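(* Let $(\Omega^{(\bullet,\bullet)},\bar\partial,\partial,\kappa)$ be a positive definite $A$-covariant Kähler structure, of total dimension $2n$, over $M$, with a state $\mathbf f$ such that $\mathbf f\circ\mathrm{vol}_\kappa$ is closed. If the complex structure $(\Omega^{(\bullet,\bullet)},\bar\partial,\partial)$ is factorisable, then the left holomorphic vector bundle $(\Omega^{(n,\bullet)},\bar\partial)$ is invertible.
   Context: **Calculi.** Everything is over $\mathbb C$. $A$ is a fixed Hopf $*$-algebra; left coactions are written $v\mapsto v_{(-1)}\otimes v_{(0)}$. An $A$-comodule $*$-algebra is a unital $*$-algebra $M$ with a left $A$-coaction that is an algebra map and commutes with $*$. An $A$-covariant differential $*$-calculus over $M$ is a graded algebra $\Omega^\bullet=\bigoplus_{k\ge 0}\Omega^k$ (product $\wedge$) with $\Omega^0=M$, a degree one map $d$ with $d^2=0$ satisfying the graded Leibniz rule, generated by $M$ as a dg algebra, with a conjugate-linear involution $*$ extending that of $M$, $(d\omega)^*=d(\omega^* )$, $(\omega\wedge\nu)^*=(-1)^{|\omega||\nu|}\nu^*\wedge\omega^*$, and a graded left $A$-coaction compatible with product, $d$ and $*$. A complex structure is an algebra $\mathbb N_0^2$-grading $\Omega^{(a,b)}$ with $\Omega^k=\bigoplus_{a+b=k}\Omega^{(a,b)}$ (as $A$-comodules and $M$-bimodules), $(\Omega^{(a,b)})^*=\Omega^{(b,a)}$ and $d=\partial+\bar\partial$, where $\partial,\bar\partial$ are the components of $d$ of bidegree $(1,0),(0,1)$. It is factorisable if $\wedge:\Omega^{(a,0)}\otimes_M\Omega^{(0,b)}\to\Omega^{(a,b)}$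 and $\wedge:\Omega^{(0,b)}\otimes_M\Omega^{(a,0)}\to\Omega^{(a,b)}$ are isomorphisms for all $a,b$. **Kähler structures.** Let $\Omega^\bullet$ have total dimension $2n$ ($\Omega^{2n}\neq0$, $\Omega^k=0$ for $k>2n$). A Kähler structure is a complex structure together with a closed, central, real ($\kappa^*=\kappa$), $A$-coinvariant form $\kappa\in\Omega^{(1,1)}$ such that, for $L(\omega)=\kappa\wedge\omega$, the maps $L^{n-k}:\Omega^k\to\Omega^{2n-k}$ are isomorphisms for $0\le k<n$. The Hodge map is determined by $\ast_H(L^j\alpha)=(-1)^{k(k+1)/2}i^{a-b}\frac{j!}{(n-j-k)!}L^{n-j-k}(\alpha)$ for $\alpha\in\Omega^{(a,b)}$ with $L^{n-k+1}\alpha=0$, $k=a+b\le n$, $0\le j\le n-k$; $\mathrm{vol}_\kappa=\ast_H|_{\Omega^{2n}}:\Omega^{2n}\to M$ is an isomorphism of $M$-bimodules. $M_{>0}$ is the set of non-zero finite sums $\sum\lambda_im_im_i^*$, $\lambda_i\ge 0$; the structure is positive definite if $\mathrm{vol}_\kappa(\omega\wedge\ast_H(\omega^* ))\in M_{>0}$ for all non-zero $\omega$ ($\mathrm{vol}_\kappa$ being zero on lower degrees). A state is a unital functional $\mathbf f$ on $M$ with $\mathbf f(M_{>0})\subseteq\mathbb R_{>0}$; $\mathbf f\circ\mathrm{vol}_\kappa$ is closed if it vanishes on $d\Omega^{2n-1}$. **Dg modules.** Let $\mathcal D=(D,\bar\partial)=(\Omega^{(0,\bullet)},\bar\partial)$,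 $D^0=M$. An $A$-comodule dg $\mathcal D$-bimodule $\mathfrak X$ belongs to ${}^A_{\mathcal D}\mathrm{dg}_0\text{-lproj}_{\mathcal D}$ if it is projective as a left $D$-module and generated as a left $D$-module by finitely many elements of degree zero. The dual ${}^\wedge\mathfrak X$ is the space of left $D$-linear maps $\phi:\mathfrak X\to D$, written on the right, $\alpha\mapsto\alpha\phi$, $(e\alpha)\phi=e(\alpha\phi)$, graded by degree; it is a dg $\mathcal D$-bimodule via $\alpha(e\phi)=(\alpha e)\phi$, $\alpha(\phi e)=(\alpha\phi)e$, $\bar\partial(\alpha\phi)=(\bar\partial\alpha)\phi+(-1)^{|\alpha|}\alpha(\bar\partial\phi)$, with $A$-coaction $\phi_{(-1)}\otimes\alpha\phi_{(0)}=S(\alpha_{(-1)})(\alpha_{(0)}\phi)_{(-1)}\otimes(\alpha_{(0)}\phi)_{(0)}$. A holomorphic vector bundle is a left $A$-comodule dg $\mathcal D$-module $\mathfrak F$ with $\Omega^{(0,\bullet)}\otimes_M\mathfrak F^0\cong\mathfrak F$ via the action and $\mathfrak F^0$ finitely generated projective as left $M$-module. $\Omega^{(n,\bullet)}$ is graded by the second index, with left action $e\cdot\omega=e\wedge\omega$ and right action $\omega\cdot e=(-1)^{n|e|}\omega\wedge e$. **Invertibility.** Let $\mathfrak X\in{}^A_{\mathcal D}\mathrm{dg}_0\text{-lproj}_{\mathcal D}$ with ${}^\wedge\mathfrak X\in{}^A_{\mathcal D}\mathrm{dg}_0\text{-lproj}_{\mathcal D}$. $\mathfrak X$ is called invertible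 if the following equivalent conditions hold: (1) the evaluation map $\mathfrak X^0\otimes_M{}^\vee(\mathfrak X^0)\to M$, $x\otimes\phi\mapsto\phi(x)$, is an isomorphism of $M$-bimodules, where ${}^\vee(\mathfrak X^0)$ is the $M$-bimodule of left $M$-linear maps $\mathfrak X^0\to M$; (2) the evaluation map $\mathfrak X\otimes_D({}^\wedge\mathfrak X)\to\mathcal D$ is an isomorphism of $D$-bimodules. *)

theory Defs
  imports Complex_Main "HOL-Library.Poly_Mapping" "HOL-Library.Function_Algebras"
begin

section \<open>Complex vector spaces and their tensor products\<close>

class complex_vector = ab_group_add +
  fixes scaleC :: "complex \<Rightarrow> 'a \<Rightarrow> 'a" (infixr "*\<^sub>C" 75)
  assumes scaleC_add_right: "c *\<^sub>C (x + y) = c *\<^sub>C x + c *\<^sub>C y"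
    and scaleC_add_left: "(b + c) *\<^sub>C x = b *\<^sub>C x + c *\<^sub>C x"
    and scaleC_scaleC: "b *\<^sub>C (c *\<^sub>C x) = (b * c) *\<^sub>C x"
    and scaleC_one: "1 *\<^sub>C x = x"

class complex_algebra_1 = complex_vector + ring_1 +
  assumes mult_scaleC_left: "(c *\<^sub>C x) * y = c *\<^sub>C (x * y)"
    and mult_scaleC_right: "x * (c *\<^sub>C y) = c *\<^sub>C (x * y)"

text \<open>Functions form a vector space pointwise; dual modules are carried by subspaces of these.\<close>

instantiation "fun" :: (type, complex_vector) complex_vector
begin

definition scaleC_fun_def: "c *\<^sub>C f = (\<lambda>x. c *\<^sub>C f x)"

instance
  by standard
    (auto simp: scaleC_fun_def fun_eq_iff scaleC_add_right scaleC_add_left scaleC_scaleC scaleC_one)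

end

abbreviation csubspace :: "'v::complex_vector set \<Rightarrow> bool"
  where "csubspace \<equiv> module.subspace scaleC"

abbreviation cspan :: "'v::complex_vector set \<Rightarrow> 'v set"
  where "cspan \<equiv> module.span scaleC"

definition clinear_on :: "'v::complex_vector set \<Rightarrow> ('v \<Rightarrow> 'w::complex_vector) \<Rightarrow> bool"
  where "clinear_on V f \<longleftrightarrow>
    (\<forall>x\<in>V. \<forall>y\<in>V. f (x + y) = f x + f y) \<and> (\<forall>c. \<forall>x\<in>V. f (c *\<^sub>C x) = c *\<^sub>C f x)"

definition cbilinear_on ::
  "'v::complex_vector set \<Rightarrow> 'w::complex_vector set \<Rightarrow> ('v \<Rightarrow> 'w \<Rightarrow> 'z::complex_vector) \<Rightarrow> bool"
  where "cbilinear_on V W \<beta> \<longleftrightarrow>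
    (\<forall>v\<in>V. clinear_on W (\<beta> v)) \<and> (\<forall>w\<in>W. clinear_on V (\<lambda>v. \<beta> v w))"

text \<open>The tensor product over the complex numbers is the free abelian group on pairs modulo
  biadditivity and balancedness over \<open>complex\<close>.\<close>

inductive_set tensor_null :: "('a::complex_vector \<times> 'b::complex_vector \<Rightarrow>\<^sub>0 int) set" where
  zero: "0 \<in> tensor_null"
| diff: "s \<in> tensor_null \<Longrightarrow> t \<in> tensor_null \<Longrightarrow> s - t \<in> tensor_null"
| add_left: "frag_of (a + a', b) - frag_of (a, b) - frag_of (a', b) \<in> tensor_null"
| add_right: "frag_of (a, b + b') - frag_of (a, b) - frag_of (a, b') \<in> tensor_null"
| scale: "frag_of (c *\<^sub>C a, b) - frag_of (a, c *\<^sub>C b) \<in> tensor_null"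

lemma tensor_null_uminus: "s \<in> tensor_null \<Longrightarrow> - s \<in> tensor_null"
  using tensor_null.diff[OF tensor_null.zero] by fastforce

lemma tensor_null_add: "s \<in> tensor_null \<Longrightarrow> t \<in> tensor_null \<Longrightarrow> s + t \<in> tensor_null"
  using tensor_null.diff[OF _ tensor_null_uminus, of s t] by simp

definition tensor_rel ::
  "('a::complex_vector \<times> 'b::complex_vector \<Rightarrow>\<^sub>0 int) \<Rightarrow> ('a \<times> 'b \<Rightarrow>\<^sub>0 int) \<Rightarrow> bool"
  where "tensor_rel s t \<longleftrightarrow> s - t \<in> tensor_null"

quotient_type (overloaded) ('a, 'b) tensor =
  "'a::complex_vector \<times> 'b::complex_vector \<Rightarrow>\<^sub>0 int" / tensor_rel
proof (rule equivpI)
  show "reflp (tensor_rel :: ('a \<times> 'b \<Rightarrow>\<^sub>0 int) \<Rightarrow> _)"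
    by (rule reflpI) (simp add: tensor_rel_def tensor_null.zero)
  show "symp (tensor_rel :: ('a \<times> 'b \<Rightarrow>\<^sub>0 int) \<Rightarrow> _)"
    by (rule sympI) (metis minus_diff_eq tensor_null_uminus tensor_rel_def)
  show "transp (tensor_rel :: ('a \<times> 'b \<Rightarrow>\<^sub>0 int) \<Rightarrow> _)"
  proof (rule transpI)
    fix s t u :: "'a \<times> 'b \<Rightarrow>\<^sub>0 int"
    assume "tensor_rel s t" "tensor_rel t u"
    then have "(s - t) + (t - u) \<in> tensor_null"
      unfolding tensor_rel_def by (rule tensor_null_add)
    then show "tensor_rel s u" by (simp add: tensor_rel_def)
  qed
qed

definition frag_scale ::
  "complex \<Rightarrow> ('a::complex_vector \<times> 'b::complex_vector \<Rightarrow>\<^sub>0 int) \<Rightarrow> ('a \<times> 'b \<Rightarrow>\<^sub>0 int)"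
  where "frag_scale c = frag_extend (\<lambda>(a, b). frag_of (c *\<^sub>C a, b))"

lemma frag_scale_zero: "frag_scale c 0 = 0"
  by (simp add: frag_scale_def)

lemma frag_scale_of: "frag_scale c (frag_of (a, b)) = frag_of (c *\<^sub>C a, b)"
  by (simp add: frag_scale_def)

lemma frag_scale_diff: "frag_scale c (s - t) = frag_scale c s - frag_scale c t"
  by (simp add: frag_scale_def frag_extend_diff)

lemma frag_scale_add: "frag_scale c (s + t) = frag_scale c s + frag_scale c t"
  by (simp add: frag_scale_def frag_extend_add)

lemma frag_scale_null: "s \<in> tensor_null \<Longrightarrow> frag_scale c s \<in> tensor_null"
proof (induction rule: tensor_null.induct)
  case zero
  then show ?case by (simp add: frag_scale_def tensor_null.zero)
next
  case (diff s t)
  then show ?case by (simp add: frag_scale_diff tensor_null.diff)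
next
  case (add_left a a' b)
  then show ?case
    by (simp add: frag_scale_diff frag_scale_of scaleC_add_right tensor_null.add_left)
next
  case (add_right a b b')
  then show ?case by (simp add: frag_scale_diff frag_scale_of tensor_null.add_right)
next
  case (scale d a b)
  have "c *\<^sub>C d *\<^sub>C a = d *\<^sub>C c *\<^sub>C a" by (simp add: scaleC_scaleC mult.commute)
  then show ?case by (simp add: frag_scale_diff frag_scale_of tensor_null.scale)
qed

instantiation tensor :: (complex_vector, complex_vector) complex_vector
begin

lift_definition zero_tensor :: "('a, 'b) tensor" is 0 .

lift_definition plus_tensor :: "('a, 'b) tensor \<Rightarrow> ('a, 'b) tensor \<Rightarrow> ('a, 'b) tensor" is "(+)"
proof -
  fix s s' t t' :: "'a \<times> 'b \<Rightarrow>\<^sub>0 int"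
  assume "tensor_rel s s'" "tensor_rel t t'"
  then have "(s - s') + (t - t') \<in> tensor_null"
    unfolding tensor_rel_def by (rule tensor_null_add)
  then show "tensor_rel (s + t) (s' + t')"
    by (simp add: tensor_rel_def add_diff_add)
qed

lift_definition uminus_tensor :: "('a, 'b) tensor \<Rightarrow> ('a, 'b) tensor" is uminus
proof -
  fix s s' :: "'a \<times> 'b \<Rightarrow>\<^sub>0 int"
  assume "tensor_rel s s'"
  then have "- (s - s') \<in> tensor_null"
    unfolding tensor_rel_def by (rule tensor_null_uminus)
  then show "tensor_rel (- s) (- s')"
    by (simp add: tensor_rel_def)
qed

lift_definition minus_tensor :: "('a, 'b) tensor \<Rightarrow> ('a, 'b) tensor \<Rightarrow> ('a, 'b) tensor" is "(-)"
proof -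
  fix s s' t t' :: "'a \<times> 'b \<Rightarrow>\<^sub>0 int"
  assume "tensor_rel s s'" "tensor_rel t t'"
  then have "(s - s') - (t - t') \<in> tensor_null"
    unfolding tensor_rel_def by (rule tensor_null.diff)
  moreover have "(s - s') - (t - t') = (s - t) - (s' - t')"
    by simp
  ultimately show "tensor_rel (s - t) (s' - t')"
    by (simp only: tensor_rel_def)
qed

lift_definition scaleC_tensor :: "complex \<Rightarrow> ('a, 'b) tensor \<Rightarrow> ('a, 'b) tensor" is frag_scale
proof -
  fix c and s s' :: "'a \<times> 'b \<Rightarrow>\<^sub>0 int"
  assume "tensor_rel s s'"
  then have "frag_scale c (s - s') \<in> tensor_null"
    unfolding tensor_rel_def by (rule frag_scale_null)
  then show "tensor_rel (frag_scale c s) (frag_scale c s')"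
    by (simp add: tensor_rel_def frag_scale_diff)
qed

instance
proof
  fix x y z :: "('a, 'b) tensor" and b c :: complex
  show "x + y + z = x + (y + z)"
    by transfer (simp add: tensor_rel_def add.assoc tensor_null.zero)
  show "x + y = y + x"
    by transfer (simp add: tensor_rel_def add.commute tensor_null.zero)
  show "0 + x = x"
    by transfer (simp add: tensor_rel_def tensor_null.zero)
  show "- x + x = 0"
    by transfer (simp add: tensor_rel_def tensor_null.zero)
  show "x - y = x + - y"
    by transfer (simp add: tensor_rel_def tensor_null.zero)
  show "c *\<^sub>C (x + y) = c *\<^sub>C x + c *\<^sub>C y"
    by transfer (simp add: tensor_rel_def frag_scale_add tensor_null.zero)
  show "(b + c) *\<^sub>C x = b *\<^sub>C x + c *\<^sub>C x"
  proof (transfer fixing: b c)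
    fix s :: "'a \<times> 'b \<Rightarrow>\<^sub>0 int"
    have "frag_scale (b + c) s - frag_scale b s - frag_scale c s \<in> tensor_null"
    proof (rule frag_induction[where S = UNIV and c = s])
      show "frag_scale (b + c) 0 - frag_scale b 0 - frag_scale c 0
          \<in> (tensor_null :: ('a \<times> 'b \<Rightarrow>\<^sub>0 int) set)"
        by (simp add: frag_scale_def tensor_null.zero)
      show "frag_scale (b + c) (frag_of p) - frag_scale b (frag_of p) - frag_scale c (frag_of p)
          \<in> tensor_null" for p :: "'a \<times> 'b"
        by (cases p) (simp only: frag_scale_of scaleC_add_left tensor_null.add_left)
      fix s t :: "'a \<times> 'b \<Rightarrow>\<^sub>0 int"
      assume "frag_scale (b + c) s - frag_scale b s - frag_scale c s \<in> tensor_null"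
        and "frag_scale (b + c) t - frag_scale b t - frag_scale c t \<in> tensor_null"
      then have "(frag_scale (b + c) s - frag_scale b s - frag_scale c s) -
          (frag_scale (b + c) t - frag_scale b t - frag_scale c t) \<in> tensor_null"
        by (rule tensor_null.diff)
      moreover have "(frag_scale (b + c) s - frag_scale b s - frag_scale c s) -
          (frag_scale (b + c) t - frag_scale b t - frag_scale c t) =
          frag_scale (b + c) (s - t) - frag_scale b (s - t) - frag_scale c (s - t)"
        by (simp add: frag_scale_diff)
      ultimately show "frag_scale (b + c) (s - t) - frag_scale b (s - t) - frag_scale c (s - t)
          \<in> tensor_null"
        by simp
    qed simp
    then show "tensor_rel (frag_scale (b + c) s) (frag_scale b s + frag_scale c s)"
      by (simp add: tensor_rel_def diff_diff_eq)
  qed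
  show "b *\<^sub>C c *\<^sub>C x = (b * c) *\<^sub>C x"
  proof (transfer fixing: b c)
    fix s :: "'a \<times> 'b \<Rightarrow>\<^sub>0 int"
    have "frag_scale b (frag_scale c s) = frag_scale (b * c) s"
    proof (rule frag_induction[where S = UNIV and c = s])
      show "frag_scale b (frag_scale c (frag_of p)) = frag_scale (b * c) (frag_of p)"
        for p :: "'a \<times> 'b"
        by (cases p) (simp add: frag_scale_of scaleC_scaleC)
    qed (simp_all add: frag_scale_diff frag_scale_zero)
    then show "tensor_rel (frag_scale b (frag_scale c s)) (frag_scale (b * c) s)"
      by (simp add: tensor_rel_def tensor_null.zero)
  qed
  show "1 *\<^sub>C x = x"
  proof transfer
    fix s :: "'a \<times> 'b \<Rightarrow>\<^sub>0 int"
    have "frag_scale 1 s = s"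
    proof (rule frag_induction[where S = UNIV and c = s])
      show "frag_scale 1 (frag_of p) = frag_of p" for p :: "'a \<times> 'b"
        by (cases p) (simp add: frag_scale_of scaleC_one)
    qed (simp_all add: frag_scale_diff frag_scale_zero)
    then show "tensor_rel (frag_scale 1 s) s"
      by (simp add: tensor_rel_def tensor_null.zero)
  qed
qed

end

lift_definition tens ::
  "'a::complex_vector \<Rightarrow> 'b::complex_vector \<Rightarrow> ('a, 'b) tensor" (infixr "\<otimes>" 70)
  is "\<lambda>a b. frag_of (a, b)" .

text \<open>For subspaces \<open>V\<close>, \<open>W\<close> the tensor product of \<open>V\<close> and \<open>W\<close> is
  identified with its image in the tensor product of the ambient spaces, the canonical map being
  injective over a field.\<close>

definition tspan ::
  "'a::complex_vector set \<Rightarrow> 'b::complex_vector set \<Rightarrow> ('a, 'b) tensor set"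
  where "tspan V W = cspan {v \<otimes> w |v w. v \<in> V \<and> w \<in> W}"

text \<open>The additive map sending \<open>v \<otimes> w\<close> to \<open>\<beta> v w\<close> for \<open>v \<in> V\<close>, \<open>w \<in> W\<close>.
  The map \<open>\<beta>\<close> needs to be defined and balanced over \<open>complex\<close> on \<open>V \<times> W\<close> only,
  so the representing formal sum has to be chosen with support there. Balancedness, rather than
  bilinearity, suffices; this covers the conjugate linear \<open>* \<otimes> *\<close>.\<close>

definition tensor_lift_on ::
  "'a::complex_vector set \<Rightarrow> 'b::complex_vector set \<Rightarrow> ('a \<Rightarrow> 'b \<Rightarrow> 'z::complex_vector) \<Rightarrow>
    ('a, 'b) tensor \<Rightarrow> 'z"
  where "tensor_lift_on V W \<beta> t =
    (let s = (SOME s. Poly_Mapping.keys s \<subseteq> V \<times> W \<and> abs_tensor s = t)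
     in \<Sum>(v, w)\<in>Poly_Mapping.keys s. of_int (Poly_Mapping.lookup s (v, w)) *\<^sub>C \<beta> v w)"

abbreviation tensor_lift ::
  "('a::complex_vector \<Rightarrow> 'b::complex_vector \<Rightarrow> 'z::complex_vector) \<Rightarrow> ('a, 'b) tensor \<Rightarrow> 'z"
  where "tensor_lift \<equiv> tensor_lift_on UNIV UNIV"

definition tensor_assoc ::
  "(('a::complex_vector, 'b::complex_vector) tensor, 'c::complex_vector) tensor \<Rightarrow>
    ('a, ('b, 'c) tensor) tensor"
  where "tensor_assoc = tensor_lift (\<lambda>t c. tensor_lift (\<lambda>a b. a \<otimes> b \<otimes> c) t)"

text \<open>The product \<open>(a \<otimes> v)(b \<otimes> w) = ab \<otimes> \<beta> v w\<close>.\<close>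

definition tensor_prod ::
  "'v::complex_vector set \<Rightarrow> 'w::complex_vector set \<Rightarrow> ('v \<Rightarrow> 'w \<Rightarrow> 'z::complex_vector) \<Rightarrow>
    ('a::complex_algebra_1, 'v) tensor \<Rightarrow> ('a, 'w) tensor \<Rightarrow> ('a, 'z) tensor"
  where "tensor_prod V W \<beta> s t =
    tensor_lift_on UNIV V (\<lambda>a v. tensor_lift_on UNIV W (\<lambda>b w. (a * b) \<otimes> \<beta> v w) t) s"

definition balanced_null ::
  "'r set \<Rightarrow> ('v \<Rightarrow> 'r \<Rightarrow> 'v) \<Rightarrow> 'v::complex_vector set \<Rightarrow> ('r \<Rightarrow> 'w \<Rightarrow> 'w) \<Rightarrow>
    'w::complex_vector set \<Rightarrow> ('v, 'w) tensor set"
  where "balanced_null R rV V lW W =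
    cspan {rV v r \<otimes> w - v \<otimes> lW r w |v r w. v \<in> V \<and> r \<in> R \<and> w \<in> W}"

text \<open>The tensor product over \<open>R\<close> of a right module \<open>V\<close> and a left module \<open>W\<close>.\<close>

definition balanced_tensor ::
  "'r set \<Rightarrow> ('v \<Rightarrow> 'r \<Rightarrow> 'v) \<Rightarrow> 'v::complex_vector set \<Rightarrow> ('r \<Rightarrow> 'w \<Rightarrow> 'w) \<Rightarrow>
    'w::complex_vector set \<Rightarrow> ('v, 'w) tensor set set"
  where "balanced_tensor R rV V lW W =
    tspan V W // {(s, t). s \<in> tspan V W \<and> t \<in> tspan V W \<and> s - t \<in> balanced_null R rV V lW W}"

definition induced_map ::
  "'v::complex_vector set \<Rightarrow> 'w::complex_vector set \<Rightarrow> ('v \<Rightarrow> 'w \<Rightarrow> 'z::complex_vector) \<Rightarrow>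
    ('v, 'w) tensor set \<Rightarrow> 'z"
  where "induced_map V W \<beta> C = tensor_lift_on V W \<beta> (SOME t. t \<in> C)"

definition tensor_iso ::
  "'r set \<Rightarrow> ('v \<Rightarrow> 'r \<Rightarrow> 'v) \<Rightarrow> 'v::complex_vector set \<Rightarrow> ('r \<Rightarrow> 'w \<Rightarrow> 'w) \<Rightarrow>
    'w::complex_vector set \<Rightarrow> ('v \<Rightarrow> 'w \<Rightarrow> 'z::complex_vector) \<Rightarrow> 'z set \<Rightarrow> bool"
  where "tensor_iso R rV V lW W \<beta> Z \<longleftrightarrow>
    cbilinear_on V W \<beta> \<and> (\<forall>v\<in>V. \<forall>w\<in>W. \<beta> v w \<in> Z) \<and>
    (\<forall>v\<in>V. \<forall>r\<in>R. \<forall>w\<in>W. \<beta> (rV v r) w = \<beta> v (lW r w)) \<and>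
    bij_betw (induced_map V W \<beta>) (balanced_tensor R rV V lW W) Z"

definition is_decomposition ::
  "'i set \<Rightarrow> ('i \<Rightarrow> 'v::complex_vector set) \<Rightarrow> 'v \<Rightarrow> ('i \<Rightarrow> 'v) \<Rightarrow> bool"
  where "is_decomposition I F x f \<longleftrightarrow>
    (\<forall>i\<in>I. f i \<in> F i) \<and> (\<forall>i. i \<notin> I \<longrightarrow> f i = 0) \<and> finite {i. f i \<noteq> 0} \<and>
    x = (\<Sum>i | f i \<noteq> 0. f i)"

definition is_direct_sum ::
  "'i set \<Rightarrow> ('i \<Rightarrow> 'v::complex_vector set) \<Rightarrow> 'v set \<Rightarrow> bool"
  where "is_direct_sum I F S \<longleftrightarrow>
    csubspace S \<and> (\<forall>i\<in>I. csubspace (F i) \<and> F i \<subseteq> S) \<and> (\<forall>x\<in>S. \<exists>!f. is_decomposition I F x f)"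

definition hcomponent :: "(nat \<Rightarrow> 'v::complex_vector set) \<Rightarrow> nat \<Rightarrow> 'v \<Rightarrow> 'v"
  where "hcomponent F k x = (THE f. is_decomposition UNIV F x f) k"


section \<open>Hopf *-algebras and comodules\<close>

record (overloaded) ('a::complex_algebra_1) hopf =
  comult :: "'a \<Rightarrow> ('a, 'a) tensor"
  counit :: "'a \<Rightarrow> complex"
  antipode :: "'a \<Rightarrow> 'a"
  hstar :: "'a \<Rightarrow> 'a"

definition conjugate_linear_involution :: "('v::complex_vector \<Rightarrow> 'v) \<Rightarrow> bool"
  where "conjugate_linear_involution s \<longleftrightarrow>
    (\<forall>x y. s (x + y) = s x + s y) \<and> (\<forall>c x. s (c *\<^sub>C x) = cnj c *\<^sub>C s x) \<and> (\<forall>x. s (s x) = x)"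

definition hopf_star_algebra :: "('a::complex_algebra_1) hopf \<Rightarrow> bool"
  where "hopf_star_algebra H \<longleftrightarrow>
    clinear_on UNIV (comult H) \<and>
    comult H 1 = 1 \<otimes> 1 \<and>
    (\<forall>x y. comult H (x * y) = tensor_prod UNIV UNIV (*) (comult H x) (comult H y)) \<and>
    (\<forall>x. tensor_lift (\<lambda>a b. tensor_assoc (comult H a \<otimes> b)) (comult H x) =
         tensor_lift (\<lambda>a b. a \<otimes> comult H b) (comult H x)) \<and>
    (\<forall>x y. counit H (x + y) = counit H x + counit H y) \<and>
    (\<forall>c x. counit H (c *\<^sub>C x) = c * counit H x) \<and>
    counit H 1 = 1 \<and>
    (\<forall>x y. counit H (x * y) = counit H x * counit H y) \<and>
    (\<forall>x. tensor_lift (\<lambda>a b. counit H a *\<^sub>C b) (comult H x) = x) \<and>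
    (\<forall>x. tensor_lift (\<lambda>a b. counit H b *\<^sub>C a) (comult H x) = x) \<and>
    clinear_on UNIV (antipode H) \<and>
    (\<forall>x. tensor_lift (\<lambda>a b. antipode H a * b) (comult H x) = counit H x *\<^sub>C 1) \<and>
    (\<forall>x. tensor_lift (\<lambda>a b. a * antipode H b) (comult H x) = counit H x *\<^sub>C 1) \<and>
    conjugate_linear_involution (hstar H) \<and>
    (\<forall>x y. hstar H (x * y) = hstar H y * hstar H x) \<and>
    (\<forall>x. comult H (hstar H x) = tensor_lift (\<lambda>a b. hstar H a \<otimes> hstar H b) (comult H x))"

definition is_comodule ::
  "('a::complex_algebra_1) hopf \<Rightarrow> 'v::complex_vector set \<Rightarrow> ('v \<Rightarrow> ('a, 'v) tensor) \<Rightarrow> bool"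
  where "is_comodule H V \<delta> \<longleftrightarrow>
    clinear_on V \<delta> \<and> (\<forall>v\<in>V. \<delta> v \<in> tspan UNIV V) \<and>
    (\<forall>v\<in>V. tensor_lift_on UNIV V (\<lambda>a w. tensor_assoc (comult H a \<otimes> w)) (\<delta> v) =
           tensor_lift_on UNIV V (\<lambda>a w. a \<otimes> \<delta> w) (\<delta> v)) \<and>
    (\<forall>v\<in>V. tensor_lift_on UNIV V (\<lambda>a w. counit H a *\<^sub>C w) (\<delta> v) = v)"


section \<open>Covariant differential *-calculi and complex structures\<close>

text \<open>The total algebra of forms is the type \<open>'w\<close>, its multiplication is the wedge product, and the
  base algebra \<open>M\<close> is \<open>forms C 0\<close>, with the structure restricted from \<open>'w\<close>.\<close>

record (overloaded) ('a::complex_algebra_1, 'w::complex_algebra_1) calculus =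
  forms :: "nat \<Rightarrow> 'w set"
  dif :: "'w \<Rightarrow> 'w"
  star :: "'w \<Rightarrow> 'w"
  coact :: "'w \<Rightarrow> ('a, 'w) tensor"

inductive_set dg_generated :: "('w::complex_algebra_1 \<Rightarrow> 'w) \<Rightarrow> 'w set \<Rightarrow> 'w set"
  for d :: "'w \<Rightarrow> 'w" and M :: "'w set" where
  base: "m \<in> M \<Longrightarrow> m \<in> dg_generated d M"
| add: "x \<in> dg_generated d M \<Longrightarrow> y \<in> dg_generated d M \<Longrightarrow> x + y \<in> dg_generated d M"
| scale: "x \<in> dg_generated d M \<Longrightarrow> c *\<^sub>C x \<in> dg_generated d M"
| mult: "x \<in> dg_generated d M \<Longrightarrow> y \<in> dg_generated d M \<Longrightarrow> x * y \<in> dg_generated d M"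
| dif: "x \<in> dg_generated d M \<Longrightarrow> d x \<in> dg_generated d M"

definition covariant_star_calculus ::
  "('a::complex_algebra_1) hopf \<Rightarrow> ('a, 'w::complex_algebra_1, 'm) calculus_scheme \<Rightarrow> bool"
  where "covariant_star_calculus H C \<longleftrightarrow>
    is_direct_sum UNIV (forms C) UNIV \<and>
    1 \<in> forms C 0 \<and>
    (\<forall>k l. \<forall>x\<in>forms C k. \<forall>y\<in>forms C l. x * y \<in> forms C (k + l)) \<and>
    clinear_on UNIV (dif C) \<and>
    (\<forall>k. \<forall>x\<in>forms C k. dif C x \<in> forms C (Suc k)) \<and>
    (\<forall>x. dif C (dif C x) = 0) \<and>
    (\<forall>k. \<forall>x\<in>forms C k. \<forall>y. dif C (x * y) = dif C x * y + (-1) ^ k * (x * dif C y)) \<and>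
    dg_generated (dif C) (forms C 0) = UNIV \<and>
    conjugate_linear_involution (star C) \<and>
    (\<forall>k. \<forall>x\<in>forms C k. star C x \<in> forms C k) \<and>
    (\<forall>x. star C (dif C x) = dif C (star C x)) \<and>
    (\<forall>k l. \<forall>x\<in>forms C k. \<forall>y\<in>forms C l.
        star C (x * y) = (-1) ^ (k * l) * (star C y * star C x)) \<and>
    is_comodule H UNIV (coact C) \<and>
    (\<forall>k. \<forall>x\<in>forms C k. coact C x \<in> tspan UNIV (forms C k)) \<and>
    coact C 1 = 1 \<otimes> 1 \<and>
    (\<forall>x y. coact C (x * y) = tensor_prod UNIV UNIV (*) (coact C x) (coact C y)) \<and>
    (\<forall>x. coact C (dif C x) = tensor_lift (\<lambda>a w. a \<otimes> dif C w) (coact C x)) \<and>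
    (\<forall>x. coact C (star C x) = tensor_lift (\<lambda>a w. hstar H a \<otimes> star C w) (coact C x))"

record (overloaded) ('a::complex_algebra_1, 'w::complex_algebra_1) cplx_calculus = "('a, 'w) calculus" +
  bforms :: "nat \<Rightarrow> nat \<Rightarrow> 'w set"
  del :: "'w \<Rightarrow> 'w"
  delbar :: "'w \<Rightarrow> 'w"

definition complex_structure ::
  "('a::complex_algebra_1) hopf \<Rightarrow> ('a, 'w::complex_algebra_1, 'm) cplx_calculus_scheme \<Rightarrow> bool"
  where "complex_structure H C \<longleftrightarrow>
    covariant_star_calculus H C \<and>
    (\<forall>k. is_direct_sum {(a, b). a + b = k} (\<lambda>(a, b). bforms C a b) (forms C k)) \<and>
    (\<forall>a b a' b'. \<forall>x\<in>bforms C a b. \<forall>y\<in>bforms C a' b'. x * y \<in> bforms C (a + a') (b + b')) \<and>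
    (\<forall>a b. \<forall>x\<in>bforms C a b. coact C x \<in> tspan UNIV (bforms C a b)) \<and>
    (\<forall>a b. star C ` bforms C a b = bforms C b a) \<and>
    clinear_on UNIV (del C) \<and> clinear_on UNIV (delbar C) \<and>
    (\<forall>a b. \<forall>x\<in>bforms C a b. del C x \<in> bforms C (Suc a) b \<and> delbar C x \<in> bforms C a (Suc b)) \<and>
    (\<forall>x. dif C x = del C x + delbar C x)"

definition factorisable :: "('a::complex_algebra_1, 'w::complex_algebra_1, 'm) cplx_calculus_scheme \<Rightarrow> bool"
  where "factorisable C \<longleftrightarrow> (\<forall>a b.
    tensor_iso (forms C 0) (*) (bforms C a 0) (*) (bforms C 0 b) (*) (bforms C a b) \<and>
    tensor_iso (forms C 0) (*) (bforms C 0 b) (*) (bforms C a 0) (*) (bforms C a b))"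


section \<open>Kaehler structures\<close>

record (overloaded) ('a::complex_algebra_1, 'w::complex_algebra_1) kaehler = "('a, 'w) cplx_calculus" +
  kform :: "'w"

definition lefschetz :: "('a::complex_algebra_1, 'w::complex_algebra_1, 'm) kaehler_scheme \<Rightarrow> 'w \<Rightarrow> 'w"
  where "lefschetz K \<omega> = kform K * \<omega>"

definition kaehler_structure ::
  "('a::complex_algebra_1) hopf \<Rightarrow> nat \<Rightarrow> ('a, 'w::complex_algebra_1, 'm) kaehler_scheme \<Rightarrow> bool"
  where "kaehler_structure H n K \<longleftrightarrow>
    complex_structure H K \<and>
    forms K (2 * n) \<noteq> {0} \<and> (\<forall>k > 2 * n. forms K k = {0}) \<and>
    kform K \<in> bforms K 1 1 \<and>
    dif K (kform K) = 0 \<and>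
    (\<forall>\<omega>. kform K * \<omega> = \<omega> * kform K) \<and>
    star K (kform K) = kform K \<and>
    coact K (kform K) = 1 \<otimes> kform K \<and>
    (\<forall>k < n. bij_betw (lefschetz K ^^ (n - k)) (forms K k) (forms K (2 * n - k)))"

definition is_hodge_map ::
  "nat \<Rightarrow> ('a::complex_algebra_1, 'w::complex_algebra_1, 'm) kaehler_scheme \<Rightarrow> ('w \<Rightarrow> 'w) \<Rightarrow> bool"
  where "is_hodge_map n K h \<longleftrightarrow>
    clinear_on UNIV h \<and>
    (\<forall>a b k j. \<forall>\<alpha>\<in>bforms K a b. k = a + b \<and> k \<le> n \<and> j \<le> n - k \<and>
        (lefschetz K ^^ (n - k + 1)) \<alpha> = 0 \<longrightarrow>
      h ((lefschetz K ^^ j) \<alpha>) =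
        ((-1) ^ (k * (k + 1) div 2) * \<i> powi (int a - int b) * (fact j / fact (n - j - k))) *\<^sub>C
          (lefschetz K ^^ (n - j - k)) \<alpha>)"

definition hodge ::
  "nat \<Rightarrow> ('a::complex_algebra_1, 'w::complex_algebra_1, 'm) kaehler_scheme \<Rightarrow> 'w \<Rightarrow> 'w"
  where "hodge n K = (THE h. is_hodge_map n K h)"

definition vol ::
  "nat \<Rightarrow> ('a::complex_algebra_1, 'w::complex_algebra_1, 'm) kaehler_scheme \<Rightarrow> 'w \<Rightarrow> 'w"
  where "vol n K \<omega> = hodge n K (hcomponent (forms K) (2 * n) \<omega>)"

definition positive_elements :: "('a::complex_algebra_1, 'w::complex_algebra_1, 'm) calculus_scheme \<Rightarrow> 'w set"
  where "positive_elements C =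
    {x. x \<noteq> 0 \<and> (\<exists>(N::nat) (r :: nat \<Rightarrow> real) m. (\<forall>i<N. 0 \<le> r i \<and> m i \<in> forms C 0) \<and>
          x = (\<Sum>i<N. complex_of_real (r i) *\<^sub>C (m i * star C (m i))))}"

definition positive_definite ::
  "nat \<Rightarrow> ('a::complex_algebra_1, 'w::complex_algebra_1, 'm) kaehler_scheme \<Rightarrow> bool"
  where "positive_definite n K \<longleftrightarrow>
    (\<forall>\<omega>. \<omega> \<noteq> 0 \<longrightarrow> vol n K (\<omega> * hodge n K (star K \<omega>)) \<in> positive_elements K)"

text \<open>Only the restriction of \<open>f\<close> to \<open>M = forms C 0\<close> is relevant.\<close>

definition is_state ::
  "('a::complex_algebra_1, 'w::complex_algebra_1, 'm) calculus_scheme \<Rightarrow> ('w \<Rightarrow> complex) \<Rightarrow> bool"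
  where "is_state C f \<longleftrightarrow>
    (\<forall>x\<in>forms C 0. \<forall>y\<in>forms C 0. f (x + y) = f x + f y) \<and>
    (\<forall>c. \<forall>x\<in>forms C 0. f (c *\<^sub>C x) = c * f x) \<and>
    f 1 = 1 \<and>
    (\<forall>x\<in>positive_elements C. \<exists>r>0. f x = complex_of_real r)"

text \<open>The premise \<open>Suc k = 2 * n\<close> avoids truncated subtraction for \<open>n = 0\<close>.\<close>

definition closed_integral ::
  "nat \<Rightarrow> ('a::complex_algebra_1, 'w::complex_algebra_1, 'm) kaehler_scheme \<Rightarrow> ('w \<Rightarrow> complex) \<Rightarrow> bool"
  where "closed_integral n K f \<longleftrightarrow>
    (\<forall>k. \<forall>\<omega>\<in>forms K k. Suc k = 2 * n \<longrightarrow> f (vol n K (dif K \<omega>)) = 0)"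


section \<open>Modules over a subring\<close>

text \<open>\<open>R\<close> is a subring of \<open>'w\<close> and \<open>V\<close> a left \<open>R\<close>-module with action \<open>l\<close>.
  Homomorphisms are extended by zero outside \<open>V\<close>, so that they are determined by their
  restriction to \<open>V\<close>.\<close>

definition left_hom ::
  "'w::complex_algebra_1 set \<Rightarrow> ('w \<Rightarrow> 'x \<Rightarrow> 'x) \<Rightarrow> 'x::complex_vector set \<Rightarrow> ('x \<Rightarrow> 'w) set"
  where "left_hom R l V =
    {\<phi>. (\<forall>x\<in>V. \<phi> x \<in> R) \<and> (\<forall>x\<in>V. \<forall>y\<in>V. \<phi> (x + y) = \<phi> x + \<phi> y) \<and>
        (\<forall>r\<in>R. \<forall>x\<in>V. \<phi> (l r x) = r * \<phi> x) \<and> (\<forall>x. x \<notin> V \<longrightarrow> \<phi> x = 0)}"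

definition free_left_module ::
  "'w::complex_algebra_1 set \<Rightarrow> 'j set \<Rightarrow> ('j \<Rightarrow>\<^sub>0 'w) set"
  where "free_left_module R J =
    {f. Poly_Mapping.keys f \<subseteq> J \<and> (\<forall>j. Poly_Mapping.lookup f j \<in> R)}"

text \<open>Projective: a direct summand of a free module. Index sets \<open>J :: 'x set\<close> suffice, since the
  canonical surjection from the free module on the set \<open>V\<close> onto a projective \<open>V\<close> splits.\<close>

definition left_projective ::
  "'w::complex_algebra_1 set \<Rightarrow> ('w \<Rightarrow> 'x \<Rightarrow> 'x) \<Rightarrow> 'x::complex_vector set \<Rightarrow> bool"
  where "left_projective R l V \<longleftrightarrow>
    (\<exists>(J :: 'x set) (s :: 'x \<Rightarrow> ('x \<Rightarrow>\<^sub>0 'w)) (p :: ('x \<Rightarrow>\<^sub>0 'w) \<Rightarrow> 'x).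
      (\<forall>x\<in>V. s x \<in> free_left_module R J) \<and>
      (\<forall>x\<in>V. \<forall>y\<in>V. s (x + y) = s x + s y) \<and>
      (\<forall>r\<in>R. \<forall>x\<in>V. s (l r x) = Poly_Mapping.map ((*) r) (s x)) \<and>
      (\<forall>f\<in>free_left_module R J. p f \<in> V) \<and>
      (\<forall>f\<in>free_left_module R J. \<forall>g\<in>free_left_module R J. p (f + g) = p f + p g) \<and>
      (\<forall>r\<in>R. \<forall>f\<in>free_left_module R J. p (Poly_Mapping.map ((*) r) f) = l r (p f)) \<and>
      (\<forall>x\<in>V. p (s x) = x))"

definition finitely_generated_by ::
  "'w::complex_algebra_1 set \<Rightarrow> ('w \<Rightarrow> 'x \<Rightarrow> 'x) \<Rightarrow> 'x::complex_vector set \<Rightarrow> 'x set \<Rightarrow> bool"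
  where "finitely_generated_by R l G V \<longleftrightarrow>
    finite G \<and> G \<subseteq> V \<and> (\<forall>x\<in>V. \<exists>e. (\<forall>g\<in>G. e g \<in> R) \<and> x = (\<Sum>g\<in>G. l (e g) g))"

text \<open>Evaluation \<open>x \<otimes> \<phi> \<mapsto> \<phi> x\<close> is an isomorphism of \<open>R\<close>-bimodules from the tensor product
  over \<open>R\<close> of \<open>V\<close> and \<open>W\<close> onto \<open>R\<close>, for bimodules \<open>V\<close> and \<open>W\<close> with
  left and right actions \<open>lV\<close>, \<open>rV\<close> and \<open>lW\<close>, \<open>rW\<close>.\<close>

definition evaluation_bimodule_iso ::
  "'w::complex_algebra_1 set \<Rightarrow> ('w \<Rightarrow> 'x \<Rightarrow> 'x) \<Rightarrow> ('x \<Rightarrow> 'w \<Rightarrow> 'x) \<Rightarrow> 'x::complex_vector set \<Rightarrow>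
    ('w \<Rightarrow> ('x \<Rightarrow> 'w) \<Rightarrow> ('x \<Rightarrow> 'w)) \<Rightarrow> (('x \<Rightarrow> 'w) \<Rightarrow> 'w \<Rightarrow> ('x \<Rightarrow> 'w)) \<Rightarrow> ('x \<Rightarrow> 'w) set \<Rightarrow> bool"
  where "evaluation_bimodule_iso R lV rV V lW rW W \<longleftrightarrow>
    tensor_iso R rV V lW W (\<lambda>x \<phi>. \<phi> x) R \<and>
    (\<forall>r\<in>R. \<forall>x\<in>V. \<forall>\<phi>\<in>W. \<phi> (lV r x) = r * \<phi> x \<and> rW \<phi> r x = \<phi> x * r)"


section \<open>Dg modules over the Dolbeault algebra\<close>

definition dolb :: "('a::complex_algebra_1, 'w::complex_algebra_1, 'm) cplx_calculus_scheme \<Rightarrow> 'w set"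
  where "dolb C = cspan (\<Union>b. bforms C 0 b)"

record (overloaded) ('a::complex_algebra_1, 'w::complex_algebra_1, 'x::complex_vector) dgmod =
  mcomp :: "nat \<Rightarrow> 'x set"
  lact :: "'w \<Rightarrow> 'x \<Rightarrow> 'x"
  ract :: "'x \<Rightarrow> 'w \<Rightarrow> 'x"
  mdif :: "'x \<Rightarrow> 'x"
  mcoact :: "'x \<Rightarrow> ('a, 'x) tensor"

definition mcarrier :: "('a::complex_algebra_1, 'w::complex_algebra_1, 'x::complex_vector) dgmod \<Rightarrow> 'x set"
  where "mcarrier X = cspan (\<Union>k. mcomp X k)"

definition comodule_left_dg_module ::
  "('a::complex_algebra_1) hopf \<Rightarrow> ('a, 'w::complex_algebra_1, 'm) cplx_calculus_scheme \<Rightarrow>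
    ('a, 'w, 'x::complex_vector) dgmod \<Rightarrow> bool"
  where "comodule_left_dg_module H C X \<longleftrightarrow>
    is_direct_sum UNIV (mcomp X) (mcarrier X) \<and>
    cbilinear_on (dolb C) (mcarrier X) (lact X) \<and>
    (\<forall>i j. \<forall>e\<in>bforms C 0 i. \<forall>x\<in>mcomp X j. lact X e x \<in> mcomp X (i + j)) \<and>
    (\<forall>x\<in>mcarrier X. lact X 1 x = x) \<and>
    (\<forall>e\<in>dolb C. \<forall>f\<in>dolb C. \<forall>x\<in>mcarrier X. lact X (e * f) x = lact X e (lact X f x)) \<and>
    clinear_on (mcarrier X) (mdif X) \<and>
    (\<forall>j. \<forall>x\<in>mcomp X j. mdif X x \<in> mcomp X (Suc j)) \<and>
    (\<forall>x\<in>mcarrier X. mdif X (mdif X x) = 0) \<and>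
    (\<forall>i. \<forall>e\<in>bforms C 0 i. \<forall>x\<in>mcarrier X.
        mdif X (lact X e x) = lact X (delbar C e) x + (-1) ^ i *\<^sub>C lact X e (mdif X x)) \<and>
    is_comodule H (mcarrier X) (mcoact X) \<and>
    (\<forall>j. \<forall>x\<in>mcomp X j. mcoact X x \<in> tspan UNIV (mcomp X j)) \<and>
    (\<forall>e\<in>dolb C. \<forall>x\<in>mcarrier X. mcoact X (lact X e x) =
        tensor_prod (dolb C) (mcarrier X) (lact X) (coact C e) (mcoact X x)) \<and>
    (\<forall>x\<in>mcarrier X. mcoact X (mdif X x) =
        tensor_lift_on UNIV (mcarrier X) (\<lambda>a y. a \<otimes> mdif X y) (mcoact X x))"

definition comodule_dg_bimodule ::
  "('a::complex_algebra_1) hopf \<Rightarrow> ('a, 'w::complex_algebra_1, 'm) cplx_calculus_scheme \<Rightarrow>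
    ('a, 'w, 'x::complex_vector) dgmod \<Rightarrow> bool"
  where "comodule_dg_bimodule H C X \<longleftrightarrow>
    comodule_left_dg_module H C X \<and>
    cbilinear_on (mcarrier X) (dolb C) (ract X) \<and>
    (\<forall>i j. \<forall>e\<in>bforms C 0 i. \<forall>x\<in>mcomp X j. ract X x e \<in> mcomp X (j + i)) \<and>
    (\<forall>x\<in>mcarrier X. ract X x 1 = x) \<and>
    (\<forall>e\<in>dolb C. \<forall>f\<in>dolb C. \<forall>x\<in>mcarrier X. ract X x (e * f) = ract X (ract X x e) f) \<and>
    (\<forall>e\<in>dolb C. \<forall>f\<in>dolb C. \<forall>x\<in>mcarrier X. ract X (lact X e x) f = lact X e (ract X x f)) \<and>
    (\<forall>j. \<forall>x\<in>mcomp X j. \<forall>e\<in>dolb C.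
        mdif X (ract X x e) = ract X (mdif X x) e + (-1) ^ j *\<^sub>C ract X x (delbar C e)) \<and>
    (\<forall>e\<in>dolb C. \<forall>x\<in>mcarrier X. mcoact X (ract X x e) =
        tensor_prod (mcarrier X) (dolb C) (ract X) (mcoact X x) (coact C e))"

text \<open>The category of comodule dg bimodules that are projective as left modules over the
  Dolbeault algebra and finitely generated in degree zero.\<close>

definition dg0_lproj ::
  "('a::complex_algebra_1) hopf \<Rightarrow> ('a, 'w::complex_algebra_1, 'm) cplx_calculus_scheme \<Rightarrow>
    ('a, 'w, 'x::complex_vector) dgmod \<Rightarrow> bool"
  where "dg0_lproj H C X \<longleftrightarrow>
    comodule_dg_bimodule H C X \<and>
    left_projective (dolb C) (lact X) (mcarrier X) \<and>
    (\<exists>G \<subseteq> mcomp X 0. finitely_generated_by (dolb C) (lact X) G (mcarrier X))"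

definition holomorphic_vector_bundle ::
  "('a::complex_algebra_1) hopf \<Rightarrow> ('a, 'w::complex_algebra_1, 'm) cplx_calculus_scheme \<Rightarrow>
    ('a, 'w, 'x::complex_vector) dgmod \<Rightarrow> bool"
  where "holomorphic_vector_bundle H C F \<longleftrightarrow>
    comodule_left_dg_module H C F \<and>
    tensor_iso (forms C 0) (*) (dolb C) (lact F) (mcomp F 0) (lact F) (mcarrier F) \<and>
    left_projective (forms C 0) (lact F) (mcomp F 0) \<and>
    (\<exists>G. finitely_generated_by (forms C 0) (lact F) G (mcomp F 0))"

text \<open>\<open>Y\<close> is the dual of \<open>X\<close>, i.e. the dg bimodule of left module maps to the
  Dolbeault algebra; the value of \<open>\<phi>\<close> at \<open>\<alpha>\<close>, written \<open>\<alpha>\<phi>\<close> below, is \<open>\<phi> \<alpha>\<close>. Differential and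
  coaction are determined by the defining equations (coaction:
  \<open>\<phi>\<^bsub>(-1)\<^esub> \<otimes> \<alpha>\<phi>\<^bsub>(0)\<^esub> = S(\<alpha>\<^bsub>(-1)\<^esub>) (\<alpha>\<^bsub>(0)\<^esub>\<phi>)\<^bsub>(-1)\<^esub> \<otimes> (\<alpha>\<^bsub>(0)\<^esub>\<phi>)\<^bsub>(0)\<^esub>\<close>).\<close>

definition is_dual ::
  "('a::complex_algebra_1) hopf \<Rightarrow> ('a, 'w::complex_algebra_1, 'm) cplx_calculus_scheme \<Rightarrow>
    ('a, 'w, 'x::complex_vector) dgmod \<Rightarrow> ('a, 'w, 'x \<Rightarrow> 'w) dgmod \<Rightarrow> bool"
  where "is_dual H C X Y \<longleftrightarrow>
    mcarrier Y = left_hom (dolb C) (lact X) (mcarrier X) \<and>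
    (\<forall>k. mcomp Y k =
      {\<phi> \<in> left_hom (dolb C) (lact X) (mcarrier X). \<forall>j. \<forall>\<alpha>\<in>mcomp X j. \<phi> \<alpha> \<in> bforms C 0 (j + k)}) \<and>
    (\<forall>\<phi>\<in>mcarrier Y. \<forall>e\<in>dolb C.
        lact Y e \<phi> = (\<lambda>\<alpha>. if \<alpha> \<in> mcarrier X then \<phi> (ract X \<alpha> e) else 0) \<and>
        ract Y \<phi> e = (\<lambda>\<alpha>. \<phi> \<alpha> * e)) \<and>
    (\<forall>\<phi>\<in>mcarrier Y. mdif Y \<phi> \<in> mcarrier Y \<and>
        (\<forall>j. \<forall>\<alpha>\<in>mcomp X j. delbar C (\<phi> \<alpha>) = \<phi> (mdif X \<alpha>) + (-1) ^ j *\<^sub>C mdif Y \<phi> \<alpha>)) \<and>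
    (\<forall>\<phi>\<in>mcarrier Y. mcoact Y \<phi> \<in> tspan UNIV (mcarrier Y) \<and>
        (\<forall>\<alpha>\<in>mcarrier X.
          tensor_lift_on UNIV (mcarrier Y) (\<lambda>a \<psi>. a \<otimes> \<psi> \<alpha>) (mcoact Y \<phi>) =
          tensor_lift_on UNIV (mcarrier X)
            (\<lambda>a \<alpha>'. tensor_lift (\<lambda>b e. (antipode H a * b) \<otimes> e) (coact C (\<phi> \<alpha>'))) (mcoact X \<alpha>)))"

text \<open>Both of the (equivalent) conditions defining invertibility are required.\<close>

definition invertible ::
  "('a::complex_algebra_1) hopf \<Rightarrow> ('a, 'w::complex_algebra_1, 'm) cplx_calculus_scheme \<Rightarrow>
    ('a, 'w, 'x::complex_vector) dgmod \<Rightarrow> bool"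
  where "invertible H C X \<longleftrightarrow>
    dg0_lproj H C X \<and>
    evaluation_bimodule_iso (forms C 0) (lact X) (ract X) (mcomp X 0)
      (\<lambda>m \<phi> x. if x \<in> mcomp X 0 then \<phi> (ract X x m) else 0) (\<lambda>\<phi> m x. \<phi> x * m)
      (left_hom (forms C 0) (lact X) (mcomp X 0)) \<and>
    (\<exists>Y. is_dual H C X Y \<and> dg0_lproj H C Y \<and>
      evaluation_bimodule_iso (dolb C) (lact X) (ract X) (mcarrier X) (lact Y) (ract Y) (mcarrier Y))"

definition sign_twist ::
  "nat \<Rightarrow> ('a::complex_algebra_1, 'w::complex_algebra_1, 'm) calculus_scheme \<Rightarrow> 'w \<Rightarrow> 'w"
  where "sign_twist n C e =
    (\<Sum>k | hcomponent (forms C) k e \<noteq> 0. (-1) ^ (n * k) *\<^sub>C hcomponent (forms C) k e)"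

text \<open>The forms of bidegree \<open>(n, \<bullet>)\<close>, with \<open>\<omega> \<cdot> e = (-1)\<^bsup>n|e|\<^esup> \<omega> \<and> e\<close>.\<close>

definition canonical_bundle ::
  "nat \<Rightarrow> ('a::complex_algebra_1, 'w::complex_algebra_1, 'm) cplx_calculus_scheme \<Rightarrow> ('a, 'w, 'w) dgmod"
  where "canonical_bundle n C =
    \<lparr>mcomp = bforms C n, lact = (*), ract = (\<lambda>\<omega> e. \<omega> * sign_twist n C e),
     mdif = delbar C, mcoact = coact C\<rparr>"

end

theory Submission
  imports Defs
begin

text \<open>Put \<open>M = \<Omega>\<^sup>0\<close>, \<open>P = \<Omega>\<^bsup>(n,0)\<^esup>\<close>, \<open>Q = \<Omega>\<^bsup>(0,n)\<^esup>\<close>, and let \<open>D\<close> and \<open>X\<close> be the rows of bidegrees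
  \<open>(0,\<bullet>)\<close> and \<open>(n,\<bullet>)\<close>. The \<open>n\<close>-th power \<open>\<kappa>\<close> of the Kaehler form is central and coinvariant, and by the
  Lefschetz isomorphism in degree \<open>0\<close> every top form is \<open>\<kappa> m\<close> for a unique \<open>m \<in> M\<close>. Dividing by \<open>\<kappa>\<close>
  is therefore an equivariant isomorphism of bimodules \<open>\<tau>\<close> from \<open>\<Omega>\<^bsup>(n,n)\<^esup>\<close> to \<open>M\<close>, and factorisability in
  bidegree \<open>(n,n)\<close> says that \<open>p \<otimes> q \<mapsto> \<tau>(p q)\<close> and \<open>q \<otimes> p \<mapsto> \<tau>(q p)\<close> identify both \<open>P \<otimes>\<^sub>M Q\<close> and \<open>Q \<otimes>\<^sub>M P\<close>
  with \<open>M\<close>: the bimodule \<open>P\<close> is invertible. To get explicit dual bases one needs two pairings that are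
  associative with each other. The two above need not be, since the products \<open>p q p'\<close> live in degree \<open>3 n\<close> and
  say nothing; but they fail to be so only by a bimodule automorphism of \<open>P\<close>, and twisting the
  second pairing by it gives \<open>p \<langle>q, p'\<rangle> = \<tau>(p q) p'\<close> (\<open>copair_assoc\<close>). The two expansions of
  \<open>\<kappa>\<close> as an element of \<open>P Q\<close> and of \<open>Q P\<close> then play the part of dual bases.

  Factorisability in the bidegrees \<open>(n,b)\<close> gives \<open>D \<otimes>\<^sub>M P \<cong> X \<cong> P \<otimes>\<^sub>M D\<close>. Through the first isomorphism left
  \<open>M\<close>-linear maps on \<open>P\<close> extend to left \<open>D\<close>-linear maps on \<open>X\<close>, so that the dual basis of \<open>P\<close> becomes one of
  \<open>X\<close>. Through the second the pairing \<open>\<langle>q, -\<rangle>\<close> extends to \<open>X\<close>, and it follows that every left \<open>D\<close>-linear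
  endomorphism of \<open>X\<close> is right multiplication by a unique element of \<open>D\<close> (\<open>D_invertible\<close>). The rest of the
  module theory is formal: if the right action identifies \<open>R\<close> with the opposite of the ring of left linear
  endomorphisms of a bimodule, and \<open>1 = \<Sum> y\<^sub>i(x\<^sub>i)\<close> for some left linear \<open>y\<^sub>i\<close>, then evaluation is an
  isomorphism and the dual is projective and generated by the \<open>y\<^sub>i\<close> (locale \<open>invertible_bimodule\<close>). This is applied over \<open>M\<close> and over \<open>D\<close>.

  The dual of \<open>X\<close> must also be a comodule dg bimodule. Its differential is given by a formula. Its coaction is
  characterised by equivariance of evaluation. The antipode shows that an element of \<open>A \<otimes> \<^sup>\<and>X\<close> is
  determined by its pairing with the coactions of all forms in \<open>X\<close> (\<open>act_cancel\<close>, \<open>act_unique\<close>), so that every axiom for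
  the coaction of the dual can be checked after evaluation, where it becomes the corresponding
  axiom for the coaction of \<open>D\<close>. Existence is clear for the functionals \<open>e\<^sub>0 p \<mapsto> e\<^sub>0 \<tau>(p q) e\<close>, which
  span the dual: the product of the coactions of \<open>q\<close> and \<open>e\<close> does it, because \<open>\<tau>\<close> is equivariant (\<open>ext_form_coaction\<close>).\<close>

section \<open>Linear maps on subspaces\<close>

interpretation cvec: vector_space "scaleC :: complex \<Rightarrow> 'v \<Rightarrow> 'v::complex_vector"
  by standard (simp_all add: scaleC_add_right scaleC_add_left scaleC_scaleC scaleC_one)

interpretation cvec_pair: vector_space_pair
  "scaleC :: complex \<Rightarrow> 'v \<Rightarrow> 'v::complex_vector" "scaleC :: complex \<Rightarrow> 'w \<Rightarrow> 'w::complex_vector" ..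

abbreviation clin :: "('v::complex_vector \<Rightarrow> 'w::complex_vector) \<Rightarrow> bool"
  where "clin \<equiv> clinear_on UNIV"

abbreviation cbilin :: "('v::complex_vector \<Rightarrow> 'w::complex_vector \<Rightarrow> 'z::complex_vector) \<Rightarrow> bool"
  where "cbilin \<equiv> cbilinear_on UNIV UNIV"

lemma clin_linear: "clin f \<longleftrightarrow> Vector_Spaces.linear scaleC scaleC f"
  by (auto simp: clinear_on_def Vector_Spaces.linear_iff cvec.vector_space_axioms)

lemma clinear_onI:
  assumes "\<And>x y. x \<in> V \<Longrightarrow> y \<in> V \<Longrightarrow> f (x + y) = f x + f y"
    and "\<And>c x. x \<in> V \<Longrightarrow> f (c *\<^sub>C x) = c *\<^sub>C f x"
  shows "clinear_on V f"
  using assms by (auto simp: clinear_on_def)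

lemma clinear_on_add: "clinear_on V f \<Longrightarrow> x \<in> V \<Longrightarrow> y \<in> V \<Longrightarrow> f (x + y) = f x + f y"
  by (auto simp: clinear_on_def)

lemma clinear_on_scale: "clinear_on V f \<Longrightarrow> x \<in> V \<Longrightarrow> f (c *\<^sub>C x) = c *\<^sub>C f x"
  by (auto simp: clinear_on_def)

lemma clinear_on_zero: "clinear_on V f \<Longrightarrow> csubspace V \<Longrightarrow> f 0 = 0"
  using clinear_on_scale[of V f 0 0] cvec.subspace_0 by fastforce

lemma clinear_on_uminus: "clinear_on V f \<Longrightarrow> x \<in> V \<Longrightarrow> f (- x) = - f x"
  using clinear_on_scale[of V f x "-1"] by simp

lemma clinear_on_diff:
  "clinear_on V f \<Longrightarrow> csubspace V \<Longrightarrow> x \<in> V \<Longrightarrow> y \<in> V \<Longrightarrow> f (x - y) = f x - f y"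
  using clinear_on_add[of V f x "- y"] clinear_on_uminus[of V f y] cvec.subspace_neg[of V y] by simp

lemma clinear_on_sum:
  assumes "clinear_on V f" "csubspace V" "\<And>i. i \<in> I \<Longrightarrow> g i \<in> V"
  shows "f (\<Sum>i\<in>I. g i) = (\<Sum>i\<in>I. f (g i))"
  using assms(3)
proof (induction I rule: infinite_finite_induct)
  case (insert i I)
  then show ?case
    using clinear_on_add[OF assms(1), of "g i" "sum g I"] cvec.subspace_sum[OF assms(2), of I g] by simp
qed (use clinear_on_zero[OF assms(1,2)] in simp_all)

lemma clinear_on_subset: "clinear_on V f \<Longrightarrow> W \<subseteq> V \<Longrightarrow> clinear_on W f"
  unfolding clinear_on_def by blast

lemma clin_on: "clin f \<Longrightarrow> clinear_on V f"
  by (rule clinear_on_subset) auto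

lemma clinear_on_cong:
  assumes "csubspace V" "\<And>x. x \<in> V \<Longrightarrow> f x = g x"
  shows "clinear_on V f \<longleftrightarrow> clinear_on V g"
  using assms cvec.subspace_add[OF assms(1)] cvec.subspace_scale[OF assms(1)]
  by (auto simp: clinear_on_def)

lemmas clin_add = clinear_on_add[OF _ UNIV_I UNIV_I]
lemmas clin_scale = clinear_on_scale[OF _ UNIV_I]
lemmas clin_zero = clinear_on_zero[OF _ cvec.subspace_UNIV]
lemmas clin_uminus = clinear_on_uminus[OF _ UNIV_I]
lemmas clin_diff = clinear_on_diff[OF _ cvec.subspace_UNIV UNIV_I UNIV_I]
lemmas clin_sum = clinear_on_sum[OF _ cvec.subspace_UNIV UNIV_I]

lemma cbilinear_on_left: "cbilinear_on V W \<beta> \<Longrightarrow> w \<in> W \<Longrightarrow> clinear_on V (\<lambda>v. \<beta> v w)"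
  by (auto simp: cbilinear_on_def)

lemma cbilinear_on_right: "cbilinear_on V W \<beta> \<Longrightarrow> v \<in> V \<Longrightarrow> clinear_on W (\<beta> v)"
  by (auto simp: cbilinear_on_def)

lemma cbilinear_onI:
  assumes "\<And>v. v \<in> V \<Longrightarrow> clinear_on W (\<beta> v)" "\<And>w. w \<in> W \<Longrightarrow> clinear_on V (\<lambda>v. \<beta> v w)"
  shows "cbilinear_on V W \<beta>"
  using assms by (auto simp: cbilinear_on_def)

lemma cbilinear_on_subset: "cbilinear_on V W \<beta> \<Longrightarrow> V' \<subseteq> V \<Longrightarrow> W' \<subseteq> W \<Longrightarrow> cbilinear_on V' W' \<beta>"
  unfolding cbilinear_on_def by (meson clinear_on_subset subsetD)

lemma cbilin_on: "cbilin \<beta> \<Longrightarrow> cbilinear_on V W \<beta>"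
  by (rule cbilinear_on_subset) auto

text \<open>Composing with a projection turns a map that is linear on a subspace into a linear map on the
  ambient space. This is how maps that are meaningful on a module only enter the calculus of
  \<open>tensor_lift\<close> below.\<close>

lemma linear_projection_exists:
  fixes V :: "'v::complex_vector set"
  assumes "csubspace V"
  shows "\<exists>\<pi>. clin \<pi> \<and> (\<forall>x. \<pi> x \<in> V) \<and> (\<forall>x\<in>V. \<pi> x = x)"
proof -
  have "Vector_Spaces.linear scaleC scaleC (\<lambda>x::'v. x)"
    using clin_linear[of "\<lambda>x::'v. x"] by (simp add: clinear_on_def)
  from cvec_pair.linear_exists_left_inverse_on[OF this assms]
  show ?thesis unfolding clin_linear by (auto simp: inj_on_def)
qed

definition subspace_proj :: "'v::complex_vector set \<Rightarrow> 'v \<Rightarrow> 'v"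
  where "subspace_proj V = (SOME \<pi>. clin \<pi> \<and> (\<forall>x. \<pi> x \<in> V) \<and> (\<forall>x\<in>V. \<pi> x = x))"

lemma
  assumes "csubspace V"
  shows subspace_proj_clin: "clin (subspace_proj V)"
    and subspace_proj_mem: "subspace_proj V x \<in> V"
    and subspace_proj_id: "x \<in> V \<Longrightarrow> subspace_proj V x = x"
  using someI_ex[OF linear_projection_exists[OF assms]] by (auto simp: subspace_proj_def)

section \<open>Tensor products over the complex numbers\<close>

text \<open>The value of \<open>tensor_lift_on\<close> computed from a given formal sum instead of a chosen one.\<close>

definition frag_eval ::
  "('a::complex_vector \<Rightarrow> 'b::complex_vector \<Rightarrow> 'z::complex_vector) \<Rightarrow> ('a \<times> 'b \<Rightarrow>\<^sub>0 int) \<Rightarrow> 'z"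
  where "frag_eval \<beta> s =
    (\<Sum>(v, w)\<in>Poly_Mapping.keys s. of_int (Poly_Mapping.lookup s (v, w)) *\<^sub>C \<beta> v w)"

lemma frag_eval_superset:
  assumes "finite S" "Poly_Mapping.keys s \<subseteq> S"
  shows "frag_eval \<beta> s = (\<Sum>(v, w)\<in>S. of_int (Poly_Mapping.lookup s (v, w)) *\<^sub>C \<beta> v w)"
  unfolding frag_eval_def
  by (rule sum.mono_neutral_left) (use assms in \<open>auto simp: in_keys_iff\<close>)

lemma frag_eval_diff: "frag_eval \<beta> (s - t) = frag_eval \<beta> s - frag_eval \<beta> t"
proof -
  define S where "S = Poly_Mapping.keys s \<union> Poly_Mapping.keys t \<union> Poly_Mapping.keys (s - t)"
  have "finite S" by (simp add: S_def)
  then show ?thesis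
    using frag_eval_superset[of S s \<beta>] frag_eval_superset[of S t \<beta>] frag_eval_superset[of S "s - t" \<beta>]
    by (simp add: S_def sum_subtractf[symmetric] lookup_minus cvec.scale_left_diff_distrib case_prod_unfold Un_upper1 le_supI1)
qed

lemma frag_eval_of: "frag_eval \<beta> (frag_of (v, w)) = \<beta> v w"
  by (simp add: frag_eval_def scaleC_one)

lemma frag_eval_zero: "frag_eval \<beta> 0 = 0"
  by (simp add: frag_eval_def)

lemma frag_eval_add: "frag_eval \<beta> (s + t) = frag_eval \<beta> s + frag_eval \<beta> t"
  using frag_eval_diff[of \<beta> "s + t" t] by (simp add: algebra_simps)

lemma frag_eval_null:
  assumes "cbilin \<beta>" "s \<in> tensor_null"
  shows "frag_eval \<beta> s = 0"
  using assms(2)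
proof induction
  case (add_left a a' b)
  show ?case
    by (simp add: frag_eval_diff frag_eval_of clin_add[OF cbilinear_on_left[OF assms(1) UNIV_I]])
next
  case (add_right a b b')
  show ?case
    by (simp add: frag_eval_diff frag_eval_of clin_add[OF cbilinear_on_right[OF assms(1) UNIV_I]])
next
  case (scale c a b)
  show ?case
    by (simp add: frag_eval_diff frag_eval_of clin_scale[OF cbilinear_on_right[OF assms(1) UNIV_I]]
        clin_scale[OF cbilinear_on_left[OF assms(1) UNIV_I]])
qed (simp_all add: frag_eval_zero frag_eval_diff)

lemma abs_tensor_eq_iff: "abs_tensor s = abs_tensor t \<longleftrightarrow> s - t \<in> tensor_null"
  using tensor.abs_eq_iff[of s t] by (simp add: tensor_rel_def)

lemma frag_eval_wd: "cbilin \<beta> \<Longrightarrow> abs_tensor s = abs_tensor t \<Longrightarrow> frag_eval \<beta> s = frag_eval \<beta> t"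
  using frag_eval_null[of \<beta> "s - t"] by (simp add: abs_tensor_eq_iff frag_eval_diff)

lemma tensor_lift_abs:
  assumes "cbilin \<beta>"
  shows "tensor_lift \<beta> (abs_tensor s) = frag_eval \<beta> s"
proof -
  let ?P = "\<lambda>s'. Poly_Mapping.keys s' \<subseteq> UNIV \<times> UNIV \<and> abs_tensor s' = abs_tensor s"
  have "?P (SOME s'. ?P s')" by (rule someI[of ?P s]) simp
  then show ?thesis
    using frag_eval_wd[OF assms, of "SOME s'. ?P s'" s]
    by (simp add: tensor_lift_on_def frag_eval_def)
qed

lemma tensor_exhaust: obtains s where "t = abs_tensor s"
  by (metis Quotient3_abs_rep Quotient3_tensor)

lemma tens_abs: "v \<otimes> w = abs_tensor (frag_of (v, w))"
  by (simp add: tens.abs_eq)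

lemma tensor_lift_tens: "cbilin \<beta> \<Longrightarrow> tensor_lift \<beta> (v \<otimes> w) = \<beta> v w"
  by (simp add: tens_abs tensor_lift_abs frag_eval_of)

lemma tensor_lift_add:
  assumes "cbilin \<beta>"
  shows "tensor_lift \<beta> (s + t) = tensor_lift \<beta> s + tensor_lift \<beta> t"
proof -
  obtain s' t' where "s = abs_tensor s'" "t = abs_tensor t'" by (metis tensor_exhaust)
  then show ?thesis using assms by (simp add: plus_tensor.abs_eq tensor_lift_abs frag_eval_add)
qed

lemma frag_eval_scale:
  assumes "cbilin \<beta>"
  shows "frag_eval \<beta> (frag_scale c s) = c *\<^sub>C frag_eval \<beta> s"
proof (rule frag_induction[where S = UNIV and c = s])
  show "frag_eval \<beta> (frag_scale c (frag_of p)) = c *\<^sub>C frag_eval \<beta> (frag_of p)" for p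
    by (cases p) (simp add: frag_scale_of frag_eval_of clin_scale[OF cbilinear_on_left[OF assms UNIV_I]])
qed (simp_all add: frag_scale_zero frag_eval_zero frag_scale_diff frag_eval_diff
    cvec.scale_right_diff_distrib)

lemma tensor_lift_scale:
  assumes "cbilin \<beta>"
  shows "tensor_lift \<beta> (c *\<^sub>C t) = c *\<^sub>C tensor_lift \<beta> t"
proof -
  obtain t' where "t = abs_tensor t'" by (metis tensor_exhaust)
  then show ?thesis using assms by (simp add: scaleC_tensor.abs_eq tensor_lift_abs frag_eval_scale)
qed

lemma tensor_lift_clin: "cbilin \<beta> \<Longrightarrow> clin (tensor_lift \<beta>)"
  by (intro clinear_onI tensor_lift_add tensor_lift_scale)

lemma tens_cbilin: "cbilin (\<otimes>)"
proof (intro cbilinear_onI clinear_onI)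
  fix v v' :: 'a and w w' :: 'b and c
  show "v \<otimes> (w + w') = v \<otimes> w + v \<otimes> w'"
    by (simp add: tens_abs plus_tensor.abs_eq abs_tensor_eq_iff diff_diff_eq[symmetric] tensor_null.add_right)
  show "(v + v') \<otimes> w = v \<otimes> w + v' \<otimes> w"
    by (simp add: tens_abs plus_tensor.abs_eq abs_tensor_eq_iff diff_diff_eq[symmetric] tensor_null.add_left)
  show *: "(c *\<^sub>C v) \<otimes> w = c *\<^sub>C (v \<otimes> w)" for v w
    by (simp add: tens_abs scaleC_tensor.abs_eq frag_scale_of)
  have "(c *\<^sub>C v) \<otimes> w = v \<otimes> (c *\<^sub>C w)"
    by (simp add: tens_abs abs_tensor_eq_iff tensor_null.scale)
  then show "v \<otimes> (c *\<^sub>C w) = c *\<^sub>C (v \<otimes> w)" using *[of v w] by (simp only:)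
qed

lemmas tens_add_left = clin_add[OF cbilinear_on_left[OF tens_cbilin UNIV_I]]
lemmas tens_add_right = clin_add[OF cbilinear_on_right[OF tens_cbilin UNIV_I]]
lemmas tens_scale_left = clin_scale[OF cbilinear_on_left[OF tens_cbilin UNIV_I]]
lemmas tens_scale_right = clin_scale[OF cbilinear_on_right[OF tens_cbilin UNIV_I]]
lemmas tens_zero_left = clin_zero[OF cbilinear_on_left[OF tens_cbilin UNIV_I]]
lemmas tens_zero_right = clin_zero[OF cbilinear_on_right[OF tens_cbilin UNIV_I]]

lemma tspan_subspace: "csubspace (tspan V W)"
  by (simp add: tspan_def)

lemma tspan_tens: "v \<in> V \<Longrightarrow> w \<in> W \<Longrightarrow> v \<otimes> w \<in> tspan V W"
  unfolding tspan_def by (rule cvec.span_base) auto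

lemma tspan_mono: "V \<subseteq> V' \<Longrightarrow> W \<subseteq> W' \<Longrightarrow> tspan V W \<subseteq> tspan V' W'"
  unfolding tspan_def by (rule cvec.span_mono) blast

lemma tspan_induct [consumes 2, case_names zero add tens]:
  assumes "t \<in> tspan V W" "csubspace V" "P 0"
    and "\<And>s t. s \<in> tspan V W \<Longrightarrow> t \<in> tspan V W \<Longrightarrow> P s \<Longrightarrow> P t \<Longrightarrow> P (s + t)"
    and "\<And>v w. v \<in> V \<Longrightarrow> w \<in> W \<Longrightarrow> P (v \<otimes> w)"
  shows "P t"
proof -
  have "t \<in> tspan V W \<and> P t" using assms(1) unfolding tspan_def
  proof (induction rule: cvec.span_induct_alt)
    case base
    then show ?case using assms(3) by (simp add: cvec.span_zero)
  next
    case (step c x y)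
    then obtain v w where x: "x = v \<otimes> w" "v \<in> V" "w \<in> W" by auto
    then have cv: "c *\<^sub>C v \<in> V" using assms(2) cvec.subspace_scale by blast
    have "c *\<^sub>C x = (c *\<^sub>C v) \<otimes> w" by (simp add: x tens_scale_left)
    then have "P (c *\<^sub>C x)" "c *\<^sub>C x \<in> tspan V W" using assms(5)[OF cv x(3)] tspan_tens[OF cv x(3)] by simp_all
    then show ?case using step assms(4)[of "c *\<^sub>C x" y]
      by (simp add: tspan_def cvec.span_add)
  qed
  then show ?thesis ..
qed

lemma tspan_UNIV: "tspan UNIV UNIV = UNIV"
proof (intro equalityI subset_UNIV subsetI)
  fix t :: "('a, 'b) tensor"
  obtain s where t: "t = abs_tensor s" by (metis tensor_exhaust)
  have "abs_tensor s \<in> tspan UNIV UNIV"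
  proof (rule frag_induction[where S = UNIV and c = s])
    show "abs_tensor 0 \<in> tspan UNIV UNIV"
      using cvec.subspace_0[OF tspan_subspace] by (simp add: zero_tensor.abs_eq)
    show "abs_tensor (frag_of p) \<in> tspan UNIV UNIV" for p :: "'a \<times> 'b"
      by (cases p) (metis tens_abs tspan_tens UNIV_I)
    show "abs_tensor (u - v) \<in> tspan UNIV UNIV"
      if "abs_tensor u \<in> tspan UNIV UNIV" "abs_tensor v \<in> tspan UNIV UNIV" for u v :: "'a \<times> 'b \<Rightarrow>\<^sub>0 int"
      using cvec.subspace_diff[OF tspan_subspace that] by (simp add: minus_tensor.abs_eq)
  qed auto
  then show "t \<in> tspan UNIV UNIV" by (simp add: t)
qed

lemma tensor_induct [case_names zero add tens]:
  assumes "P 0" "\<And>s t. P s \<Longrightarrow> P t \<Longrightarrow> P (s + t)" "\<And>v w. P (v \<otimes> w)"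
  shows "P t"
proof (rule tspan_induct[of t UNIV UNIV])
  show "t \<in> tspan UNIV UNIV" by (simp add: tspan_UNIV)
qed (use assms in auto)

lemma tspan_representative:
  assumes "csubspace V" "csubspace W" "t \<in> tspan V W"
  shows "\<exists>s. Poly_Mapping.keys s \<subseteq> V \<times> W \<and> abs_tensor s = t"
  using assms(3,1)
proof (induction rule: tspan_induct)
  case zero
  then show ?case by (intro exI[of _ 0]) (simp add: zero_tensor.abs_eq)
next
  case (add s t)
  then obtain s' t' where "Poly_Mapping.keys s' \<subseteq> V \<times> W" "abs_tensor s' = s"
    "Poly_Mapping.keys t' \<subseteq> V \<times> W" "abs_tensor t' = t" by blast
  then show ?case using keys_add[of s' t']
    by (intro exI[of _ "s' + t'"]) (auto simp: plus_tensor.abs_eq)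
next
  case (tens v w)
  then show ?case by (intro exI[of _ "frag_of (v, w)"]) (auto simp: tens_abs)
qed

lemma bilinear_extend:
  assumes "csubspace V" "csubspace W" "cbilinear_on V W \<beta>"
  shows "cbilin (\<lambda>v w. \<beta> (subspace_proj V v) (subspace_proj W w))"
  using subspace_proj_mem[OF assms(1)] subspace_proj_mem[OF assms(2)]
  by (intro cbilinear_onI clinear_onI)
     (simp_all add: clin_add[OF subspace_proj_clin[OF assms(1)]] clin_add[OF subspace_proj_clin[OF assms(2)]]
      clin_scale[OF subspace_proj_clin[OF assms(1)]] clin_scale[OF subspace_proj_clin[OF assms(2)]]
      clinear_on_add[OF cbilinear_on_left[OF assms(3)]] clinear_on_add[OF cbilinear_on_right[OF assms(3)]]
      clinear_on_scale[OF cbilinear_on_left[OF assms(3)]] clinear_on_scale[OF cbilinear_on_right[OF assms(3)]])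

lemma tensor_lift_on_eq_extend:
  assumes "csubspace V" "csubspace W" "cbilinear_on V W \<beta>" "t \<in> tspan V W"
  shows "tensor_lift_on V W \<beta> t = tensor_lift (\<lambda>v w. \<beta> (subspace_proj V v) (subspace_proj W w)) t"
proof -
  let ?P = "\<lambda>s'. Poly_Mapping.keys s' \<subseteq> V \<times> W \<and> abs_tensor s' = t"
  define s where "s = (SOME s'. ?P s')"
  have s: "?P s" unfolding s_def by (rule someI_ex[OF tspan_representative[OF assms(1,2,4)]])
  have "tensor_lift_on V W \<beta> t = frag_eval \<beta> s"
    by (simp add: tensor_lift_on_def frag_eval_def s_def Let_def)
  also have "\<dots> = frag_eval (\<lambda>v w. \<beta> (subspace_proj V v) (subspace_proj W w)) s"
    unfolding frag_eval_def using s
    by (intro sum.cong refl) (auto simp: subspace_proj_id[OF assms(1)] subspace_proj_id[OF assms(2)])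
  also have "\<dots> = tensor_lift (\<lambda>v w. \<beta> (subspace_proj V v) (subspace_proj W w)) t"
    using tensor_lift_abs[OF bilinear_extend[OF assms(1-3)], of s] s by simp
  finally show ?thesis .
qed

lemma tensor_lift_cong:
  assumes "t \<in> tspan V W" "csubspace V" "cbilin \<beta>" "cbilin \<gamma>" "\<And>v w. v \<in> V \<Longrightarrow> w \<in> W \<Longrightarrow> \<beta> v w = \<gamma> v w"
  shows "tensor_lift \<beta> t = tensor_lift \<gamma> t"
  using assms(1,2)
  by (induction rule: tspan_induct)
     (simp_all add: clin_zero[OF tensor_lift_clin] tensor_lift_add tensor_lift_tens assms(3-5))

lemma tensor_lift_cong_right:
  assumes "t \<in> tspan UNIV W" "cbilin \<beta>" "cbilin \<gamma>" "\<And>v w. w \<in> W \<Longrightarrow> \<beta> v w = \<gamma> v w"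
  shows "tensor_lift \<beta> t = tensor_lift \<gamma> t"
  by (rule tensor_lift_cong[OF assms(1) cvec.subspace_UNIV assms(2,3)]) (rule assms(4))

text \<open>The representative chosen in the definition of \<open>tensor_lift_on\<close> is immaterial as soon as \<open>\<beta>\<close> extends to a
  bilinear map of the ambient spaces. By this lemma all computations take place with total maps.\<close>

lemma tensor_lift_on_eq:
  assumes "csubspace V" "csubspace W" "t \<in> tspan V W" "cbilin \<gamma>"
    and "\<And>v w. v \<in> V \<Longrightarrow> w \<in> W \<Longrightarrow> \<beta> v w = \<gamma> v w"
  shows "tensor_lift_on V W \<beta> t = tensor_lift \<gamma> t"
proof -
  have "cbilinear_on V W \<gamma>" by (rule cbilin_on[OF assms(4)])
  then have b: "cbilinear_on V W \<beta>"
    unfolding cbilinear_on_def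
    using clinear_on_cong[OF assms(2), of "\<beta> _" "\<gamma> _"]
      clinear_on_cong[OF assms(1), of "\<lambda>v. \<beta> v _" "\<lambda>v. \<gamma> v _"] assms(5) by meson
  show ?thesis unfolding tensor_lift_on_eq_extend[OF assms(1,2) b assms(3)]
    by (rule tensor_lift_cong[OF assms(3,1) bilinear_extend[OF assms(1,2) b] assms(4)])
       (simp add: subspace_proj_id assms)
qed

lemma tensor_lift_on_clin:
  assumes "csubspace V" "csubspace W" "cbilinear_on V W \<beta>"
  shows "clinear_on (tspan V W) (tensor_lift_on V W \<beta>)"
  by (subst clinear_on_cong[OF tspan_subspace tensor_lift_on_eq_extend[OF assms]])
     (simp_all add: clin_on[OF tensor_lift_clin[OF bilinear_extend[OF assms]]])

lemma tensor_lift_on_tens: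
  assumes "csubspace V" "csubspace W" "cbilinear_on V W \<beta>" "v \<in> V" "w \<in> W"
  shows "tensor_lift_on V W \<beta> (v \<otimes> w) = \<beta> v w"
  using assms tensor_lift_on_eq_extend[OF assms(1-3) tspan_tens[OF assms(4,5)]]
  by (simp add: tensor_lift_tens[OF bilinear_extend] subspace_proj_id)

text \<open>The computations below are in the style of Sweedler: \<open>tensor_lift \<gamma> t\<close> is read as an integral of \<open>\<gamma>\<close>
  against \<open>t\<close>, and nested integrals stand for iterated coproducts. Every integrand is multilinear in its
  bound variables, and the rules collected here prove this by recursion on the expression.\<close>

named_theorems clin_intros

lemma cbilin_iff: "cbilin \<beta> \<longleftrightarrow> (\<forall>v. clin (\<beta> v)) \<and> (\<forall>w. clin (\<lambda>v. \<beta> v w))"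
  by (simp add: cbilinear_on_def)

lemma cbilinI [clin_intros]: "(\<And>v. clin (\<lambda>w. \<beta> v w)) \<Longrightarrow> (\<And>w. clin (\<lambda>v. \<beta> v w)) \<Longrightarrow> cbilin \<beta>"
  by (simp add: cbilinear_on_def)

lemma clin_id [clin_intros]: "clin (\<lambda>x. x)" by (simp add: clinear_on_def)

lemma clin_compose: "clin g \<Longrightarrow> clin f \<Longrightarrow> clin (\<lambda>x. g (f x))" by (simp add: clinear_on_def)

lemma clin_tens_left [clin_intros]: "clin f \<Longrightarrow> clin (\<lambda>x. f x \<otimes> w)"
  by (simp add: clinear_on_def tens_add_left tens_scale_left)

lemma clin_tens_right [clin_intros]: "clin f \<Longrightarrow> clin (\<lambda>x. v \<otimes> f x)"
  by (simp add: clinear_on_def tens_add_right tens_scale_right)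

lemma clin_mult_left [clin_intros]: "clin f \<Longrightarrow> clin (\<lambda>x. f x * (w::'a::complex_algebra_1))"
  by (simp add: clinear_on_def distrib_right mult_scaleC_left)

lemma clin_mult_right [clin_intros]: "clin f \<Longrightarrow> clin (\<lambda>x. (w::'a::complex_algebra_1) * f x)"
  by (simp add: clinear_on_def distrib_left mult_scaleC_right)

lemma clin_scaleC [clin_intros]: "clin f \<Longrightarrow> clin (\<lambda>x. c *\<^sub>C f x)"
  by (simp add: clinear_on_def scaleC_add_right scaleC_scaleC mult.commute)

lemma clin_plus [clin_intros]: "clin f \<Longrightarrow> clin g \<Longrightarrow> clin (\<lambda>x. f x + g x)"
  by (simp add: clinear_on_def scaleC_add_right algebra_simps)

lemma clin_minus [clin_intros]: "clin f \<Longrightarrow> clin g \<Longrightarrow> clin (\<lambda>x. f x - g x)"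
  by (simp add: clinear_on_def cvec.scale_right_diff_distrib algebra_simps)

lemma clin_sum_fun: "(\<And>i. i \<in> I \<Longrightarrow> clin (f i)) \<Longrightarrow> clin (\<lambda>x. \<Sum>i\<in>I. f i x)"
  by (simp add: clinear_on_def sum.distrib cvec.scale_sum_right)

lemma frag_eval_cong_lin:
  assumes "\<And>v w. clin (\<lambda>x. \<gamma> x v w)"
  shows "clin (\<lambda>x. frag_eval (\<gamma> x) s)"
  unfolding frag_eval_def case_prod_unfold
  by (intro clin_sum_fun clin_intros assms)

lemma clin_tensor_lift_fun [clin_intros]:
  assumes "\<And>x. cbilin (\<gamma> x)" "\<And>v w. clin (\<lambda>x. \<gamma> x v w)"
  shows "clin (\<lambda>x. tensor_lift (\<gamma> x) t)"
proof -
  obtain s where t: "t = abs_tensor s" by (metis tensor_exhaust)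
  show ?thesis unfolding t tensor_lift_abs[OF assms(1)] by (rule frag_eval_cong_lin[OF assms(2)])
qed

lemma clin_tensor_lift_arg [clin_intros]: "cbilin \<beta> \<Longrightarrow> clin f \<Longrightarrow> clin (\<lambda>x. tensor_lift \<beta> (f x))"
  by (rule clin_compose[OF tensor_lift_clin])

lemma tensor_lift_compose:
  assumes "cbilin \<beta>" "clin g"
  shows "g (tensor_lift \<beta> t) = tensor_lift (\<lambda>v w. g (\<beta> v w)) t"
proof -
  have b: "cbilin (\<lambda>v w. g (\<beta> v w))"
    using assms by (auto simp: cbilin_iff intro: clin_compose[OF assms(2)])
  show ?thesis
    by (induction t rule: tensor_induct)
       (simp_all add: clin_zero[OF tensor_lift_clin] clin_zero assms b tensor_lift_add tensor_lift_tens clin_add)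
qed

lemma tensor_lift_id: "tensor_lift (\<otimes>) t = t"
  by (induction t rule: tensor_induct)
     (simp_all add: clin_zero[OF tensor_lift_clin[OF tens_cbilin]] tensor_lift_add[OF tens_cbilin]
       tensor_lift_tens[OF tens_cbilin])

lemma tensor_lift_diff_fun:
  assumes "cbilin \<beta>" "cbilin \<gamma>"
  shows "tensor_lift (\<lambda>v w. \<beta> v w - \<gamma> v w) t = tensor_lift \<beta> t - tensor_lift \<gamma> t"
proof -
  have 1: "cbilin (\<lambda>v w. \<beta> v w - \<gamma> v w)"
    using assms by (auto simp: cbilin_iff intro: clin_minus)
  show ?thesis
    by (induction t rule: tensor_induct)
       (simp_all add: clin_zero[OF tensor_lift_clin] tensor_lift_add tensor_lift_tens assms 1)
qed

lemma tensor_lift_fubini: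
  assumes "\<And>v w. cbilin (\<lambda>x y. \<gamma> v w x y)" "\<And>x y. cbilin (\<lambda>v w. \<gamma> v w x y)"
  shows "tensor_lift (\<lambda>v w. tensor_lift (\<lambda>x y. \<gamma> v w x y) s) t =
         tensor_lift (\<lambda>x y. tensor_lift (\<lambda>v w. \<gamma> v w x y) t) s"
proof -
  have 1: "clin (\<lambda>w. \<gamma> v w x y)" "clin (\<lambda>v. \<gamma> v w x y)" "clin (\<lambda>x. \<gamma> v w x y)" "clin (\<lambda>y. \<gamma> v w x y)" for v w x y
    using assms by (simp_all add: cbilin_iff)
  have 2: "cbilin (\<lambda>v w. tensor_lift (\<lambda>x y. \<gamma> v w x y) s)" by (intro clin_intros 1)
  have 3: "cbilin (\<lambda>x y. tensor_lift (\<lambda>v w. \<gamma> v w x y) t)" for t by (intro clin_intros 1)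
  have 4: "clin (\<lambda>t. tensor_lift (\<lambda>x y. tensor_lift (\<lambda>v w. \<gamma> v w x y) t) s)" by (intro clin_intros 1)
  show ?thesis
    by (induction t rule: tensor_induct)
       (simp_all add: clin_zero[OF tensor_lift_clin[OF 2]] clin_zero[OF 4] clin_add[OF tensor_lift_clin[OF 2]] clin_add[OF 4] tensor_lift_tens[OF 2] tensor_lift_tens assms(2))
qed

text \<open>Linear functionals on the first factor reduce questions about a tensor to its slices
  \<open>(f \<otimes> id) t\<close>, which live in the second factor.\<close>

definition cfunctional :: "('v::complex_vector \<Rightarrow> complex) \<Rightarrow> bool"
  where "cfunctional f \<longleftrightarrow> (\<forall>x y. f (x + y) = f x + f y) \<and> (\<forall>c x. f (c *\<^sub>C x) = c * f x)"

lemma clin_functional_scale [clin_intros]: "cfunctional f \<Longrightarrow> clin g \<Longrightarrow> clin (\<lambda>x. f (g x) *\<^sub>C w)"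
  by (simp add: clinear_on_def cfunctional_def scaleC_add_left scaleC_scaleC)

definition slice :: "('a::complex_vector \<Rightarrow> complex) \<Rightarrow> ('a, 'w::complex_vector) tensor \<Rightarrow> 'w"
  where "slice f = tensor_lift (\<lambda>a w. f a *\<^sub>C w)"

lemma slice_cbilin: "cfunctional f \<Longrightarrow> cbilin (\<lambda>a w. f a *\<^sub>C w)"
  by (intro clin_intros)

lemma slice_clin: "cfunctional f \<Longrightarrow> clin (slice f)"
  unfolding slice_def by (rule tensor_lift_clin[OF slice_cbilin])

lemma slice_tens: "cfunctional f \<Longrightarrow> slice f (a \<otimes> w) = f a *\<^sub>C w"
  unfolding slice_def by (rule tensor_lift_tens[OF slice_cbilin])

lemma slice_mem:
  assumes "cfunctional f" "csubspace W" "t \<in> tspan UNIV W"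
  shows "slice f t \<in> W"
  using assms(3) cvec.subspace_UNIV
  by (induction rule: tspan_induct)
     (simp_all add: clin_zero[OF slice_clin] clin_add[OF slice_clin] slice_tens assms cvec.subspace_0
       cvec.subspace_add cvec.subspace_scale)

text \<open>With respect to a basis of the first factor, the coefficients of a tensor are its slices by the
  coordinate functionals, and only finitely many basis elements are involved.\<close>

lemma slice_expansion:
  fixes t :: "('a::complex_vector, 'w::complex_vector) tensor"
  shows "\<exists>S e. finite S \<and> (\<forall>b\<in>S. cfunctional (e b)) \<and> t = (\<Sum>b\<in>S. b \<otimes> slice (e b) t)"
proof -
  define B where "B = cvec.extend_basis ({} :: 'a set)"
  have B: "cvec.independent B" "cvec.span B = UNIV"
    using cvec.independent_extend_basis[of "{}"] cvec.span_extend_basis[of "{}"]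
    by (simp_all add: B_def cvec.independent_empty)
  define e where "e b = (\<lambda>a. cvec.representation B a b)" for b
  have e: "cfunctional (e b)" for b
    unfolding e_def cfunctional_def
    using B by (simp add: cvec.representation_add cvec.representation_scale)
  have "\<exists>S0\<subseteq>B. finite S0 \<and> (\<forall>S. finite S \<longrightarrow> S0 \<subseteq> S \<longrightarrow> t = (\<Sum>b\<in>S. b \<otimes> slice (e b) t))"
  proof (induction t rule: tensor_induct)
    case zero
    then show ?case by (intro exI[of _ "{}"]) (simp add: clin_zero[OF slice_clin[OF e]] tens_zero_right)
  next
    case (add s t)
    from add(1) obtain S where S: "S \<subseteq> B" "finite S"
        and s: "\<And>S'. finite S' \<Longrightarrow> S \<subseteq> S' \<Longrightarrow> s = (\<Sum>b\<in>S'. b \<otimes> slice (e b) s)"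
      by (elim exE conjE) blast
    from add(2) obtain T where T: "T \<subseteq> B" "finite T"
        and t: "\<And>S'. finite S' \<Longrightarrow> T \<subseteq> S' \<Longrightarrow> t = (\<Sum>b\<in>S'. b \<otimes> slice (e b) t)"
      by (elim exE conjE) blast
    have "s + t = (\<Sum>b\<in>S'. b \<otimes> slice (e b) (s + t))" if "finite S'" "S \<union> T \<subseteq> S'" for S'
    proof -
      have "(\<Sum>b\<in>S'. b \<otimes> slice (e b) (s + t)) =
          (\<Sum>b\<in>S'. b \<otimes> slice (e b) s) + (\<Sum>b\<in>S'. b \<otimes> slice (e b) t)"
        by (simp add: clin_add[OF slice_clin[OF e]] tens_add_right sum.distrib)
      also have "\<dots> = s + t" using s[of S', symmetric] t[of S', symmetric] that by (simp only: Un_subset_iff)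
      finally show ?thesis by (rule sym)
    qed
    then show ?case using S T by (intro exI[of _ "S \<union> T"]) auto
  next
    case (tens v w)
    define S0 where "S0 = {b. e b v \<noteq> 0}"
    have fin: "finite S0" and sub: "S0 \<subseteq> B"
      using cvec.finite_representation[of B v] cvec.representation_ne_zero[of B v]
      by (auto simp: S0_def e_def)
    have "v \<otimes> w = (\<Sum>b\<in>S. b \<otimes> slice (e b) (v \<otimes> w))" if "finite S" "S0 \<subseteq> S" for S
    proof -
      have "(\<Sum>b\<in>S. e b v *\<^sub>C b) = (\<Sum>b\<in>S0. e b v *\<^sub>C b)"
        by (rule sum.mono_neutral_right) (use that in \<open>auto simp: S0_def\<close>)
      also have "\<dots> = v"
        using cvec.sum_nonzero_representation_eq[OF B(1), of v] B(2) by (simp add: S0_def e_def)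
      finally have v: "(\<Sum>b\<in>S. e b v *\<^sub>C b) = v" .
      have "(\<Sum>b\<in>S. e b v *\<^sub>C b) \<otimes> w = (\<Sum>b\<in>S. (e b v *\<^sub>C b) \<otimes> w)"
        using clin_sum[OF cbilinear_on_left[OF tens_cbilin UNIV_I, of w]] by blast
      also have "\<dots> = (\<Sum>b\<in>S. b \<otimes> slice (e b) (v \<otimes> w))"
        by (simp add: slice_tens[OF e] tens_scale_left tens_scale_right)
      finally show ?thesis unfolding v .
    qed
    then show ?case using fin sub by blast
  qed
  then show ?thesis using e by (metis order_refl)
qed

lemma slice_separates:
  assumes "\<And>f. cfunctional f \<Longrightarrow> slice f s = slice f t"
  shows "s = t"
proof -
  obtain S e where "\<forall>b\<in>S. cfunctional (e b)" "s - t = (\<Sum>b\<in>S. b \<otimes> slice (e b) (s - t))"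
    using slice_expansion[of "s - t"] by blast
  then have "s - t = 0"
    using assms by (simp add: clin_diff[OF slice_clin] tens_zero_right cong: sum.cong)
  then show ?thesis by simp
qed

text \<open>Membership in the tensor product with a subspace is detected by slices. This yields the various
  compatibilities of coactions with gradings.\<close>

lemma tspan_slice:
  assumes "csubspace W" "\<And>f. cfunctional f \<Longrightarrow> slice f t \<in> W"
  shows "t \<in> tspan UNIV W"
proof -
  obtain S e where *: "\<forall>b\<in>S. cfunctional (e b)" "t = (\<Sum>b\<in>S. b \<otimes> slice (e b) t)"
    using slice_expansion[of t] by blast
  have "(\<Sum>b\<in>S. b \<otimes> slice (e b) t) \<in> tspan UNIV W"
    by (rule cvec.subspace_sum[OF tspan_subspace]) (simp add: tspan_tens assms *(1))
  with *(2) show ?thesis by simp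
qed

section \<open>Balanced tensor products\<close>

lemma csubspace_cspan_least: "S \<subseteq> T \<Longrightarrow> csubspace T \<Longrightarrow> cspan S \<subseteq> T"
  by (rule cvec.span_minimal)

locale balanced_data =
  fixes R :: "'r set" and rV :: "'v::complex_vector \<Rightarrow> 'r \<Rightarrow> 'v" and V :: "'v set"
    and lW :: "'r \<Rightarrow> 'w::complex_vector \<Rightarrow> 'w" and W :: "'w set"
  assumes V: "csubspace V" and W: "csubspace W"
    and rV: "v \<in> V \<Longrightarrow> a \<in> R \<Longrightarrow> rV v a \<in> V"
    and lW: "a \<in> R \<Longrightarrow> w \<in> W \<Longrightarrow> lW a w \<in> W"
begin

definition balanced_map :: "('v \<Rightarrow> 'w \<Rightarrow> 'z::complex_vector) \<Rightarrow> bool"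
  where "balanced_map \<gamma> \<longleftrightarrow>
    cbilinear_on V W \<gamma> \<and> (\<forall>v\<in>V. \<forall>a\<in>R. \<forall>w\<in>W. \<gamma> (rV v a) w = \<gamma> v (lW a w))"

lemma lift_null:
  assumes "balanced_map \<gamma>" "t \<in> balanced_null R rV V lW W"
  shows "tensor_lift_on V W \<gamma> t = 0"
proof -
  have b: "cbilinear_on V W \<gamma>" using assms(1) by (simp add: balanced_map_def)
  note lin = tensor_lift_on_clin[OF V W b]
  have "t \<in> tspan V W \<and> tensor_lift_on V W \<gamma> t = 0"
    using assms(2) unfolding balanced_null_def
  proof (induction rule: cvec.span_induct_alt)
    case base
    then show ?case using clinear_on_zero[OF lin tspan_subspace] cvec.subspace_0[OF tspan_subspace] by simp
  next
    case (step c x y)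
    then obtain v a w where x: "x = rV v a \<otimes> w - v \<otimes> lW a w" and m: "v \<in> V" "a \<in> R" "w \<in> W" by auto
    have m': "rV v a \<otimes> w \<in> tspan V W" "v \<otimes> lW a w \<in> tspan V W"
      using m by (auto intro!: tspan_tens rV lW)
    have xt: "x \<in> tspan V W" unfolding x by (rule cvec.subspace_diff[OF tspan_subspace m'])
    have "tensor_lift_on V W \<gamma> x = 0"
      using clinear_on_diff[OF lin tspan_subspace m'] m assms(1)
      by (simp add: x tensor_lift_on_tens[OF V W b] rV lW balanced_map_def)
    then show ?case
      using step xt clinear_on_add[OF lin, of "c *\<^sub>C x" y] clinear_on_scale[OF lin xt, of c]
        cvec.subspace_add[OF tspan_subspace, of "c *\<^sub>C x" V W y] cvec.subspace_scale[OF tspan_subspace xt, of c]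
      by simp
  qed
  then show ?thesis ..
qed

definition null_rel where
  "null_rel = {(s, t). s \<in> tspan V W \<and> t \<in> tspan V W \<and> s - t \<in> balanced_null R rV V lW W}"

lemma null_sub: "csubspace (balanced_null R rV V lW W)"
  by (simp add: balanced_null_def)

lemma null_rel_equiv: "equiv (tspan V W) null_rel"
proof (rule equivI)
  show "null_rel \<subseteq> tspan V W \<times> tspan V W" by (auto simp: null_rel_def)
  show "refl_on (tspan V W) null_rel"
    by (auto simp: refl_on_def null_rel_def cvec.subspace_0[OF null_sub])
  show "sym null_rel"
  proof (rule symI)
    fix s t assume "(s, t) \<in> null_rel"
    then show "(t, s) \<in> null_rel"
      using cvec.subspace_neg[OF null_sub, of "s - t"] by (simp add: null_rel_def)
  qed
  show "trans null_rel"
  proof (rule transI)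
    fix s t u assume "(s, t) \<in> null_rel" "(t, u) \<in> null_rel"
    then show "(s, u) \<in> null_rel"
      using cvec.subspace_add[OF null_sub, of "s - t" "t - u"] by (simp add: null_rel_def)
  qed
qed

lemma induced_class:
  assumes "balanced_map \<gamma>" "t \<in> tspan V W"
  shows "induced_map V W \<gamma> (null_rel `` {t}) = tensor_lift_on V W \<gamma> t"
proof -
  have b: "cbilinear_on V W \<gamma>" using assms(1) by (simp add: balanced_map_def)
  define t' where "t' = (SOME t'. t' \<in> null_rel `` {t})"
  have "t \<in> null_rel `` {t}" using equiv_class_self[OF null_rel_equiv assms(2)] .
  then have "t' \<in> null_rel `` {t}" unfolding t'_def by (rule someI)
  then have t': "t' \<in> tspan V W" "t - t' \<in> balanced_null R rV V lW W" by (auto simp: null_rel_def)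
  have "tensor_lift_on V W \<gamma> t - tensor_lift_on V W \<gamma> t' = tensor_lift_on V W \<gamma> (t - t')"
    using clinear_on_diff[OF tensor_lift_on_clin[OF V W b] tspan_subspace assms(2) t'(1)] by simp
  also have "\<dots> = 0" by (rule lift_null[OF assms(1) t'(2)])
  finally show ?thesis by (simp add: induced_map_def t'_def)
qed

text \<open>The statement that the induced map is bijective, freed from classes: surjectivity, and a kernel
  consisting of the balancing relations.\<close>

lemma tensor_iso_iff:
  "tensor_iso R rV V lW W \<beta> Z \<longleftrightarrow>
    balanced_map \<beta> \<and> (\<forall>v\<in>V. \<forall>w\<in>W. \<beta> v w \<in> Z) \<and>
    tensor_lift_on V W \<beta> ` tspan V W = Z \<and>
    (\<forall>t\<in>tspan V W. tensor_lift_on V W \<beta> t = 0 \<longrightarrow> t \<in> balanced_null R rV V lW W)"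
proof (cases "balanced_map \<beta>")
  case True
  have b: "cbilinear_on V W \<beta>" using True by (simp add: balanced_map_def)
  note lin = tensor_lift_on_clin[OF V W b]
  have B: "balanced_tensor R rV V lW W = tspan V W // null_rel"
    by (simp add: balanced_tensor_def null_rel_def)
  have img: "induced_map V W \<beta> ` (tspan V W // null_rel) = tensor_lift_on V W \<beta> ` tspan V W"
    by (auto simp: quotient_def induced_class[OF True] image_iff)
  have inj: "inj_on (induced_map V W \<beta>) (tspan V W // null_rel) \<longleftrightarrow>
    (\<forall>t\<in>tspan V W. tensor_lift_on V W \<beta> t = 0 \<longrightarrow> t \<in> balanced_null R rV V lW W)" (is "?L \<longleftrightarrow> ?R")
  proof
    assume ?L
    show ?R
    proof (intro ballI impI)
      fix t assume t: "t \<in> tspan V W" "tensor_lift_on V W \<beta> t = 0"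
      have 0: "0 \<in> tspan V W" by (rule cvec.subspace_0[OF tspan_subspace])
      have "induced_map V W \<beta> (null_rel `` {t}) = induced_map V W \<beta> (null_rel `` {0})"
        using t clinear_on_zero[OF lin tspan_subspace] by (simp add: induced_class[OF True] 0)
      then have "null_rel `` {t} = null_rel `` {0}"
        using \<open>?L\<close> t(1) 0 by (meson inj_onD quotientI)
      then have "(t, 0) \<in> null_rel"
        using eq_equiv_class[OF _ null_rel_equiv 0] by simp
      then show "t \<in> balanced_null R rV V lW W" by (simp add: null_rel_def)
    qed
  next
    assume R: ?R
    show ?L
    proof (rule inj_onI)
      fix A B assume "A \<in> tspan V W // null_rel" "B \<in> tspan V W // null_rel"
        and eq: "induced_map V W \<beta> A = induced_map V W \<beta> B"
      then obtain s t where st: "s \<in> tspan V W" "t \<in> tspan V W" "A = null_rel `` {s}" "B = null_rel `` {t}"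
        by (auto simp: quotient_def)
      have "tensor_lift_on V W \<beta> (s - t) = 0"
        using eq clinear_on_diff[OF lin tspan_subspace st(1,2)] by (simp add: induced_class[OF True] st)
      then have "(s, t) \<in> null_rel"
        using R st cvec.subspace_diff[OF tspan_subspace st(1,2)] by (simp add: null_rel_def)
      then show "A = B" using st equiv_class_eq[OF null_rel_equiv] by simp
    qed
  qed
  show ?thesis
    using True unfolding tensor_iso_def B bij_betw_def img inj by (auto simp: balanced_map_def)
next
  case False
  then show ?thesis by (auto simp: tensor_iso_def balanced_map_def)
qed

lemma tensor_iso_induct [consumes 2, case_names zero add mult]:
  assumes "tensor_iso R rV V lW W \<beta> Z" "z \<in> Z" "P 0"
    and "\<And>x y. x \<in> Z \<Longrightarrow> y \<in> Z \<Longrightarrow> P x \<Longrightarrow> P y \<Longrightarrow> P (x + y)"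
    and "\<And>v w. v \<in> V \<Longrightarrow> w \<in> W \<Longrightarrow> P (\<beta> v w)"
  shows "P z"
proof -
  have b: "cbilinear_on V W \<beta>" and Z: "tensor_lift_on V W \<beta> ` tspan V W = Z"
    using assms(1) by (simp_all add: tensor_iso_iff balanced_map_def)
  note lin = tensor_lift_on_clin[OF V W b]
  have "P (tensor_lift_on V W \<beta> t)" if "t \<in> tspan V W" for t
    using that V
  proof (induction rule: tspan_induct)
    case zero
    then show ?case by (simp add: clinear_on_zero[OF lin tspan_subspace] assms(3))
  next
    case (add s t)
    then show ?case using Z by (auto simp: clinear_on_add[OF lin] intro!: assms(4))
  next
    case (tens v w)
    then show ?case by (simp add: tensor_lift_on_tens[OF V W b] assms(5))
  qed
  then show ?thesis using Z assms(2) by auto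
qed

lemma tensor_iso_sum_list:
  assumes "tensor_iso R rV V lW W \<beta> Z" "z \<in> Z"
  shows "\<exists>xs. set xs \<subseteq> V \<times> W \<and> z = (\<Sum>(v, w)\<leftarrow>xs. \<beta> v w)"
  using assms
proof (induction rule: tensor_iso_induct)
  case zero
  then show ?case by (intro exI[of _ "[]"]) simp
next
  case (add x y)
  then obtain xs ys where "set xs \<subseteq> V \<times> W" "x = (\<Sum>(v, w)\<leftarrow>xs. \<beta> v w)"
    "set ys \<subseteq> V \<times> W" "y = (\<Sum>(v, w)\<leftarrow>ys. \<beta> v w)" by auto
  then show ?case by (intro exI[of _ "xs @ ys"]) simp
next
  case (mult v w)
  then show ?case by (intro exI[of _ "[(v, w)]"]) simp
qed

lemma tensor_iso_sum:
  assumes "tensor_iso R rV V lW W \<beta> Z" "z \<in> Z"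
  obtains N v w where "\<And>i. i < (N::nat) \<Longrightarrow> v i \<in> V" "\<And>i. i < N \<Longrightarrow> w i \<in> W"
    "z = (\<Sum>i<N. \<beta> (v i) (w i))"
proof -
  obtain xs where xs: "set xs \<subseteq> V \<times> W" "z = (\<Sum>(v, w)\<leftarrow>xs. \<beta> v w)"
    using tensor_iso_sum_list[OF assms] by auto
  show ?thesis
  proof (rule that[of "length xs" "\<lambda>i. fst (xs ! i)" "\<lambda>i. snd (xs ! i)"])
    fix i assume "i < length xs"
    then have "xs ! i \<in> V \<times> W" using xs(1) by (meson nth_mem subsetD)
    then show "fst (xs ! i) \<in> V" "snd (xs ! i) \<in> W" by auto
  next
    show "z = (\<Sum>i<length xs. \<beta> (fst (xs ! i)) (snd (xs ! i)))"
      unfolding xs(2) by (simp add: sum_list_sum_nth case_prod_unfold atLeast0LessThan)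
  qed
qed

text \<open>The universal property of the balanced tensor product, transported along the isomorphism: to define a
  linear map on \<open>Z\<close> it suffices to give its values on the products \<open>\<beta> v w\<close> in a balanced way. For the
  canonical bundle this extends linear maps from its part of degree zero.\<close>

lemma tensor_iso_factor:
  assumes "tensor_iso R rV V lW W \<beta> Z" "balanced_map \<gamma>"
  shows "\<exists>g. clinear_on Z g \<and> (\<forall>v\<in>V. \<forall>w\<in>W. g (\<beta> v w) = \<gamma> v w)"
proof -
  have bal: "balanced_map \<beta>" and b: "cbilinear_on V W \<beta>" and Z: "tensor_lift_on V W \<beta> ` tspan V W = Z"
    and inj: "\<And>t. t \<in> tspan V W \<Longrightarrow> tensor_lift_on V W \<beta> t = 0 \<Longrightarrow> t \<in> balanced_null R rV V lW W"
    using assms(1) by (simp_all add: tensor_iso_iff balanced_map_def)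
  have c: "cbilinear_on V W \<gamma>" using assms(2) by (simp add: balanced_map_def)
  note lin = tensor_lift_on_clin[OF V W b] and lin' = tensor_lift_on_clin[OF V W c]
  define g where "g z = tensor_lift_on V W \<gamma> (SOME t. t \<in> tspan V W \<and> tensor_lift_on V W \<beta> t = z)" for z
  have g: "g (tensor_lift_on V W \<beta> t) = tensor_lift_on V W \<gamma> t" if t: "t \<in> tspan V W" for t
  proof -
    define s where "s = (SOME s. s \<in> tspan V W \<and> tensor_lift_on V W \<beta> s = tensor_lift_on V W \<beta> t)"
    have s: "s \<in> tspan V W \<and> tensor_lift_on V W \<beta> s = tensor_lift_on V W \<beta> t"
      unfolding s_def by (rule someI[of _ t]) (simp add: t)
    then have "tensor_lift_on V W \<beta> (s - t) = 0"
      using clinear_on_diff[OF lin tspan_subspace, of s t] t by simp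
    then have "tensor_lift_on V W \<gamma> (s - t) = 0"
      by (intro lift_null[OF assms(2)] inj cvec.subspace_diff[OF tspan_subspace]) (use s t in auto)
    then show ?thesis using clinear_on_diff[OF lin' tspan_subspace, of s t] s t
      by (simp add: g_def s_def)
  qed
  show ?thesis
  proof (intro exI[of _ g] conjI ballI)
    show "clinear_on Z g"
    proof (rule clinear_onI)
      fix x y c assume "x \<in> Z" "y \<in> Z"
      then obtain s t where st: "s \<in> tspan V W" "t \<in> tspan V W" "x = tensor_lift_on V W \<beta> s" "y = tensor_lift_on V W \<beta> t"
        using Z by auto
      show "g (x + y) = g x + g y"
        using g[of "s + t"] st cvec.subspace_add[OF tspan_subspace st(1,2)]
        by (simp add: g clinear_on_add[OF lin] clinear_on_add[OF lin'])
      show "g (c *\<^sub>C x) = c *\<^sub>C g x"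
        using g[of "c *\<^sub>C s"] st cvec.subspace_scale[OF tspan_subspace st(1)]
        by (simp add: g clinear_on_scale[OF lin] clinear_on_scale[OF lin'])
    qed
    fix v w assume vw: "v \<in> V" "w \<in> W"
    show "g (\<beta> v w) = \<gamma> v w"
      using g[OF tspan_tens[OF vw]] by (simp add: tensor_lift_on_tens[OF V W b] tensor_lift_on_tens[OF V W c] vw)
  qed
qed

end

text \<open>Tensor products commute with the sum of a family of subspaces; the version for the second factor
  is obtained by flipping.\<close>

lemma tspan_cspan_left:
  assumes "\<And>b. csubspace (F b)" "csubspace W" "t \<in> tspan (cspan (\<Union>b. F b)) W"
  shows "\<exists>B s. finite B \<and> (\<forall>b\<in>B. s b \<in> tspan (F b) W) \<and> t = (\<Sum>b\<in>B. s b)"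
  using assms(3) cvec.subspace_span
proof (induction rule: tspan_induct)
  case zero
  then show ?case by (intro exI[of _ "{}"]) simp
next
  case (add x y)
  then obtain B s B' s' where 1: "finite B" "\<forall>b\<in>B. s b \<in> tspan (F b) W" "x = (\<Sum>b\<in>B. s b)"
    and 2: "finite B'" "\<forall>b\<in>B'. s' b \<in> tspan (F b) W" "y = (\<Sum>b\<in>B'. s' b)" by blast
  let ?s = "\<lambda>b. (if b \<in> B then s b else 0) + (if b \<in> B' then s' b else 0)"
  have "x = (\<Sum>b\<in>B \<union> B'. if b \<in> B then s b else 0)"
    using 1 2(1) by (simp add: sum.inter_restrict[symmetric] Int_absorb1)
  moreover have "y = (\<Sum>b\<in>B \<union> B'. if b \<in> B' then s' b else 0)"
    using 2 1(1) by (simp add: sum.inter_restrict[symmetric] Int_absorb1)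
  ultimately have "x + y = (\<Sum>b\<in>B \<union> B'. ?s b)" by (simp add: sum.distrib)
  moreover have "?s b \<in> tspan (F b) W" for b
    using 1(2) 2(2) by (intro cvec.subspace_add[OF tspan_subspace]) (simp_all add: cvec.subspace_0[OF tspan_subspace])
  ultimately show ?case using 1(1) 2(1) by (intro exI[of _ "B \<union> B'"] exI[of _ ?s]) blast
next
  case (tens v w)
  from tens(1) show ?case
  proof (induction rule: cvec.span_induct_alt)
    case base
    then show ?case by (intro exI[of _ "{}"]) (simp add: tens_zero_left)
  next
    case (step c x y)
    then obtain b0 B s where b0: "x \<in> F b0" and 1: "finite B" "\<forall>b\<in>B. s b \<in> tspan (F b) W" "y \<otimes> w = (\<Sum>b\<in>B. s b)"
      by blast
    let ?s = "\<lambda>b. (if b = b0 then (c *\<^sub>C x) \<otimes> w else 0) + (if b \<in> B then s b else 0)"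
    have "y \<otimes> w = (\<Sum>b\<in>insert b0 B. if b \<in> B then s b else 0)"
      using 1 by (simp add: sum.inter_restrict[symmetric] Int_absorb1 subset_insertI del: sum.insert)
    moreover have "(c *\<^sub>C x) \<otimes> w = (\<Sum>b\<in>insert b0 B. if b = b0 then (c *\<^sub>C x) \<otimes> w else 0)"
      using 1 by (simp add: sum.delta del: sum.insert)
    ultimately have "(c *\<^sub>C x + y) \<otimes> w = (\<Sum>b\<in>insert b0 B. ?s b)" by (simp add: sum.distrib tens_add_left del: sum.insert)
    moreover have "?s b \<in> tspan (F b) W" for b
      using 1(2) b0 tens(2) cvec.subspace_scale[OF assms(1) b0, of c]
      by (intro cvec.subspace_add[OF tspan_subspace]) (simp_all add: cvec.subspace_0[OF tspan_subspace] tspan_tens)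
    ultimately show ?case using 1(1) by (intro exI[of _ "insert b0 B"] exI[of _ ?s]) blast
  qed
qed

definition tensor_flip :: "('v::complex_vector, 'w::complex_vector) tensor \<Rightarrow> ('w, 'v) tensor"
  where "tensor_flip = tensor_lift (\<lambda>v w. w \<otimes> v)"

lemma tensor_flip_clin: "clin tensor_flip"
  unfolding tensor_flip_def by (intro tensor_lift_clin clin_intros)

lemma tensor_flip_tens: "tensor_flip (v \<otimes> w) = w \<otimes> v"
  unfolding tensor_flip_def by (intro tensor_lift_tens clin_intros)

lemma tensor_flip_flip: "tensor_flip (tensor_flip t) = t"
  by (induction t rule: tensor_induct)
     (simp_all add: clin_zero[OF tensor_flip_clin] clin_add[OF tensor_flip_clin] tensor_flip_tens)

lemma tensor_flip_tspan:
  assumes "csubspace V" "t \<in> tspan V W"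
  shows "tensor_flip t \<in> tspan W V"
  using assms(2,1)
  by (induction rule: tspan_induct)
     (simp_all add: clin_zero[OF tensor_flip_clin] clin_add[OF tensor_flip_clin] tensor_flip_tens
       tspan_tens cvec.subspace_0[OF tspan_subspace] cvec.subspace_add[OF tspan_subspace])

lemma tspan_cspan_right:
  assumes "\<And>b. csubspace (F b)" "csubspace V" "t \<in> tspan V (cspan (\<Union>b. F b))"
  shows "\<exists>B s. finite B \<and> (\<forall>b\<in>B. s b \<in> tspan V (F b)) \<and> t = (\<Sum>b\<in>B. s b)"
proof -
  obtain B s where B: "finite B" "\<forall>b\<in>B. s b \<in> tspan (F b) V" "tensor_flip t = (\<Sum>b\<in>B. s b)"
    using tspan_cspan_left[OF assms(1,2) tensor_flip_tspan[OF assms(2,3)]] by blast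
  have "t = (\<Sum>b\<in>B. tensor_flip (s b))"
    using B(3) tensor_flip_flip[of t] by (simp add: clin_sum[OF tensor_flip_clin])
  moreover have "\<forall>b\<in>B. tensor_flip (s b) \<in> tspan V (F b)"
    using B(2) tensor_flip_tspan[OF assms(1)] by blast
  ultimately show ?thesis using B(1) by (intro exI[of _ B] exI[of _ "\<lambda>b. tensor_flip (s b)"] conjI)
qed

text \<open>The homogeneous parts of a tensor have images in different summands \<open>Z b\<close>. If the tensor is mapped to
  zero then so is each part, which is then a combination of the balancing relations in its own degree.\<close>

lemma tensor_iso_direct_sum:
  assumes B: "balanced_data R rV V lW W" and Bb: "\<And>b. balanced_data R rV (V' b) lW (W' b)"
    and iso: "\<And>b. tensor_iso R rV (V' b) lW (W' b) \<beta> (Z b)"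
    and sub: "\<And>b. V' b \<subseteq> V" "\<And>b. W' b \<subseteq> W"
    and bil: "cbilinear_on V W \<beta>"
    and bal: "\<And>v a w. v \<in> V \<Longrightarrow> a \<in> R \<Longrightarrow> w \<in> W \<Longrightarrow> \<beta> (rV v a) w = \<beta> v (lW a w)"
    and mem: "\<And>v w. v \<in> V \<Longrightarrow> w \<in> W \<Longrightarrow> \<beta> v w \<in> cspan (\<Union>b. Z b)"
    and dec: "\<And>t. t \<in> tspan V W \<Longrightarrow>
      \<exists>B s. finite B \<and> (\<forall>b\<in>B. s b \<in> tspan (V' b) (W' b)) \<and> t = (\<Sum>b\<in>B. s b)"
    and pr: "\<And>b. clin (pr b)" "\<And>b z. z \<in> Z b \<Longrightarrow> pr b z = z"
      "\<And>b c z. z \<in> Z c \<Longrightarrow> c \<noteq> b \<Longrightarrow> pr b z = 0"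
  shows "tensor_iso R rV V lW W \<beta> (cspan (\<Union>b. Z b))"
proof -
  interpret balanced_data R rV V lW W by fact
  interpret b: balanced_data R rV "V' b" lW "W' b" for b by fact
  note lin = tensor_lift_on_clin[OF V W bil]
  have bil_b: "cbilinear_on (V' b) (W' b) \<beta>" for b by (rule cbilinear_on_subset[OF bil sub])
  have lift_eq: "tensor_lift_on (V' b) (W' b) \<beta> t = tensor_lift_on V W \<beta> t" if t: "t \<in> tspan (V' b) (W' b)" for t b
  proof -
    have t': "t \<in> tspan V W" using t tspan_mono[OF sub] by blast
    show ?thesis
      unfolding tensor_lift_on_eq_extend[OF V W bil t']
      by (rule tensor_lift_on_eq[OF b.V b.W t bilinear_extend[OF V W bil]])
         (simp add: subspace_proj_id[OF V subsetD[OF sub(1)]] subspace_proj_id[OF W subsetD[OF sub(2)]])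
  qed
  have null_mono: "balanced_null R rV (V' b) lW (W' b) \<subseteq> balanced_null R rV V lW W" for b
    unfolding balanced_null_def by (rule cvec.span_mono) (use sub in blast)
  have Zb: "tensor_lift_on V W \<beta> ` tspan (V' b) (W' b) = Z b" for b
    using iso[of b] lift_eq by (auto simp: b.tensor_iso_iff image_iff)
  show ?thesis
    unfolding tensor_iso_iff
  proof (intro conjI ballI impI)
    show "balanced_map \<beta>" using bil bal by (simp add: balanced_map_def)
    show "\<beta> v w \<in> cspan (\<Union>b. Z b)" if "v \<in> V" "w \<in> W" for v w by (rule mem[OF that])
    have "csubspace (tensor_lift_on V W \<beta> ` tspan V W)"
    proof (rule cvec.subspaceI)
      show "0 \<in> tensor_lift_on V W \<beta> ` tspan V W"
        using clinear_on_zero[OF lin tspan_subspace] cvec.subspace_0[OF tspan_subspace, of V W] by force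
      fix x y c assume "x \<in> tensor_lift_on V W \<beta> ` tspan V W" "y \<in> tensor_lift_on V W \<beta> ` tspan V W"
      then obtain s t where "s \<in> tspan V W" "t \<in> tspan V W" "x = tensor_lift_on V W \<beta> s" "y = tensor_lift_on V W \<beta> t"
        by auto
      then show "x + y \<in> tensor_lift_on V W \<beta> ` tspan V W" "c *\<^sub>C x \<in> tensor_lift_on V W \<beta> ` tspan V W"
        using clinear_on_add[OF lin, of s t] clinear_on_scale[OF lin, of s c]
          cvec.subspace_add[OF tspan_subspace, of s V W t] cvec.subspace_scale[OF tspan_subspace, of s V W c]
        by (metis imageI)+
    qed
    moreover have "Z b \<subseteq> tensor_lift_on V W \<beta> ` tspan V W" for b
      using Zb[of b] tspan_mono[OF sub[of b]] by blast
    ultimately have 1: "cspan (\<Union>b. Z b) \<subseteq> tensor_lift_on V W \<beta> ` tspan V W"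
      by (intro csubspace_cspan_least) auto
    have "tensor_lift_on V W \<beta> t \<in> cspan (\<Union>b. Z b)" if "t \<in> tspan V W" for t
      using that V
    proof (induction rule: tspan_induct)
      case zero
      then show ?case by (simp add: clinear_on_zero[OF lin tspan_subspace] cvec.span_zero)
    next
      case (add s t)
      then show ?case by (simp add: clinear_on_add[OF lin] cvec.span_add)
    next
      case (tens v w)
      then show ?case by (simp add: tensor_lift_on_tens[OF V W bil] mem)
    qed
    with 1 show "tensor_lift_on V W \<beta> ` tspan V W = cspan (\<Union>b. Z b)" by blast
    fix t assume t: "t \<in> tspan V W" and 0: "tensor_lift_on V W \<beta> t = 0"
    obtain B s where B: "finite B" "\<And>b. b \<in> B \<Longrightarrow> s b \<in> tspan (V' b) (W' b)" "t = (\<Sum>b\<in>B. s b)"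
      using dec[OF t] by blast
    have sV: "s b \<in> tspan V W" if "b \<in> B" for b using B(2)[OF that] tspan_mono[OF sub] by blast
    have sum0: "(\<Sum>b\<in>B. tensor_lift_on V W \<beta> (s b)) = 0"
      using 0 clinear_on_sum[OF lin tspan_subspace sV, of B "\<lambda>b. b"] by (simp add: B(3))
    have "s b \<in> balanced_null R rV V lW W" if b: "b \<in> B" for b
    proof -
      have "0 = pr b (\<Sum>c\<in>B. tensor_lift_on V W \<beta> (s c))" by (simp add: sum0 clin_zero[OF pr(1)])
      also have "\<dots> = (\<Sum>c\<in>B. pr b (tensor_lift_on V W \<beta> (s c)))" by (rule clin_sum[OF pr(1)])
      also have "\<dots> = (\<Sum>c\<in>B. if c = b then tensor_lift_on V W \<beta> (s b) else 0)"
      proof (intro sum.cong refl)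
        fix c assume "c \<in> B"
        then have "tensor_lift_on V W \<beta> (s c) \<in> Z c" using Zb[of c] B(2) by blast
        then show "pr b (tensor_lift_on V W \<beta> (s c)) = (if c = b then tensor_lift_on V W \<beta> (s b) else 0)"
          using pr(2)[of "tensor_lift_on V W \<beta> (s c)" c] pr(3)[of "tensor_lift_on V W \<beta> (s c)" c b]
          by (cases "c = b") simp_all
      qed
      also have "\<dots> = tensor_lift_on V W \<beta> (s b)" using b B(1) by simp
      finally have "tensor_lift_on (V' b) (W' b) \<beta> (s b) = 0" using lift_eq[OF B(2)[OF b]] by simp
      then have "s b \<in> balanced_null R rV (V' b) lW (W' b)"
        using iso[of b] B(2)[OF b] by (simp add: b.tensor_iso_iff)
      then show ?thesis using null_mono by blast
    qed
    then show "t \<in> balanced_null R rV V lW W"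
      unfolding B(3) by (rule cvec.subspace_sum[OF null_sub])
  qed
qed

section \<open>Bimodules and their duals\<close>

lemma sum_fun_apply: "(\<Sum>i\<in>I. f i) x = (\<Sum>i\<in>I. f i x)" for f :: "'i \<Rightarrow> 'x \<Rightarrow> 'y::comm_monoid_add"
  by (induction I rule: infinite_finite_induct) simp_all

text \<open>Rings and modules are subspaces of ambient types, and the operations are constrained there only.\<close>

locale sub_bimodule =
  fixes R :: "'w::complex_algebra_1 set" and l :: "'w \<Rightarrow> 'x::complex_vector \<Rightarrow> 'x"
    and r :: "'x \<Rightarrow> 'w \<Rightarrow> 'x" and V :: "'x set"
  assumes R_sub: "csubspace R" and R_one: "1 \<in> R" and R_mult: "a \<in> R \<Longrightarrow> b \<in> R \<Longrightarrow> a * b \<in> R"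
    and V_sub: "csubspace V"
    and l_bilin: "cbilinear_on R V l" and l_mem: "a \<in> R \<Longrightarrow> x \<in> V \<Longrightarrow> l a x \<in> V"
    and l_one: "x \<in> V \<Longrightarrow> l 1 x = x"
    and l_mult: "a \<in> R \<Longrightarrow> b \<in> R \<Longrightarrow> x \<in> V \<Longrightarrow> l (a * b) x = l a (l b x)"
    and r_bilin: "cbilinear_on V R r" and r_mem: "x \<in> V \<Longrightarrow> a \<in> R \<Longrightarrow> r x a \<in> V"
    and r_one: "x \<in> V \<Longrightarrow> r x 1 = x"
    and r_mult: "a \<in> R \<Longrightarrow> b \<in> R \<Longrightarrow> x \<in> V \<Longrightarrow> r x (a * b) = r (r x a) b"
    and l_r: "a \<in> R \<Longrightarrow> b \<in> R \<Longrightarrow> x \<in> V \<Longrightarrow> r (l a x) b = l a (r x b)"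
begin

lemmas l_add_left = clinear_on_add[OF cbilinear_on_left[OF l_bilin]]
lemmas l_scale_left = clinear_on_scale[OF cbilinear_on_left[OF l_bilin]]
lemmas l_sum_left = clinear_on_sum[OF cbilinear_on_left[OF l_bilin] R_sub]
lemmas l_sum_right = clinear_on_sum[OF cbilinear_on_right[OF l_bilin] V_sub]
lemmas r_add_left = clinear_on_add[OF cbilinear_on_left[OF r_bilin]]
lemmas r_add_right = clinear_on_add[OF cbilinear_on_right[OF r_bilin]]
lemmas r_scale_right = clinear_on_scale[OF cbilinear_on_right[OF r_bilin]]
lemmas r_diff_right = clinear_on_diff[OF cbilinear_on_right[OF r_bilin] R_sub]

abbreviation dual :: "('x \<Rightarrow> 'w) set" where "dual \<equiv> left_hom R l V"

definition dual_lact :: "'w \<Rightarrow> ('x \<Rightarrow> 'w) \<Rightarrow> ('x \<Rightarrow> 'w)"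
  where "dual_lact e \<phi> = (\<lambda>x. if x \<in> V then \<phi> (r x e) else 0)"

definition dual_ract :: "('x \<Rightarrow> 'w) \<Rightarrow> 'w \<Rightarrow> ('x \<Rightarrow> 'w)"
  where "dual_ract \<phi> e = (\<lambda>x. \<phi> x * e)"

lemma dual_mem: "\<phi> \<in> dual \<Longrightarrow> x \<in> V \<Longrightarrow> \<phi> x \<in> R"
  and dual_add: "\<phi> \<in> dual \<Longrightarrow> x \<in> V \<Longrightarrow> y \<in> V \<Longrightarrow> \<phi> (x + y) = \<phi> x + \<phi> y"
  and dual_l: "\<phi> \<in> dual \<Longrightarrow> a \<in> R \<Longrightarrow> x \<in> V \<Longrightarrow> \<phi> (l a x) = a * \<phi> x"
  and dual_out: "\<phi> \<in> dual \<Longrightarrow> x \<notin> V \<Longrightarrow> \<phi> x = 0"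
  by (auto simp: left_hom_def)

lemma R_scalar: "c *\<^sub>C 1 \<in> R"
  by (rule cvec.subspace_scale[OF R_sub R_one])

lemma dual_scale:
  assumes "\<phi> \<in> dual" "x \<in> V"
  shows "\<phi> (c *\<^sub>C x) = c *\<^sub>C \<phi> x"
  using dual_l[OF assms(1) R_scalar assms(2), of c] l_scale_left[OF assms(2) R_one, of c]
  by (simp add: l_one assms mult_scaleC_left)

lemma dual_clinear: "\<phi> \<in> dual \<Longrightarrow> clinear_on V \<phi>"
  by (intro clinear_onI dual_add dual_scale)

lemma dual_zero: "\<phi> \<in> dual \<Longrightarrow> \<phi> 0 = 0"
  by (rule clinear_on_zero[OF dual_clinear V_sub])

lemma dual_sum: "\<phi> \<in> dual \<Longrightarrow> (\<And>i. i \<in> I \<Longrightarrow> g i \<in> V) \<Longrightarrow> \<phi> (\<Sum>i\<in>I. g i) = (\<Sum>i\<in>I. \<phi> (g i))"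
  by (rule clinear_on_sum[OF dual_clinear V_sub])

lemma dualI:
  assumes "\<And>x. x \<in> V \<Longrightarrow> \<phi> x \<in> R" "\<And>x y. x \<in> V \<Longrightarrow> y \<in> V \<Longrightarrow> \<phi> (x + y) = \<phi> x + \<phi> y"
    "\<And>a x. a \<in> R \<Longrightarrow> x \<in> V \<Longrightarrow> \<phi> (l a x) = a * \<phi> x" "\<And>x. x \<notin> V \<Longrightarrow> \<phi> x = 0"
  shows "\<phi> \<in> dual"
  using assms by (auto simp: left_hom_def)

lemma dual_eqI:
  assumes "\<phi> \<in> dual" "\<psi> \<in> dual" "\<And>x. x \<in> V \<Longrightarrow> \<phi> x = \<psi> x"
  shows "\<phi> = \<psi>"
  using assms dual_out by (metis ext)

lemma dual_sub: "csubspace dual"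
proof (rule cvec.subspaceI)
  show "0 \<in> dual" by (rule dualI) (simp_all add: cvec.subspace_0[OF R_sub])
  show "\<phi> + \<psi> \<in> dual" if "\<phi> \<in> dual" "\<psi> \<in> dual" for \<phi> \<psi>
    by (rule dualI) (use that in \<open>simp_all add: dual_mem cvec.subspace_add[OF R_sub] dual_add dual_l dual_out algebra_simps\<close>)
  show "c *\<^sub>C \<phi> \<in> dual" if "\<phi> \<in> dual" for \<phi> c
    by (rule dualI) (use that in \<open>simp_all add: scaleC_fun_def dual_mem cvec.subspace_scale[OF R_sub] dual_add
          dual_l dual_out scaleC_add_right mult_scaleC_right\<close>)
qed

lemma dual_lact_mem:
  assumes "e \<in> R" "\<phi> \<in> dual"
  shows "dual_lact e \<phi> \<in> dual"
  by (rule dualI) (use assms in \<open>auto simp: dual_lact_def dual_mem r_mem r_add_left cvec.subspace_add[OF V_sub] dual_add l_mem l_r dual_l\<close>)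

lemma dual_ract_mem:
  assumes "\<phi> \<in> dual" "e \<in> R"
  shows "dual_ract \<phi> e \<in> dual"
  by (rule dualI) (use assms in \<open>auto simp: dual_ract_def dual_mem R_mult dual_add dual_l dual_out distrib_right mult.assoc\<close>)

lemma dual_sub_bimodule: "sub_bimodule R dual_lact dual_ract dual"
proof
  show "cbilinear_on R dual dual_lact"
  proof (intro cbilinear_onI clinear_onI ext)
    fix \<phi> e c x assume m: "\<phi> \<in> dual" "e \<in> R"
    show "dual_lact e (\<phi> + \<psi>) x = (dual_lact e \<phi> + dual_lact e \<psi>) x" for \<psi>
      by (simp add: dual_lact_def)
    show "dual_lact e (c *\<^sub>C \<phi>) x = (c *\<^sub>C dual_lact e \<phi>) x"
      by (simp add: dual_lact_def scaleC_fun_def)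
    show "dual_lact (e + e') \<phi> x = (dual_lact e \<phi> + dual_lact e' \<phi>) x" if "e' \<in> R" for e'
      using m that by (simp add: dual_lact_def r_add_right dual_add r_mem)
    show "dual_lact (c *\<^sub>C e) \<phi> x = (c *\<^sub>C dual_lact e \<phi>) x"
      using m by (simp add: dual_lact_def scaleC_fun_def r_scale_right dual_scale r_mem)
  qed
  show "cbilinear_on dual R dual_ract"
    by (intro cbilinear_onI clinear_onI ext)
       (simp_all add: dual_ract_def scaleC_fun_def distrib_left distrib_right mult_scaleC_left mult_scaleC_right)
qed (simp_all add: R_sub R_one R_mult dual_sub dual_lact_mem dual_ract_mem,
     auto simp: dual_lact_def dual_ract_def fun_eq_iff r_mem r_one r_mult dual_out mult.assoc)

text \<open>The dual basis criterion. The elements \<open>x i\<close> may repeat, so coefficients of equal generators are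
  added up.\<close>

lemma dual_basis_projective:
  fixes \<phi> :: "'i \<Rightarrow> 'x \<Rightarrow> 'w"
  assumes "finite I" "\<And>i. i \<in> I \<Longrightarrow> \<phi> i \<in> dual" "\<And>i. i \<in> I \<Longrightarrow> x i \<in> V"
    and exp: "\<And>y. y \<in> V \<Longrightarrow> (\<Sum>i\<in>I. l (\<phi> i y) (x i)) = y"
  shows "left_projective R l V" "finitely_generated_by R l (x ` I) V"
proof -
  define J where "J = x ` I"
  have J: "finite J" "J \<subseteq> V" using assms by (auto simp: J_def)
  define e where "e y g = (\<Sum>i | i \<in> I \<and> x i = g. \<phi> i y)" for y g
  have e_mem: "e y g \<in> R" if "y \<in> V" for y g
    unfolding e_def by (rule cvec.subspace_sum[OF R_sub]) (use that assms dual_mem in auto)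
  have e_exp: "(\<Sum>g\<in>J. l (e y g) g) = y" if y: "y \<in> V" for y
  proof -
    have "l (e y g) g = (\<Sum>i | i \<in> I \<and> x i = g. l (\<phi> i y) (x i))" if "g \<in> J" for g
      unfolding e_def using that J assms(2) y by (subst l_sum_left) (auto intro!: dual_mem)
    then show ?thesis using sum.image_gen[OF assms(1), of "\<lambda>i. l (\<phi> i y) (x i)" x] exp[OF y]
      by (simp add: J_def)
  qed
  show "finitely_generated_by R l (x ` I) V"
    unfolding finitely_generated_by_def J_def[symmetric]
  proof (intro conjI ballI)
    fix y assume "y \<in> V"
    then show "\<exists>c. (\<forall>g\<in>J. c g \<in> R) \<and> y = (\<Sum>g\<in>J. l (c g) g)"
      by (intro exI[of _ "e y"]) (simp add: e_mem e_exp)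
  qed (use J in auto)
  define s where "s y = (\<Sum>i\<in>I. Poly_Mapping.single (x i) (\<phi> i y))" for y
  define p where "p f = (\<Sum>g\<in>J. l (Poly_Mapping.lookup f g) g)" for f :: "'x \<Rightarrow>\<^sub>0 'w"
  have look: "Poly_Mapping.lookup (s y) g = e y g" for y g
    unfolding s_def e_def using assms(1)
    by (simp add: lookup_sum lookup_single when_def sum.If_cases Int_def)
  have map_look: "Poly_Mapping.lookup (Poly_Mapping.map ((*) a) f) g = a * Poly_Mapping.lookup f g"
    for a :: 'w and f :: "'x \<Rightarrow>\<^sub>0 'w" and g
    by (simp add: Poly_Mapping.map.rep_eq when_def)
  show "left_projective R l V"
    unfolding left_projective_def
  proof (intro exI[of _ J] exI[of _ s] exI[of _ p] conjI ballI)
    fix y assume y: "y \<in> V"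
    have "e y g = 0" if "g \<notin> J" for g using that by (auto simp: e_def J_def intro!: sum.neutral)
    then have "g \<in> J" if "e y g \<noteq> 0" for g using that by blast
    then show "s y \<in> free_left_module R J"
      using e_mem[OF y] by (auto simp: free_left_module_def look in_keys_iff subset_iff)
    show "s (y + z) = s y + s z" if "z \<in> V" for z
      by (rule poly_mapping_eqI)
         (use assms(2) y that in \<open>auto simp: look lookup_add e_def dual_add sum.distrib[symmetric] intro!: sum.cong\<close>)
    show "p (s y) = y" using e_exp[OF y] by (simp add: p_def look)
  next
    fix a y assume "a \<in> R" "y \<in> V"
    then show "s (l a y) = Poly_Mapping.map ((*) a) (s y)"
      by (intro poly_mapping_eqI)
         (use assms(2) in \<open>auto simp: look map_look e_def dual_l sum_distrib_left intro!: sum.cong\<close>)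
  next
    fix f assume f: "f \<in> free_left_module R J"
    have fm: "Poly_Mapping.lookup f j \<in> R" for j using f by (auto simp: free_left_module_def)
    show "p f \<in> V" unfolding p_def
      by (rule cvec.subspace_sum[OF V_sub]) (use fm J l_mem in auto)
    show "p (f + g) = p f + p g" if "g \<in> free_left_module R J" for g
    proof -
      have "Poly_Mapping.lookup g j \<in> R" for j using that by (auto simp: free_left_module_def)
      then show ?thesis unfolding p_def
        using fm J by (auto simp: lookup_add l_add_left sum.distrib[symmetric] intro!: sum.cong)
    qed
  next
    fix a f assume a: "a \<in> R" and f: "f \<in> free_left_module R J"
    have fm: "Poly_Mapping.lookup f j \<in> R" for j using f by (auto simp: free_left_module_def)
    have "p (Poly_Mapping.map ((*) a) f) = (\<Sum>j\<in>J. l a (l (Poly_Mapping.lookup f j) j))"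
      unfolding p_def using fm a J by (auto simp: map_look l_mult intro!: sum.cong)
    also have "\<dots> = l a (p f)"
      unfolding p_def using fm a J by (subst l_sum_right) (auto simp: l_mem)
    finally show "p (Poly_Mapping.map ((*) a) f) = l a (p f)" .
  qed
qed

end

text \<open>The conditions of Morita theory in terms of elements: \<open>full\<close> and \<open>faithful\<close> say that the opposite of \<open>R\<close> is
  the ring of left linear endomorphisms of \<open>V\<close>, and \<open>trace\<close> says that \<open>V\<close> is a generator.\<close>

locale invertible_bimodule = sub_bimodule R l r V
  for R :: "'w::complex_algebra_1 set" and l :: "'w \<Rightarrow> 'x::complex_vector \<Rightarrow> 'x" and r V +
  fixes I :: "'i set" and x :: "'i \<Rightarrow> 'x" and y :: "'i \<Rightarrow> 'x \<Rightarrow> 'w"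
  assumes fin: "finite I" and x_mem: "i \<in> I \<Longrightarrow> x i \<in> V" and y_mem: "i \<in> I \<Longrightarrow> y i \<in> left_hom R l V"
    and trace: "(\<Sum>i\<in>I. y i (x i)) = 1"
    and full: "clinear_on V f \<Longrightarrow> (\<And>v. v \<in> V \<Longrightarrow> f v \<in> V) \<Longrightarrow>
      (\<And>a v. a \<in> R \<Longrightarrow> v \<in> V \<Longrightarrow> f (l a v) = l a (f v)) \<Longrightarrow> \<exists>d\<in>R. \<forall>v\<in>V. f v = r v d"
    and faithful: "d \<in> R \<Longrightarrow> (\<And>v. v \<in> V \<Longrightarrow> r v d = 0) \<Longrightarrow> d = 0"
begin

lemma unique: "d \<in> R \<Longrightarrow> d' \<in> R \<Longrightarrow> (\<And>v. v \<in> V \<Longrightarrow> r v d = r v d') \<Longrightarrow> d = d'"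
  using faithful[of "d - d'"] cvec.subspace_diff[OF R_sub, of d d'] by (simp add: r_diff_right)

text \<open>For fixed \<open>\<phi>\<close> and \<open>v\<close> the map \<open>u \<mapsto> \<phi>(u) v\<close> is left linear, hence the right multiplication by an
  element of \<open>R\<close>. This element is the pairing of the Morita context in the order opposite to evaluation; it is
  left linear in \<open>\<phi>\<close>, so pairing with an element of \<open>V\<close> is a linear form on the dual.\<close>

definition pairing :: "('x \<Rightarrow> 'w) \<Rightarrow> 'x \<Rightarrow> 'w"
  where "pairing \<phi> v = (SOME d. d \<in> R \<and> (\<forall>u\<in>V. l (\<phi> u) v = r u d))"

lemma
  assumes "\<phi> \<in> dual" "v \<in> V"
  shows pairing_mem: "pairing \<phi> v \<in> R" and pairing: "u \<in> V \<Longrightarrow> r u (pairing \<phi> v) = l (\<phi> u) v"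
proof -
  have "\<exists>d. d \<in> R \<and> (\<forall>u\<in>V. l (\<phi> u) v = r u d)"
    using full[of "\<lambda>u. l (\<phi> u) v"] assms
    by (auto simp: clinear_on_def dual_mem l_add_left l_scale_left dual_add dual_scale dual_l l_mem l_mult)
  then have "pairing \<phi> v \<in> R \<and> (\<forall>u\<in>V. l (\<phi> u) v = r u (pairing \<phi> v))"
    unfolding pairing_def by (rule someI_ex)
  then show "pairing \<phi> v \<in> R" "u \<in> V \<Longrightarrow> r u (pairing \<phi> v) = l (\<phi> u) v" by simp_all
qed

lemma pairing_dual:
  assumes "v \<in> V"
  shows "(\<lambda>\<phi>. if \<phi> \<in> dual then pairing \<phi> v else 0) \<in> left_hom R dual_lact dual"
proof -
  interpret D: sub_bimodule R dual_lact dual_ract dual by (rule dual_sub_bimodule)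
  show ?thesis
  proof (rule D.dualI)
    show "(if \<phi> \<in> dual then pairing \<phi> v else 0) \<in> R" if "\<phi> \<in> dual" for \<phi>
      using that assms pairing_mem by simp
  next
    fix \<phi> \<psi> assume m: "\<phi> \<in> dual" "\<psi> \<in> dual"
    have "pairing (\<phi> + \<psi>) v = pairing \<phi> v + pairing \<psi> v"
      by (rule unique) (use m assms in \<open>simp_all add: pairing_mem pairing cvec.subspace_add[OF dual_sub]
        cvec.subspace_add[OF R_sub] r_add_right l_add_left dual_mem\<close>)
    then show "(if \<phi> + \<psi> \<in> dual then pairing (\<phi> + \<psi>) v else 0) =
        (if \<phi> \<in> dual then pairing \<phi> v else 0) + (if \<psi> \<in> dual then pairing \<psi> v else 0)"
      using m cvec.subspace_add[OF dual_sub] by simp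
  next
    fix e \<phi> assume m: "e \<in> R" "\<phi> \<in> dual"
    have "pairing (dual_lact e \<phi>) v = e * pairing \<phi> v"
      by (rule unique) (use m assms in \<open>simp_all add: pairing_mem pairing dual_lact_mem R_mult r_mult r_mem, simp_all add: dual_lact_def\<close>)
    then show "(if dual_lact e \<phi> \<in> dual then pairing (dual_lact e \<phi>) v else 0) =
        e * (if \<phi> \<in> dual then pairing \<phi> v else 0)"
      using m dual_lact_mem by simp
  qed simp
qed

text \<open>Evaluated at \<open>v\<close>, the sum is \<open>\<Sum> \<phi>(v) y\<^sub>i(x\<^sub>i)\<close>. So the \<open>y\<^sub>i\<close> together with the pairings with the
  \<open>x\<^sub>i\<close> are a dual basis of the dual.\<close>

lemma pairing_expansion:
  assumes "\<phi> \<in> dual"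
  shows "(\<Sum>i\<in>I. dual_lact (pairing \<phi> (x i)) (y i)) = \<phi>"
proof (rule dual_eqI)
  show "(\<Sum>i\<in>I. dual_lact (pairing \<phi> (x i)) (y i)) \<in> dual"
    by (rule cvec.subspace_sum[OF dual_sub]) (use assms x_mem y_mem pairing_mem dual_lact_mem in auto)
  fix v assume v: "v \<in> V"
  have "(\<Sum>i\<in>I. dual_lact (pairing \<phi> (x i)) (y i)) v = (\<Sum>i\<in>I. \<phi> v * y i (x i))"
    using v assms
    by (auto simp: sum_fun_apply dual_lact_def pairing x_mem y_mem dual_l dual_mem intro!: sum.cong)
  then show "(\<Sum>i\<in>I. dual_lact (pairing \<phi> (x i)) (y i)) v = \<phi> v"
    by (simp add: sum_distrib_left[symmetric] trace)
qed (rule assms)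

lemma dual_projective: "left_projective R dual_lact dual"
  and dual_finitely_generated: "finitely_generated_by R dual_lact (y ` I) dual"
proof -
  interpret D: sub_bimodule R dual_lact dual_ract dual by (rule dual_sub_bimodule)
  define \<Psi> where "\<Psi> i = (\<lambda>\<phi>. if \<phi> \<in> dual then pairing \<phi> (x i) else 0)" for i
  have "\<Psi> i \<in> D.dual" if "i \<in> I" for i unfolding \<Psi>_def by (rule pairing_dual[OF x_mem[OF that]])
  moreover have "(\<Sum>i\<in>I. dual_lact (\<Psi> i \<phi>) (y i)) = \<phi>" if "\<phi> \<in> dual" for \<phi>
    using pairing_expansion[OF that] that by (simp add: \<Psi>_def)
  ultimately show "left_projective R dual_lact dual" "finitely_generated_by R dual_lact (y ` I) dual"
    using D.dual_basis_projective[OF fin, of \<Psi> y] y_mem by blast+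
qed

text \<open>The inverse of evaluation maps \<open>e\<close> to \<open>\<Sum> x\<^sub>i \<otimes> y\<^sub>i e\<close>. Modulo the balancing relations,
  \<open>v \<otimes> \<phi> = \<Sum> y\<^sub>i(x\<^sub>i) v \<otimes> \<phi> = \<Sum> x\<^sub>i [y\<^sub>i, v] \<otimes> \<phi> = \<Sum> x\<^sub>i \<otimes> [y\<^sub>i, v] \<phi>\<close> for the pairing above, and
  \<open>[y\<^sub>i, v] \<phi> = y\<^sub>i \<phi>(v)\<close>.\<close>

theorem evaluation_iso: "evaluation_bimodule_iso R l r V dual_lact dual_ract dual"
proof -
  interpret balanced_data R r V dual_lact dual
    by unfold_locales (simp_all add: V_sub dual_sub r_mem dual_lact_mem)
  have bil: "cbilinear_on V dual (\<lambda>v \<phi>. \<phi> v)"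
    by (auto intro!: cbilinear_onI dual_clinear simp: clinear_on_def scaleC_fun_def)
  note lin = tensor_lift_on_clin[OF V_sub dual_sub bil]
  have bal: "balanced_map (\<lambda>v \<phi>. \<phi> v)"
    by (auto simp: balanced_map_def bil dual_lact_def)
  have eval_tens: "tensor_lift_on V dual (\<lambda>v \<phi>. \<phi> v) (v \<otimes> \<phi>) = \<phi> v" if "v \<in> V" "\<phi> \<in> dual" for v \<phi>
    using tensor_lift_on_tens[OF V_sub dual_sub bil that] .
  define canon where "canon e = (\<Sum>i\<in>I. x i \<otimes> dual_ract (y i) e)" for e
  have canon_diff: "t - canon (tensor_lift_on V dual (\<lambda>v \<phi>. \<phi> v) t) \<in> balanced_null R r V dual_lact dual"
    if "t \<in> tspan V dual" for t
    using that V_sub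
  proof (induction rule: tspan_induct)
    case zero
    have "canon 0 = 0" by (simp add: canon_def dual_ract_def tens_zero_right zero_fun_def[symmetric])
    then show ?case using cvec.subspace_0[OF null_sub] by (simp add: clinear_on_zero[OF lin tspan_subspace])
  next
    case (add s t)
    have "canon (a + b) = canon a + canon b" for a b
    proof -
      have "dual_ract \<phi> (a + b) = dual_ract \<phi> a + dual_ract \<phi> b" for \<phi>
        by (auto simp: dual_ract_def distrib_left)
      then show ?thesis by (simp add: canon_def tens_add_right sum.distrib)
    qed
    then show ?case using cvec.subspace_add[OF null_sub add(3,4)] add(1,2)
      by (simp add: clinear_on_add[OF lin] algebra_simps)
  next
    case (tens v \<phi>)
    have key: "dual_lact (pairing (y i) v) \<phi> = dual_ract (y i) (\<phi> v)" if "i \<in> I" for i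
      by (rule dual_eqI)
         (use that tens y_mem in \<open>auto simp: dual_lact_mem pairing_mem dual_ract_mem dual_mem,
           auto simp: dual_lact_def dual_ract_def pairing dual_l dual_mem\<close>)
    have split: "v = (\<Sum>i\<in>I. r (x i) (pairing (y i) v))"
    proof -
      have "(\<Sum>i\<in>I. r (x i) (pairing (y i) v)) = (\<Sum>i\<in>I. l (y i (x i)) v)"
        using tens x_mem y_mem by (auto simp: pairing intro!: sum.cong)
      also have "\<dots> = l (\<Sum>i\<in>I. y i (x i)) v"
        using tens x_mem y_mem by (subst l_sum_left) (auto simp: dual_mem)
      finally show ?thesis using tens by (simp add: trace l_one)
    qed
    have "v \<otimes> \<phi> = (\<Sum>i\<in>I. r (x i) (pairing (y i) v) \<otimes> \<phi>)"
      by (subst split) (rule clin_sum[OF cbilinear_on_left[OF tens_cbilin UNIV_I]])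
    then have "v \<otimes> \<phi> - canon (\<phi> v) =
      (\<Sum>i\<in>I. r (x i) (pairing (y i) v) \<otimes> \<phi> - x i \<otimes> dual_lact (pairing (y i) v) \<phi>)"
      by (simp add: canon_def sum_subtractf key)
    also have "\<dots> \<in> balanced_null R r V dual_lact dual"
      unfolding balanced_null_def
      by (rule cvec.span_sum, rule cvec.span_base) (use tens x_mem y_mem pairing_mem in blast)
    finally show ?case using tens by (simp add: eval_tens)
  qed
  have canon_mem: "canon e \<in> tspan V dual" if "e \<in> R" for e
    unfolding canon_def
    by (rule cvec.subspace_sum[OF tspan_subspace]) (use that x_mem y_mem dual_ract_mem tspan_tens in blast)
  have canon_eval: "tensor_lift_on V dual (\<lambda>v \<phi>. \<phi> v) (canon e) = e" if e: "e \<in> R" for e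
  proof -
    have "tensor_lift_on V dual (\<lambda>v \<phi>. \<phi> v) (canon e) = (\<Sum>i\<in>I. y i (x i) * e)"
      unfolding canon_def using e x_mem y_mem
      by (subst clinear_on_sum[OF lin tspan_subspace])
         (auto simp: eval_tens dual_ract_mem tspan_tens, auto simp: dual_ract_def)
    then show ?thesis by (simp add: sum_distrib_right[symmetric] trace)
  qed
  have "tensor_iso R r V dual_lact dual (\<lambda>v \<phi>. \<phi> v) R"
    unfolding tensor_iso_iff
  proof (intro conjI ballI impI)
    show "balanced_map (\<lambda>v \<phi>. \<phi> v)" by (rule bal)
    show "\<phi> v \<in> R" if "v \<in> V" "\<phi> \<in> dual" for v \<phi> using that dual_mem by simp
    have "tensor_lift_on V dual (\<lambda>v \<phi>. \<phi> v) t \<in> R" if "t \<in> tspan V dual" for t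
      using that V_sub
      by (induction rule: tspan_induct)
         (simp_all add: clinear_on_zero[OF lin tspan_subspace] clinear_on_add[OF lin] eval_tens dual_mem
           cvec.subspace_0[OF R_sub] cvec.subspace_add[OF R_sub])
    then show "tensor_lift_on V dual (\<lambda>v \<phi>. \<phi> v) ` tspan V dual = R"
      using canon_mem canon_eval by (force simp: image_iff)
    fix t assume "t \<in> tspan V dual" "tensor_lift_on V dual (\<lambda>v \<phi>. \<phi> v) t = 0"
    moreover have "canon 0 = 0" by (simp add: canon_def dual_ract_def tens_zero_right zero_fun_def[symmetric])
    ultimately show "t \<in> balanced_null R r V dual_lact dual" using canon_diff[of t] by simp
  qed
  then show ?thesis
    unfolding evaluation_bimodule_iso_def by (auto simp: dual_l dual_ract_def)
qed

end

section \<open>Gradings\<close>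

lemma decomposition_superset:
  assumes "is_decomposition I F x f" "finite S" "{i. f i \<noteq> 0} \<subseteq> S"
  shows "x = (\<Sum>i\<in>S. f i)"
proof -
  have "(\<Sum>i | f i \<noteq> 0. f i) = (\<Sum>i\<in>S. f i)"
    by (rule sum.mono_neutral_left) (use assms in auto)
  then show ?thesis using assms(1) by (simp add: is_decomposition_def)
qed

lemma decompositionI:
  assumes "\<And>i. i \<in> I \<Longrightarrow> f i \<in> F i" "\<And>i. i \<notin> I \<Longrightarrow> f i = 0" "finite S" "{i. f i \<noteq> 0} \<subseteq> S"
    "x = (\<Sum>i\<in>S. f i)"
  shows "is_decomposition I F x f"
proof -
  have "(\<Sum>i | f i \<noteq> 0. f i) = (\<Sum>i\<in>S. f i)"
    by (rule sum.mono_neutral_left) (use assms in auto)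
  then show ?thesis using assms finite_subset by (auto simp: is_decomposition_def)
qed

lemma decomposition_add:
  assumes "\<And>i. i \<in> I \<Longrightarrow> csubspace (F i)" "is_decomposition I F x f" "is_decomposition I F y g"
  shows "is_decomposition I F (x + y) (\<lambda>i. f i + g i)"
proof (rule decompositionI[where S = "{i. f i \<noteq> 0} \<union> {i. g i \<noteq> 0}"])
  show "finite ({i. f i \<noteq> 0} \<union> {i. g i \<noteq> 0})" using assms by (simp add: is_decomposition_def)
  then show "x + y = (\<Sum>i\<in>{i. f i \<noteq> 0} \<union> {i. g i \<noteq> 0}. f i + g i)"
    using decomposition_superset[OF assms(2), of "{i. f i \<noteq> 0} \<union> {i. g i \<noteq> 0}"]
      decomposition_superset[OF assms(3), of "{i. f i \<noteq> 0} \<union> {i. g i \<noteq> 0}"] by (simp add: sum.distrib)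
qed (use assms in \<open>auto simp: is_decomposition_def cvec.subspace_add\<close>)

lemma decomposition_scale:
  assumes "\<And>i. i \<in> I \<Longrightarrow> csubspace (F i)" "is_decomposition I F x f"
  shows "is_decomposition I F (c *\<^sub>C x) (\<lambda>i. c *\<^sub>C f i)"
proof (rule decompositionI[where S = "{i. f i \<noteq> 0}"])
  show "c *\<^sub>C x = (\<Sum>i | f i \<noteq> 0. c *\<^sub>C f i)"
    using assms(2) by (simp add: is_decomposition_def cvec.scale_sum_right)
qed (use assms in \<open>auto simp: is_decomposition_def cvec.subspace_scale\<close>)

definition dsum_component :: "'i set \<Rightarrow> ('i \<Rightarrow> 'v::complex_vector set) \<Rightarrow> 'i \<Rightarrow> 'v \<Rightarrow> 'v"
  where "dsum_component I F i x = (THE f. is_decomposition I F x f) i"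

context
  fixes I :: "'i set" and F :: "'i \<Rightarrow> 'v::complex_vector set" and S
  assumes dsum: "is_direct_sum I F S"
begin

lemma dsum_sub: "i \<in> I \<Longrightarrow> csubspace (F i)" and dsum_total_sub: "csubspace S"
  and dsum_subset: "i \<in> I \<Longrightarrow> F i \<subseteq> S"
  using dsum by (auto simp: is_direct_sum_def)

lemma dsum_component_eq:
  assumes "x \<in> S" "is_decomposition I F x f"
  shows "dsum_component I F i x = f i"
proof -
  have "\<exists>!f. is_decomposition I F x f" using dsum assms(1) by (auto simp: is_direct_sum_def)
  then have "(THE f. is_decomposition I F x f) = f"
    using the1_equality[of "is_decomposition I F x" f] assms(2) by blast
  then show ?thesis by (simp add: dsum_component_def)
qed

lemma dsum_decomposition:
  assumes "x \<in> S"
  shows "is_decomposition I F x (\<lambda>i. dsum_component I F i x)"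
proof -
  have "\<exists>!f. is_decomposition I F x f" using dsum assms by (auto simp: is_direct_sum_def)
  then show ?thesis
    using theI'[of "is_decomposition I F x"] by (simp add: dsum_component_def)
qed

lemma dsum_component_mem: "x \<in> S \<Longrightarrow> i \<in> I \<Longrightarrow> dsum_component I F i x \<in> F i"
  using dsum_decomposition by (auto simp: is_decomposition_def)

lemma dsum_component_clinear: "clinear_on S (dsum_component I F i)"
  using dsum_component_eq[OF _ decomposition_add[OF dsum_sub dsum_decomposition dsum_decomposition]]
    dsum_component_eq[OF _ decomposition_scale[OF dsum_sub dsum_decomposition]]
    cvec.subspace_add[OF dsum_total_sub] cvec.subspace_scale[OF dsum_total_sub]
  by (intro clinear_onI) auto

lemma dsum_component_in:
  assumes "i \<in> I" "x \<in> F i"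
  shows "dsum_component I F j x = (if j = i then x else 0)"
proof (rule dsum_component_eq)
  show "x \<in> S" using assms dsum_subset by blast
  show "is_decomposition I F x (\<lambda>j. if j = i then x else 0)"
    by (rule decompositionI[where S = "{i}"]) (use assms cvec.subspace_0[OF dsum_sub] in auto)
qed

end

lemma hcomponent_dsum: "hcomponent F k x = dsum_component UNIV F k x"
  by (simp add: hcomponent_def dsum_component_def)

lemma decomposition_induct:
  assumes "is_direct_sum I F S" "x \<in> S" "P 0" "\<And>x y. P x \<Longrightarrow> P y \<Longrightarrow> P (x + y)"
    "\<And>i x. i \<in> I \<Longrightarrow> x \<in> F i \<Longrightarrow> P x"
  shows "P x"
proof -
  let ?c = "\<lambda>i. dsum_component I F i x"
  have d: "is_decomposition I F x ?c" by (rule dsum_decomposition[OF assms(1,2)])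
  have "P (\<Sum>i\<in>J. ?c i)" if "finite J" "J \<subseteq> I" for J
    using that
  proof (induction)
    case (insert i J)
    then have "P (?c i)" using assms(5)[of i "?c i"] dsum_component_mem[OF assms(1,2)] by simp
    then show ?case using insert assms(4)[of "?c i" "\<Sum>i\<in>J. ?c i"] by simp
  qed (simp add: assms(3))
  moreover have "finite {i. ?c i \<noteq> 0}" "{i. ?c i \<noteq> 0} \<subseteq> I"
    using d by (auto simp: is_decomposition_def)
  ultimately have "P (\<Sum>i | ?c i \<noteq> 0. ?c i)" by blast
  then show ?thesis using d by (simp add: is_decomposition_def)
qed

lemma direct_sumI:
  assumes sub: "\<And>i. csubspace (F i)"
    and indep: "\<And>f. (\<And>i. f i \<in> F i) \<Longrightarrow> finite {i. f i \<noteq> 0} \<Longrightarrow> (\<Sum>i | f i \<noteq> 0. f i) = 0 \<Longrightarrow> f = (\<lambda>_. 0)"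
  shows "is_direct_sum UNIV F (cspan (\<Union>i. F i))"
  unfolding is_direct_sum_def
proof (intro conjI ballI)
  show "csubspace (cspan (\<Union>i. F i))" by simp
  show "csubspace (F i)" for i by (rule sub)
  show "F i \<subseteq> cspan (\<Union>i. F i)" for i using cvec.span_superset by blast
  fix x assume "x \<in> cspan (\<Union>i. F i)"
  then have "\<exists>f. is_decomposition UNIV F x f"
  proof (induction rule: cvec.span_induct_alt)
    case base
    show ?case
      by (rule exI[of _ "\<lambda>_. 0"], rule decompositionI[where S = "{}"]) (simp_all add: cvec.subspace_0[OF sub])
  next
    case (step c x y)
    then obtain i f where i: "x \<in> F i" and f: "is_decomposition UNIV F y f" by blast
    have "is_decomposition UNIV F x (\<lambda>j. if j = i then x else 0)"
      by (rule decompositionI[where S = "{i}"]) (use i cvec.subspace_0[OF sub] in auto)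
    from decomposition_add[OF sub decomposition_scale[OF sub this, of c] f]
    show ?case by blast
  qed
  moreover have "f = g" if f: "is_decomposition UNIV F x f" and g: "is_decomposition UNIV F x g" for f g
  proof -
    have d: "is_decomposition UNIV F 0 (\<lambda>i. f i + (-1) *\<^sub>C g i)"
      using decomposition_add[OF sub f decomposition_scale[OF sub g, of "-1"]] by simp
    have "(\<lambda>i. f i + (-1) *\<^sub>C g i) = (\<lambda>_. 0)"
      by (rule indep) (use d in \<open>auto simp: is_decomposition_def\<close>)
    then show ?thesis by (simp add: fun_eq_iff)
  qed
  ultimately show "\<exists>!f. is_decomposition UNIV F x f" by blast
qed

text \<open>Projections onto the summands that are defined on the whole ambient space give independence.\<close>

lemma direct_sumI_projections:
  assumes sub: "\<And>i. csubspace (F i)" and pr: "\<And>i. clin (pr i)"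
    and pr_in: "\<And>i j x. x \<in> F i \<Longrightarrow> pr j x = (if j = i then x else 0)"
  shows "is_direct_sum UNIV F (cspan (\<Union>i. F i))"
proof (rule direct_sumI[OF sub])
  fix f assume f: "\<And>i. f i \<in> F i" "finite {i. f i \<noteq> 0}" "(\<Sum>i | f i \<noteq> 0. f i) = 0"
  have "f j = 0" for j
  proof -
    have "0 = pr j (\<Sum>i | f i \<noteq> 0. f i)" by (simp add: f(3) clin_zero[OF pr])
    also have "\<dots> = (\<Sum>i | f i \<noteq> 0. pr j (f i))" by (rule clin_sum[OF pr])
    also have "\<dots> = (\<Sum>i | f i \<noteq> 0. if j = i then f i else 0)" by (rule sum.cong) (simp_all add: pr_in[OF f(1)])
    also have "\<dots> = f j" using f(2) by simp
    finally show ?thesis by simp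
  qed
  then show "f = (\<lambda>_. 0)" by blast
qed

lemma minus_one_power_scaleC: "(-1) ^ k * x = (-1) ^ k *\<^sub>C (x :: 'w::complex_algebra_1)"
  by (cases "even k") (simp_all add: scaleC_one)

lemma cspan_induct [consumes 1, case_names zero add base]:
  assumes "x \<in> cspan (\<Union>i. F i)" "\<And>i. csubspace (F i)" "P 0"
    "\<And>x y. x \<in> cspan (\<Union>i. F i) \<Longrightarrow> y \<in> cspan (\<Union>i. F i) \<Longrightarrow> P x \<Longrightarrow> P y \<Longrightarrow> P (x + y)"
    "\<And>i x. x \<in> F i \<Longrightarrow> P x"
  shows "P x"
proof -
  have "x \<in> cspan (\<Union>i. F i) \<and> P x"
    using assms(1)
  proof (induction rule: cvec.span_induct_alt)
    case base
    show ?case by (simp add: assms(3) cvec.span_zero)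
  next
    case (step c x y)
    then obtain i where "x \<in> F i" by blast
    then have "c *\<^sub>C x \<in> F i" using cvec.subspace_scale[OF assms(2)] by blast
    then have "P (c *\<^sub>C x)" "c *\<^sub>C x \<in> cspan (\<Union>i. F i)" using assms(5) cvec.span_superset by blast+
    then show ?case using step assms(4) by (simp add: cvec.span_add)
  qed
  then show ?thesis ..
qed

section \<open>The bigraded algebra of forms\<close>

locale dolbeault =
  fixes H :: "('a::complex_algebra_1) hopf" and C :: "('a, 'w::complex_algebra_1, 'm) cplx_calculus_scheme"
  assumes hopf: "hopf_star_algebra H" and cplx: "complex_structure H C"
begin

lemma calc: "covariant_star_calculus H C"
  using cplx by (simp add: complex_structure_def)

lemma forms_dsum: "is_direct_sum UNIV (forms C) UNIV"
  using calc by (simp add: covariant_star_calculus_def)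

lemma bforms_dsum: "is_direct_sum {(a, b). a + b = k} (\<lambda>(a, b). bforms C a b) (forms C k)"
  using cplx by (simp add: complex_structure_def)

lemma forms_sub: "csubspace (forms C k)"
  using dsum_sub[OF forms_dsum] by simp

lemma bforms_sub: "csubspace (bforms C a b)"
  using dsum_sub[OF bforms_dsum, of "(a, b)" "a + b"] by simp

lemma bforms_forms: "x \<in> bforms C a b \<Longrightarrow> x \<in> forms C (a + b)"
  using dsum_subset[OF bforms_dsum, of "(a, b)" "a + b"] by auto

lemma mult_bforms: "x \<in> bforms C a b \<Longrightarrow> y \<in> bforms C a' b' \<Longrightarrow> x * y \<in> bforms C (a + a') (b + b')"
  using cplx unfolding complex_structure_def by blast

lemma mult_forms: "x \<in> forms C k \<Longrightarrow> y \<in> forms C l \<Longrightarrow> x * y \<in> forms C (k + l)"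
  using calc by (simp add: covariant_star_calculus_def)

lemma one_form: "1 \<in> forms C 0"
  using calc by (simp add: covariant_star_calculus_def)

text \<open>The bidegree decomposition is given separately for each total degree, so the projection to a
  bidegree is a composite of two.\<close>

definition bcomp :: "nat \<Rightarrow> nat \<Rightarrow> 'w \<Rightarrow> 'w"
  where "bcomp a b x = dsum_component {(a', b'). a' + b' = a + b} (\<lambda>(a, b). bforms C a b) (a, b)
    (dsum_component UNIV (forms C) (a + b) x)"

lemma hcomp_mem: "dsum_component UNIV (forms C) k x \<in> forms C k"
  using dsum_component_mem[OF forms_dsum] by simp

lemma bcomp_clin: "clin (bcomp a b)"
proof (rule clinear_onI)
  note 1 = dsum_component_clinear[OF forms_dsum] and 2 = dsum_component_clinear[OF bforms_dsum]
  fix x y c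
  show "bcomp a b (x + y) = bcomp a b x + bcomp a b y"
    unfolding bcomp_def clin_add[OF 1] by (rule clinear_on_add[OF 2 hcomp_mem hcomp_mem])
  show "bcomp a b (c *\<^sub>C x) = c *\<^sub>C bcomp a b x"
    unfolding bcomp_def clin_scale[OF 1] by (rule clinear_on_scale[OF 2 hcomp_mem])
qed

lemma bcomp_mem: "bcomp a b x \<in> bforms C a b"
  using dsum_component_mem[OF bforms_dsum hcomp_mem, of "(a, b)" "a + b"] by (simp add: bcomp_def)

lemma bcomp_in:
  assumes "x \<in> bforms C a b"
  shows "bcomp a' b' x = (if a' = a \<and> b' = b then x else 0)"
proof (cases "a' + b' = a + b")
  case True
  then show ?thesis
    using dsum_component_in[OF forms_dsum UNIV_I bforms_forms[OF assms], of "a + b"]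
      dsum_component_in[OF bforms_dsum, of "(a, b)" "a + b" x "(a', b')"] assms
    by (simp add: bcomp_def)
next
  case False
  have "dsum_component {(a'', b''). a'' + b'' = a' + b'} (\<lambda>(a, b). bforms C a b) (a', b') 0 = 0"
    by (rule clinear_on_zero[OF dsum_component_clinear[OF bforms_dsum] forms_sub])
  then show ?thesis
    using dsum_component_in[OF forms_dsum UNIV_I bforms_forms[OF assms], of "a' + b'"] False
    by (auto simp: bcomp_def)
qed

lemma forms_induct [case_names zero add bform]:
  assumes "P 0" "\<And>x y. P x \<Longrightarrow> P y \<Longrightarrow> P (x + y)" "\<And>a b x. x \<in> bforms C a b \<Longrightarrow> P x"
  shows "P x"
proof (rule decomposition_induct[OF forms_dsum UNIV_I])
  fix k x assume "x \<in> forms C k"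
  then show "P x"
    by (rule decomposition_induct[OF bforms_dsum]) (use assms in auto)
qed (use assms in auto)

lemma forms_zero: "forms C 0 = bforms C 0 0"
proof (intro equalityI subsetI)
  fix x assume "x \<in> forms C 0"
  then show "x \<in> bforms C 0 0"
    by (rule decomposition_induct[OF bforms_dsum])
       (auto simp: cvec.subspace_0[OF bforms_sub] cvec.subspace_add[OF bforms_sub])
qed (use bforms_forms[of _ 0 0] in simp)

text \<open>Identities between the operators \<open>del\<close> and \<open>delbar\<close> are the bihomogeneous parts of identities for \<open>dif\<close>.\<close>

lemma bforms_separate:
  assumes "u + v = u' + v'" "u \<in> bforms C a b" "u' \<in> bforms C a b" "v \<in> bforms C a' b'" "v' \<in> bforms C a' b'"
    "(a, b) \<noteq> (a', b')"
  shows "u = u'" "v = v'"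
proof -
  have "bcomp a b (u + v) = bcomp a b (u' + v')" "bcomp a' b' (u + v) = bcomp a' b' (u' + v')"
    using assms(1) by simp_all
  then show "u = u'" "v = v'"
    using assms(6) by (auto simp: clin_add[OF bcomp_clin] bcomp_in[OF assms(2)] bcomp_in[OF assms(3)]
        bcomp_in[OF assms(4)] bcomp_in[OF assms(5)] split: if_splits)
qed

lemma del_clin: "clin (del C)" and delbar_clin: "clin (delbar C)" and dif_clin: "clin (dif C)"
  using cplx calc by (simp_all add: complex_structure_def covariant_star_calculus_def)

lemma del_mem: "x \<in> bforms C a b \<Longrightarrow> del C x \<in> bforms C (Suc a) b"
  and delbar_mem: "x \<in> bforms C a b \<Longrightarrow> delbar C x \<in> bforms C a (Suc b)"
  and dif_eq: "dif C x = del C x + delbar C x"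
  using cplx by (simp_all add: complex_structure_def)

lemma delbar_mult:
  assumes "x \<in> bforms C a b"
  shows "delbar C (x * y) = delbar C x * y + (-1) ^ (a + b) *\<^sub>C (x * delbar C y)"
proof (induction y rule: forms_induct)
  case zero
  then show ?case by (simp add: clin_zero[OF delbar_clin])
next
  case (add x y)
  then show ?case by (simp add: clin_add[OF delbar_clin] algebra_simps scaleC_add_right)
next
  case (bform a' b' y)
  have "dif C (x * y) = dif C x * y + (-1) ^ (a + b) * (x * dif C y)"
    using calc bforms_forms[OF assms] by (simp add: covariant_star_calculus_def)
  then have "del C (x * y) + delbar C (x * y) =
      (del C x * y + (-1) ^ (a + b) *\<^sub>C (x * del C y)) + (delbar C x * y + (-1) ^ (a + b) *\<^sub>C (x * delbar C y))"
    by (simp add: dif_eq minus_one_power_scaleC algebra_simps scaleC_add_right)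
  then show ?case
  proof (rule bforms_separate(2))
    show "del C (x * y) \<in> bforms C (Suc (a + a')) (b + b')" "delbar C (x * y) \<in> bforms C (a + a') (Suc (b + b'))"
      using mult_bforms[OF assms bform] by (simp_all add: del_mem delbar_mem)
    show "del C x * y + (-1) ^ (a + b) *\<^sub>C (x * del C y) \<in> bforms C (Suc (a + a')) (b + b')"
      using mult_bforms[OF del_mem[OF assms] bform] mult_bforms[OF assms del_mem[OF bform]]
      by (simp add: cvec.subspace_add[OF bforms_sub] cvec.subspace_scale[OF bforms_sub])
    show "delbar C x * y + (-1) ^ (a + b) *\<^sub>C (x * delbar C y) \<in> bforms C (a + a') (Suc (b + b'))"
      using mult_bforms[OF delbar_mem[OF assms] bform] mult_bforms[OF assms delbar_mem[OF bform]]
      by (simp add: cvec.subspace_add[OF bforms_sub] cvec.subspace_scale[OF bforms_sub])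
  qed simp
qed

lemma delbar_delbar: "delbar C (delbar C x) = 0"
proof (induction x rule: forms_induct)
  case zero
  then show ?case by (simp add: clin_zero[OF delbar_clin])
next
  case (add x y)
  then show ?case by (simp add: clin_add[OF delbar_clin])
next
  case (bform a b x)
  have "dif C (dif C x) = 0" using calc by (simp add: covariant_star_calculus_def)
  then have "bcomp a (Suc (Suc b)) (del C (del C x) + del C (delbar C x) + (delbar C (del C x) + delbar C (delbar C x))) = bcomp a (Suc (Suc b)) 0"
    by (simp add: dif_eq clin_add[OF del_clin] clin_add[OF delbar_clin] algebra_simps)
  then show ?case
    by (simp add: clin_add[OF bcomp_clin] clin_zero[OF bcomp_clin]
        bcomp_in[OF del_mem[OF del_mem[OF bform]]] bcomp_in[OF del_mem[OF delbar_mem[OF bform]]]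
        bcomp_in[OF delbar_mem[OF del_mem[OF bform]]] bcomp_in[OF delbar_mem[OF delbar_mem[OF bform]]])
qed

lemma coact_clin: "clin (coact C)"
  and coact_coassoc: "tensor_lift (\<lambda>a w. tensor_assoc (comult H a \<otimes> w)) (coact C x) =
    tensor_lift (\<lambda>a w. a \<otimes> coact C w) (coact C x)"
  and coact_counit: "tensor_lift (\<lambda>a w. counit H a *\<^sub>C w) (coact C x) = x"
  using calc by (simp_all add: covariant_star_calculus_def is_comodule_def)

lemma coact_mult: "coact C (x * y) = tensor_prod UNIV UNIV (*) (coact C x) (coact C y)"
  and coact_dif: "coact C (dif C x) = tensor_lift (\<lambda>a w. a \<otimes> dif C w) (coact C x)"
  and coact_forms: "x \<in> forms C k \<Longrightarrow> coact C x \<in> tspan UNIV (forms C k)"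
  and coact_one: "coact C 1 = 1 \<otimes> 1"
  using calc by (simp_all add: covariant_star_calculus_def)

lemma coact_bforms: "x \<in> bforms C a b \<Longrightarrow> coact C x \<in> tspan UNIV (bforms C a b)"
  using cplx by (simp add: complex_structure_def)

lemma slice_map:
  assumes "cfunctional f" "clin g"
  shows "slice f (tensor_lift (\<lambda>a w. a \<otimes> g w) t) = g (slice f t)"
proof -
  have g: "clin (\<lambda>x. g (h x))" if "clin h" for h :: "'c::complex_vector \<Rightarrow> _" by (rule clin_compose[OF assms(2) that])
  show ?thesis
    unfolding slice_def
    by (subst (1 2) tensor_lift_compose)
       (intro clin_intros g assms | simp add: slice_def[symmetric] slice_tens assms clin_scale[OF assms(2)])+
qed

text \<open>The slices of the coaction commute with \<open>dif\<close> and preserve bidegrees, so they commute with each of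
  the two components of \<open>dif\<close>.\<close>

lemma coact_delbar: "coact C (delbar C x) = tensor_lift (\<lambda>a w. a \<otimes> delbar C w) (coact C x)"
proof (rule slice_separates)
  fix f :: "'a \<Rightarrow> complex" assume f: "cfunctional f"
  note sm = slice_map[OF f]
  show "slice f (coact C (delbar C x)) = slice f (tensor_lift (\<lambda>a w. a \<otimes> delbar C w) (coact C x))"
    unfolding sm[OF delbar_clin]
  proof (induction x rule: forms_induct)
    case zero
    then show ?case by (simp add: clin_zero[OF delbar_clin] clin_zero[OF coact_clin] clin_zero[OF slice_clin[OF f]])
  next
    case (add x y)
    then show ?case by (simp add: clin_add[OF delbar_clin] clin_add[OF coact_clin] clin_add[OF slice_clin[OF f]])
  next
    case (bform a b x)
    have s: "slice f (coact C y) \<in> bforms C a' b'" if "y \<in> bforms C a' b'" for y a' b'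
      by (rule slice_mem[OF f bforms_sub coact_bforms[OF that]])
    have "slice f (coact C (dif C x)) = dif C (slice f (coact C x))"
      by (simp add: coact_dif sm[OF dif_clin])
    then have "slice f (coact C (del C x)) + slice f (coact C (delbar C x)) =
        del C (slice f (coact C x)) + delbar C (slice f (coact C x))"
      by (simp add: dif_eq clin_add[OF coact_clin] clin_add[OF slice_clin[OF f]])
    then show ?case
      by (rule bforms_separate(2)[where a = "Suc a" and b = b and a' = a and b' = "Suc b"])
         (auto intro!: s del_mem delbar_mem bform)
  qed
qed

text \<open>Row \<open>0\<close> is the Dolbeault algebra and row \<open>n\<close> underlies the canonical bundle.\<close>

definition row :: "nat \<Rightarrow> 'w set" where "row a = cspan (\<Union>b. bforms C a b)"

lemma dolb_row: "dolb C = row 0" by (simp add: dolb_def row_def)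

lemma row_sub: "csubspace (row a)" by (simp add: row_def)

lemma bforms_row: "x \<in> bforms C a b \<Longrightarrow> x \<in> row a"
  unfolding row_def by (rule cvec.span_base) auto

lemma row_induct [consumes 1, case_names zero add bform]:
  assumes "x \<in> row a" "P 0" "\<And>x y. x \<in> row a \<Longrightarrow> y \<in> row a \<Longrightarrow> P x \<Longrightarrow> P y \<Longrightarrow> P (x + y)"
    "\<And>b x. x \<in> bforms C a b \<Longrightarrow> P x"
  shows "P x"
  using assms(1) unfolding row_def
proof (rule cspan_induct)
  show "P (x + y)" if "x \<in> cspan (\<Union>b. bforms C a b)" "y \<in> cspan (\<Union>b. bforms C a b)" "P x" "P y" for x y
    using assms(3)[of x y] that by (simp add: row_def)
qed (use assms bforms_sub in auto)

lemma row_dsum: "is_direct_sum UNIV (bforms C a) (row a)"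
  unfolding row_def
  by (rule direct_sumI_projections[of _ "bcomp a"]) (simp_all add: bforms_sub bcomp_clin bcomp_in)

lemma row_mult: "x \<in> row a \<Longrightarrow> y \<in> row b \<Longrightarrow> x * y \<in> row (a + b)"
proof (induction rule: row_induct)
  case (bform c x)
  from bform(2) show ?case
    by (induction rule: row_induct)
       (simp_all add: cvec.subspace_0[OF row_sub] distrib_left cvec.subspace_add[OF row_sub]
         bforms_row[OF mult_bforms[OF bform(1)]])
qed (simp_all add: cvec.subspace_0[OF row_sub] cvec.subspace_add[OF row_sub] distrib_right)

lemma row_delbar: "x \<in> row a \<Longrightarrow> delbar C x \<in> row a"
  by (induction rule: row_induct)
     (auto simp: clin_zero[OF delbar_clin] cvec.subspace_0[OF row_sub] clin_add[OF delbar_clin]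
       cvec.subspace_add[OF row_sub] intro: bforms_row delbar_mem)

lemma row_coact: "x \<in> row a \<Longrightarrow> coact C x \<in> tspan UNIV (row a)"
proof (induction rule: row_induct)
  case (bform b x)
  then show ?case using coact_bforms[OF bform] tspan_mono[of UNIV UNIV "bforms C a b" "row a"] bforms_row by blast
qed (simp_all add: clin_zero[OF coact_clin] cvec.subspace_0[OF tspan_subspace] clin_add[OF coact_clin]
  cvec.subspace_add[OF tspan_subspace])

lemma one_dolb: "1 \<in> dolb C"
  using one_form bforms_row by (simp add: dolb_row forms_zero)

lemma dolb_sub: "csubspace (dolb C)" by (simp add: dolb_row row_sub)

lemma dolb_mult: "x \<in> dolb C \<Longrightarrow> y \<in> dolb C \<Longrightarrow> x * y \<in> dolb C"
  using row_mult[of x 0 y 0] by (simp add: dolb_row)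

end

section \<open>Sweedler calculus\<close>

lemma tensor_assoc_clin: "clin tensor_assoc"
  unfolding tensor_assoc_def by (rule tensor_lift_clin) (intro clin_intros)

lemma tensor_assoc_tens: "tensor_assoc ((a \<otimes> b) \<otimes> c) = a \<otimes> (b \<otimes> c)"
proof -
  have 1: "cbilin (\<lambda>t c. tensor_lift (\<lambda>a b. a \<otimes> b \<otimes> c) t)" by (intro clin_intros)
  have 2: "cbilin (\<lambda>a b. a \<otimes> b \<otimes> c)" for c by (intro clin_intros)
  show ?thesis unfolding tensor_assoc_def tensor_lift_tens[OF 1] tensor_lift_tens[OF 2] ..
qed

definition trilinear :: "('a::complex_vector \<Rightarrow> 'b::complex_vector \<Rightarrow> 'c::complex_vector \<Rightarrow> 'z::complex_vector) \<Rightarrow> bool"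
  where "trilinear \<gamma> \<longleftrightarrow> (\<forall>b c. clin (\<lambda>a. \<gamma> a b c)) \<and> (\<forall>a c. clin (\<lambda>b. \<gamma> a b c)) \<and> (\<forall>a b. clin (\<lambda>c. \<gamma> a b c))"

lemma trilinearI [clin_intros]:
  "(\<And>b c. clin (\<lambda>a. \<gamma> a b c)) \<Longrightarrow> (\<And>a c. clin (\<lambda>b. \<gamma> a b c)) \<Longrightarrow> (\<And>a b. clin (\<lambda>c. \<gamma> a b c)) \<Longrightarrow> trilinear \<gamma>"
  by (simp add: trilinear_def)

context dolbeault begin

lemma clin_coact [clin_intros]: "clin f \<Longrightarrow> clin (\<lambda>x. coact C (f x))"
  by (rule clin_compose[OF coact_clin])

lemma comult_clin: "clin (comult H)" and antipode_clin: "clin (antipode H)"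
  and comult_mult: "comult H (x * y) = tensor_prod UNIV UNIV (*) (comult H x) (comult H y)"
  and antipode_left: "tensor_lift (\<lambda>a b. antipode H a * b) (comult H x) = counit H x *\<^sub>C 1"
  and counit_functional: "cfunctional (counit H)"
  and counit_mult: "counit H (x * y) = counit H x * counit H y"
  using hopf by (simp_all add: hopf_star_algebra_def cfunctional_def)

lemma clin_comult [clin_intros]: "clin f \<Longrightarrow> clin (\<lambda>x. comult H (f x))"
  by (rule clin_compose[OF comult_clin])

lemma clin_antipode [clin_intros]: "clin f \<Longrightarrow> clin (\<lambda>x. antipode H (f x))"
  by (rule clin_compose[OF antipode_clin])

lemma clin_delbar [clin_intros]: "clin f \<Longrightarrow> clin (\<lambda>x. delbar C (f x))"
  by (rule clin_compose[OF delbar_clin])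

lemma clin_counit [clin_intros]: "clin g \<Longrightarrow> clin (\<lambda>x. counit H (g x) *\<^sub>C w)"
  by (rule clin_functional_scale[OF counit_functional])

text \<open>Coassociativity as a change of variables. Both sides integrate \<open>\<gamma>\<close> against
  \<open>x\<^bsub>(-2)\<^esub> \<otimes> x\<^bsub>(-1)\<^esub> \<otimes> x\<^bsub>(0)\<^esub>\<close>.\<close>

lemma sweedler_coassoc:
  assumes "trilinear \<gamma>"
  shows "tensor_lift (\<lambda>a w. tensor_lift (\<lambda>b u. \<gamma> a b u) (coact C w)) (coact C x) =
         tensor_lift (\<lambda>a w. tensor_lift (\<lambda>a1 a2. \<gamma> a1 a2 w) (comult H a)) (coact C x)"
proof -
  have g: "clin (\<lambda>a. \<gamma> a b c)" "clin (\<lambda>b. \<gamma> a b c)" "clin (\<lambda>c. \<gamma> a b c)" for a b c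
    using assms by (simp_all add: trilinear_def)
  define G where "G = tensor_lift (\<lambda>a t. tensor_lift (\<lambda>b u. \<gamma> a b u) t)"
  have b1: "cbilin (\<lambda>a t. tensor_lift (\<lambda>b u. \<gamma> a b u) t)" and b2: "cbilin (\<lambda>b u. \<gamma> a b u)"
    and b3: "cbilin (\<lambda>a b. \<gamma> a b w)" for a w
    by (intro clin_intros g)+
  have G: "clin G" unfolding G_def by (rule tensor_lift_clin[OF b1])
  have G_tens: "G (a \<otimes> t) = tensor_lift (\<lambda>b u. \<gamma> a b u) t" for a t
    unfolding G_def by (rule tensor_lift_tens[OF b1])
  have lin: "clin (\<lambda>s. tensor_assoc (s \<otimes> w))" for w :: 'w
    by (rule clin_compose[OF tensor_assoc_clin]) (intro clin_intros)
  have 1: "G (tensor_assoc (s \<otimes> w)) = tensor_lift (\<lambda>a1 a2. \<gamma> a1 a2 w) s" for s w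
    by (induction s rule: tensor_induct)
       (simp_all add: clin_zero[OF lin] clin_zero[OF G] clin_zero[OF tensor_lift_clin[OF b3]]
         clin_add[OF lin] clin_add[OF G] clin_add[OF tensor_lift_clin[OF b3]]
         tensor_assoc_tens G_tens tensor_lift_tens[OF b2] tensor_lift_tens[OF b3])
  have c1: "cbilin (\<lambda>a w. tensor_assoc (comult H a \<otimes> w))"
    by (intro clin_intros clin_compose[OF tensor_assoc_clin])
  have c2: "cbilin (\<lambda>a w. a \<otimes> coact C w)" by (intro clin_intros)
  have "G (tensor_lift (\<lambda>a w. tensor_assoc (comult H a \<otimes> w)) (coact C x)) =
      G (tensor_lift (\<lambda>a w. a \<otimes> coact C w) (coact C x))"
    by (simp add: coact_coassoc)
  then show ?thesis
    unfolding tensor_lift_compose[OF c1 G] tensor_lift_compose[OF c2 G] 1 G_tens by simp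
qed

lemma tensor_prod_lift:
  fixes s :: "('b::complex_algebra_1, 'v::complex_vector) tensor"
  assumes "cbilin \<beta>" "cbilin \<gamma>"
  shows "tensor_lift \<gamma> (tensor_prod UNIV UNIV \<beta> s t) =
    tensor_lift (\<lambda>a v. tensor_lift (\<lambda>b w. \<gamma> (a * b) (\<beta> v w)) t) s"
proof -
  have b: "clin (\<lambda>v. \<beta> v w)" "clin (\<lambda>w. \<beta> v w)" for v w
    using assms(1) by (simp_all add: cbilin_iff)
  have 1: "cbilin (\<lambda>a v. tensor_lift (\<lambda>b w. (a * b) \<otimes> \<beta> v w) t)" by (intro clin_intros b)
  have 2: "cbilin (\<lambda>b w. (a * b) \<otimes> \<beta> v w)" for a :: 'b and v by (intro clin_intros b)
  note lin = tensor_lift_clin[OF assms(2)]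
  show ?thesis
    unfolding tensor_prod_def tensor_lift_compose[OF 1 lin] tensor_lift_compose[OF 2 lin]
      tensor_lift_tens[OF assms(2)] ..
qed

lemma mult_cbilin: "cbilin ((*) :: 'b::complex_algebra_1 \<Rightarrow> 'b \<Rightarrow> 'b)"
  by (intro clin_intros)

lemma sweedler_mult:
  "cbilin \<gamma> \<Longrightarrow> tensor_lift \<gamma> (coact C (x * y)) =
    tensor_lift (\<lambda>a v. tensor_lift (\<lambda>b w. \<gamma> (a * b) (v * w)) (coact C y)) (coact C x)"
  unfolding coact_mult by (rule tensor_prod_lift[OF mult_cbilin])

lemma sweedler_comult:
  "cbilin \<gamma> \<Longrightarrow> tensor_lift \<gamma> (comult H (x * y)) =
    tensor_lift (\<lambda>a v. tensor_lift (\<lambda>b w. \<gamma> (a * b) (v * w)) (comult H y)) (comult H x)"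
  unfolding comult_mult by (rule tensor_prod_lift[OF mult_cbilin])

lemma sweedler_counit:
  assumes "clin g"
  shows "tensor_lift (\<lambda>a w. counit H a *\<^sub>C g w) (coact C x) = g x"
proof -
  have 1: "cbilin (\<lambda>a w. counit H a *\<^sub>C w)" by (intro clin_intros)
  have "g (tensor_lift (\<lambda>a w. counit H a *\<^sub>C w) (coact C x)) = g x" by (simp add: coact_counit)
  then show ?thesis unfolding tensor_lift_compose[OF 1 assms] clin_scale[OF assms] .
qed

lemma sweedler_antipode:
  assumes "clin g"
  shows "tensor_lift (\<lambda>a b. g (antipode H a * b)) (comult H x) = counit H x *\<^sub>C g 1"
proof -
  have 1: "cbilin (\<lambda>a b. antipode H a * b)" by (intro clin_intros)
  show ?thesis
    unfolding tensor_lift_compose[OF 1 assms, symmetric] antipode_left clin_scale[OF assms] ..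
qed

lemma sweedler_delbar:
  assumes "cbilin \<gamma>"
  shows "tensor_lift \<gamma> (coact C (delbar C x)) = tensor_lift (\<lambda>a w. \<gamma> a (delbar C w)) (coact C x)"
proof -
  have 1: "cbilin (\<lambda>a w. a \<otimes> delbar C w)" by (intro clin_intros)
  show ?thesis
    unfolding coact_delbar tensor_lift_compose[OF 1 tensor_lift_clin[OF assms]] tensor_lift_tens[OF assms] ..
qed

text \<open>For \<open>t = \<Sum> b \<otimes> z\<close> this is \<open>\<Sum> x\<^bsub>(-1)\<^esub> b \<otimes> ev z x\<^bsub>(0)\<^esub>\<close>. If \<open>t\<close> is the coaction of a linear form
  \<open>\<phi>\<close>, then equivariance of evaluation says that this is the coaction of \<open>\<phi> x\<close>.\<close>

definition act :: "('z::complex_vector \<Rightarrow> 'w \<Rightarrow> 'y::complex_vector) \<Rightarrow> ('a, 'z) tensor \<Rightarrow> 'w \<Rightarrow> ('a, 'y) tensor"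
  where "act ev t x = tensor_lift (\<lambda>a x'. tensor_lift (\<lambda>b z. (a * b) \<otimes> ev z x') t) (coact C x)"

text \<open>By \<open>S(x\<^bsub>(-2)\<^esub>) x\<^bsub>(-1)\<^esub> \<otimes> x\<^bsub>(0)\<^esub> = 1 \<otimes> x\<close> the antipode removes the coaction of \<open>x\<close>. Hence \<open>act ev t\<close>
  determines the values \<open>\<Sum> b \<otimes> ev z x\<close>, and equivariance of evaluation turns into the formula with
  the antipode that defines the coaction of a dual.\<close>

lemma act_cancel:
  assumes ev: "cbilin ev"
  shows "tensor_lift (\<lambda>a x'. tensor_lift (\<lambda>b y. (antipode H a * b) \<otimes> y) (act ev t x')) (coact C x) =
    tensor_lift (\<lambda>b z. b \<otimes> ev z x) t"
proof -
  have e: "clin (\<lambda>z. ev z y)" "clin (\<lambda>y. ev z y)" for y z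
    using ev by (simp_all add: cbilin_iff)
  have i1: "cbilin (\<lambda>a' x''. tensor_lift (\<lambda>b z. (a' * b) \<otimes> ev z x'') t)" by (intro clin_intros e)
  have i2: "cbilin (\<lambda>b z. (a' * b) \<otimes> ev z x'')" for a' :: 'a and x'' by (intro clin_intros e)
  have i3: "cbilin (\<lambda>b y. (antipode H a * b) \<otimes> y)" for a by (intro clin_intros)
  note l3 = tensor_lift_clin[OF i3]
  have tri: "trilinear (\<lambda>a a' x''. tensor_lift (\<lambda>b z. (antipode H a * (a' * b)) \<otimes> ev z x'') t)"
    by (intro clin_intros e)
  have "tensor_lift (\<lambda>a x'. tensor_lift (\<lambda>b y. (antipode H a * b) \<otimes> y) (act ev t x')) (coact C x) =
    tensor_lift (\<lambda>a x'. tensor_lift (\<lambda>a' x''. tensor_lift (\<lambda>b z. (antipode H a * (a' * b)) \<otimes> ev z x'') t) (coact C x')) (coact C x)"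
    unfolding act_def tensor_lift_compose[OF i1 l3] tensor_lift_compose[OF i2 l3] tensor_lift_tens[OF i3] ..
  also have "\<dots> = tensor_lift (\<lambda>a x'. tensor_lift (\<lambda>a1 a2. tensor_lift (\<lambda>b z. (antipode H a1 * (a2 * b)) \<otimes> ev z x') t) (comult H a)) (coact C x)"
    by (rule sweedler_coassoc[OF tri])
  also have "\<dots> = tensor_lift (\<lambda>a x'. counit H a *\<^sub>C tensor_lift (\<lambda>b z. b \<otimes> ev z x') t) (coact C x)"
  proof -
    have "clin (\<lambda>c. tensor_lift (\<lambda>b z. (c * b) \<otimes> ev z x') t)" for x' by (intro clin_intros e)
    from sweedler_antipode[OF this] show ?thesis by (simp add: mult.assoc)
  qed
  also have "\<dots> = tensor_lift (\<lambda>b z. b \<otimes> ev z x) t"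
    by (rule sweedler_counit) (intro clin_intros e)
  finally show ?thesis .
qed

end

section \<open>The canonical bundle\<close>

lemma tensor_lift_mem:
  assumes "t \<in> tspan V W" "csubspace V" "cbilin \<beta>" "csubspace Z" "\<And>v w. v \<in> V \<Longrightarrow> w \<in> W \<Longrightarrow> \<beta> v w \<in> Z"
  shows "tensor_lift \<beta> t \<in> Z"
  using assms(1,2)
  by (induction rule: tspan_induct)
     (simp_all add: clin_zero[OF tensor_lift_clin] tensor_lift_add tensor_lift_tens assms(3-5)
       cvec.subspace_0 cvec.subspace_add)

lemma tensor_prod_on_eq:
  fixes s :: "('b::complex_algebra_1, 'v::complex_vector) tensor"
    and \<beta> \<gamma> :: "'v \<Rightarrow> 'w::complex_vector \<Rightarrow> 'z::complex_vector"
  assumes "csubspace V" "csubspace W" "s \<in> tspan UNIV V" "t \<in> tspan UNIV W" "cbilin \<gamma>"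
    and "\<And>v w. v \<in> V \<Longrightarrow> w \<in> W \<Longrightarrow> \<beta> v w = \<gamma> v w"
  shows "tensor_prod V W \<beta> s t = tensor_prod UNIV UNIV \<gamma> s t"
proof -
  have g: "clin (\<lambda>v. \<gamma> v w)" "clin (\<lambda>w. \<gamma> v w)" for v w
    using assms(5) by (simp_all add: cbilin_iff)
  have 1: "cbilin (\<lambda>a v. tensor_lift (\<lambda>b w. (a * b) \<otimes> \<gamma> v w) t)" by (intro clin_intros g)
  have 2: "cbilin (\<lambda>b w. (a * b) \<otimes> \<gamma> v w)" for a :: 'b and v by (intro clin_intros g)
  show ?thesis
    unfolding tensor_prod_def
    by (rule tensor_lift_on_eq[OF cvec.subspace_UNIV assms(1,3) 1],
        rule tensor_lift_on_eq[OF cvec.subspace_UNIV assms(2,4) 2]) (simp add: assms(6))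
qed

context dolbeault begin

lemma hcomponent_clin: "clin (hcomponent (forms C) k)"
  using dsum_component_clinear[OF forms_dsum] by (simp add: hcomponent_dsum[abs_def])

lemma hcomponent_forms: "x \<in> forms C k \<Longrightarrow> hcomponent (forms C) j x = (if j = k then x else 0)"
  using dsum_component_in[OF forms_dsum UNIV_I] by (simp add: hcomponent_dsum)

lemma hcomponent_finite: "finite {k. hcomponent (forms C) k x \<noteq> 0}"
  using dsum_decomposition[OF forms_dsum UNIV_I, of x] by (simp add: is_decomposition_def hcomponent_dsum)

lemma sign_twist_superset:
  assumes "finite S" "{k. hcomponent (forms C) k x \<noteq> 0} \<subseteq> S"
  shows "sign_twist m C x = (\<Sum>k\<in>S. (-1) ^ (m * k) *\<^sub>C hcomponent (forms C) k x)"
  unfolding sign_twist_def by (rule sum.mono_neutral_left) (use assms in auto)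

lemma sign_twist_clin: "clin (sign_twist m C)"
proof (rule clinear_onI)
  fix x y c
  let ?S = "{k. hcomponent (forms C) k x \<noteq> 0} \<union> {k. hcomponent (forms C) k y \<noteq> 0}"
  have S: "finite ?S" by (simp add: hcomponent_finite)
  show "sign_twist m C (x + y) = sign_twist m C x + sign_twist m C y"
    by (subst (1 2 3) sign_twist_superset[OF S])
       (auto simp: clin_add[OF hcomponent_clin] scaleC_add_right sum.distrib)
  show "sign_twist m C (c *\<^sub>C x) = c *\<^sub>C sign_twist m C x"
    by (subst (1 2) sign_twist_superset[OF S])
       (auto simp: clin_scale[OF hcomponent_clin] cvec.scale_sum_right mult.commute)
qed

lemma sign_twist_forms: "x \<in> forms C k \<Longrightarrow> sign_twist m C x = (-1) ^ (m * k) *\<^sub>C x"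
  by (subst sign_twist_superset[of "{k}"]) (auto simp: hcomponent_forms)

lemma sign_twist_bforms: "x \<in> bforms C a b \<Longrightarrow> sign_twist m C x = (-1) ^ (m * (a + b)) *\<^sub>C x"
  by (rule sign_twist_forms[OF bforms_forms])

lemma clin_sign_twist [clin_intros]: "clin f \<Longrightarrow> clin (\<lambda>x. sign_twist m C (f x))"
  by (rule clin_compose[OF sign_twist_clin])

lemma sign_twist_mem: "x \<in> bforms C a b \<Longrightarrow> sign_twist m C x \<in> bforms C a b"
  by (simp add: sign_twist_bforms cvec.subspace_scale[OF bforms_sub])

lemma sign_twist_row: "x \<in> row a \<Longrightarrow> sign_twist m C x \<in> row a"
  by (induction rule: row_induct)
     (simp_all add: clin_zero[OF sign_twist_clin] clin_add[OF sign_twist_clin] cvec.subspace_0[OF row_sub]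
       cvec.subspace_add[OF row_sub] bforms_row[OF sign_twist_mem])

lemma clin_eqI:
  assumes "clin f" "clin g" "\<And>a b x. x \<in> bforms C a b \<Longrightarrow> f x = g x"
  shows "f x = g x"
  by (induction x rule: forms_induct)
     (simp_all add: clin_zero[OF assms(1)] clin_zero[OF assms(2)] clin_add[OF assms(1)] clin_add[OF assms(2)] assms(3))

lemma sign_twist_mult: "sign_twist m C (x * y) = sign_twist m C x * sign_twist m C y"
proof (rule clin_eqI[of "\<lambda>x. sign_twist m C (x * y)" "\<lambda>x. sign_twist m C x * sign_twist m C y"])
  fix a b x assume x: "x \<in> bforms C a b"
  show "sign_twist m C (x * y) = sign_twist m C x * sign_twist m C y"
  proof (rule clin_eqI[of "\<lambda>y. sign_twist m C (x * y)" "\<lambda>y. sign_twist m C x * sign_twist m C y"])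
    fix a' b' y assume y: "y \<in> bforms C a' b'"
    show "sign_twist m C (x * y) = sign_twist m C x * sign_twist m C y"
      by (simp add: sign_twist_bforms[OF x] sign_twist_bforms[OF y] sign_twist_bforms[OF mult_bforms[OF x y]]
          mult_scaleC_left mult_scaleC_right scaleC_scaleC power_add[symmetric] algebra_simps)
  qed (intro clin_intros)+
qed (intro clin_intros)+

lemma sign_twist_one: "sign_twist m C 1 = 1"
  using sign_twist_forms[OF one_form] by (simp add: scaleC_one)

lemma sign_twist_zero_form: "x \<in> forms C 0 \<Longrightarrow> sign_twist m C x = x"
  using sign_twist_forms[of x 0 m] by (simp add: scaleC_one)

lemma sign_twist_twist: "sign_twist m C (sign_twist m C x) = x"
proof (rule clin_eqI[of "\<lambda>x. sign_twist m C (sign_twist m C x)" "\<lambda>x. x"])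
  fix a b x assume x: "x \<in> bforms C a b"
  show "sign_twist m C (sign_twist m C x) = x"
    by (simp add: sign_twist_bforms[OF x] clin_scale[OF sign_twist_clin] scaleC_scaleC power_add[symmetric] scaleC_one)
qed (intro clin_intros)+

lemma sign_twist_delbar: "sign_twist m C (delbar C x) = (-1) ^ m *\<^sub>C delbar C (sign_twist m C x)"
proof (rule clin_eqI[of "\<lambda>x. sign_twist m C (delbar C x)" "\<lambda>x. (-1) ^ m *\<^sub>C delbar C (sign_twist m C x)"])
  fix a b x assume x: "x \<in> bforms C a b"
  show "sign_twist m C (delbar C x) = (-1) ^ m *\<^sub>C delbar C (sign_twist m C x)"
    by (simp add: sign_twist_bforms[OF x] sign_twist_bforms[OF delbar_mem[OF x]] clin_scale[OF delbar_clin]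
        scaleC_scaleC power_add[symmetric])
qed (intro clin_intros)+

lemma coact_sign_twist: "coact C (sign_twist m C x) = tensor_lift (\<lambda>a w. a \<otimes> sign_twist m C w) (coact C x)"
proof (rule clin_eqI[of "\<lambda>x. coact C (sign_twist m C x)" "\<lambda>x. tensor_lift (\<lambda>a w. a \<otimes> sign_twist m C w) (coact C x)"])
  fix a b x assume x: "x \<in> bforms C a b"
  have "tensor_lift (\<lambda>a w. a \<otimes> sign_twist m C w) (coact C x) =
      tensor_lift (\<lambda>a' w. (-1) ^ (m * (a + b)) *\<^sub>C (a' \<otimes> w)) (coact C x)"
    by (rule tensor_lift_cong_right[OF coact_bforms[OF x]])
       (intro clin_intros | simp add: sign_twist_bforms tens_scale_right)+
  also have "\<dots> = (-1) ^ (m * (a + b)) *\<^sub>C tensor_lift (\<otimes>) (coact C x)"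
    by (rule tensor_lift_compose[symmetric, of "(\<otimes>)" "\<lambda>t. (-1) ^ (m * (a + b)) *\<^sub>C t"]) (intro clin_intros tens_cbilin)+
  also have "tensor_lift (\<otimes>) (coact C x) = coact C x" by (rule tensor_lift_id)
  finally show "coact C (sign_twist m C x) = tensor_lift (\<lambda>a w. a \<otimes> sign_twist m C w) (coact C x)"
    by (simp add: sign_twist_bforms[OF x] clin_scale[OF coact_clin])
qed (intro clin_intros)+

lemma sweedler_sign_twist:
  assumes "cbilin \<gamma>"
  shows "tensor_lift \<gamma> (coact C (sign_twist m C x)) = tensor_lift (\<lambda>a w. \<gamma> a (sign_twist m C w)) (coact C x)"
proof -
  have 1: "cbilin (\<lambda>a w. a \<otimes> sign_twist m C w)" by (intro clin_intros)
  show ?thesis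
    unfolding coact_sign_twist tensor_lift_compose[OF 1 tensor_lift_clin[OF assms]] tensor_lift_tens[OF assms] ..
qed

lemma row_comodule: "is_comodule H (row a) (coact C)"
  unfolding is_comodule_def
proof (intro conjI ballI)
  fix v assume v: "v \<in> row a"
  note eq = tensor_lift_on_eq[OF cvec.subspace_UNIV row_sub row_coact[OF v]]
  have 1: "cbilin (\<lambda>a w. tensor_assoc (comult H a \<otimes> (w::'w)))"
    by (intro clin_intros clin_compose[OF tensor_assoc_clin])
  have 2: "cbilin (\<lambda>a w. a \<otimes> coact C w)" and 3: "cbilin (\<lambda>a w. counit H a *\<^sub>C (w::'w))"
    by (intro clin_intros)+
  show "tensor_lift_on UNIV (row a) (\<lambda>a w. tensor_assoc (comult H a \<otimes> w)) (coact C v) =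
      tensor_lift_on UNIV (row a) (\<lambda>a w. a \<otimes> coact C w) (coact C v)"
    by (simp add: eq[OF 1 refl] eq[OF 2 refl] coact_coassoc)
  show "tensor_lift_on UNIV (row a) (\<lambda>a w. counit H a *\<^sub>C w) (coact C v) = v"
    by (simp add: eq[OF 3 refl] coact_counit)
qed (simp_all add: clin_on[OF coact_clin] row_coact)

end

locale canonical = dolbeault H C
  for H :: "('a::complex_algebra_1) hopf" and C :: "('a, 'w::complex_algebra_1, 'm) cplx_calculus_scheme" +
  fixes n :: nat
begin

abbreviation X where "X \<equiv> canonical_bundle n C"

definition rtwist :: "'w \<Rightarrow> 'w \<Rightarrow> 'w" where "rtwist \<omega> e = \<omega> * sign_twist n C e"

lemma rtwist_cbilin: "cbilin rtwist"
  unfolding rtwist_def by (intro clin_intros)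

lemma X_simps: "mcomp X = bforms C n" "lact X = (*)" "ract X = rtwist" "mdif X = delbar C"
    "mcoact X = coact C" "mcarrier X = row n"
  by (auto simp: canonical_bundle_def mcarrier_def row_def rtwist_def fun_eq_iff)

sublocale can: sub_bimodule "dolb C" "(*)" rtwist "row n"
proof
  show "cbilinear_on (dolb C) (row n) (*)" by (rule cbilin_on[OF mult_cbilin])
  show "cbilinear_on (row n) (dolb C) rtwist" by (rule cbilin_on[OF rtwist_cbilin])
  show "a * x \<in> row n" if "a \<in> dolb C" "x \<in> row n" for a x
    using row_mult[of a 0 x n] that by (simp add: dolb_row)
  show "rtwist x a \<in> row n" if "x \<in> row n" "a \<in> dolb C" for a x
    using row_mult[of x n "sign_twist n C a" 0] sign_twist_row[of a 0 n] that by (simp add: dolb_row rtwist_def)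
qed (simp_all add: dolb_sub one_dolb dolb_mult row_sub rtwist_def sign_twist_one sign_twist_mult mult.assoc)

text \<open>All structure maps are restrictions of operations on the algebra of forms.\<close>

lemma canonical_left_dg_module: "comodule_left_dg_module H C X"
  unfolding comodule_left_dg_module_def X_simps
proof (intro conjI allI ballI)
  show "is_direct_sum UNIV (bforms C n) (row n)" by (rule row_dsum)
  show "e * x \<in> bforms C n (i + j)" if "e \<in> bforms C 0 i" "x \<in> bforms C n j" for i j e x
    using mult_bforms[OF that] by simp
  show "delbar C (e * x) = delbar C e * x + (-1) ^ i *\<^sub>C (e * delbar C x)" if "e \<in> bforms C 0 i" for i e x
    using delbar_mult[OF that] by simp
  show "coact C (e * x) = tensor_prod (dolb C) (row n) (*) (coact C e) (coact C x)"
    if "e \<in> dolb C" "x \<in> row n" for e x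
    using tensor_prod_on_eq[OF dolb_sub row_sub _ row_coact mult_cbilin refl] row_coact[of e 0] that
    by (simp add: coact_mult dolb_row)
  show "coact C (delbar C x) = tensor_lift_on UNIV (row n) (\<lambda>a y. a \<otimes> delbar C y) (coact C x)"
    if x: "x \<in> row n" for x
  proof -
    have "cbilin (\<lambda>a y. a \<otimes> delbar C y)" by (intro clin_intros)
    from tensor_lift_on_eq[OF cvec.subspace_UNIV row_sub row_coact[OF x] this refl]
    show ?thesis by (simp add: coact_delbar)
  qed
qed (simp_all add: can.l_bilin clin_on[OF delbar_clin] delbar_mem delbar_delbar row_comodule coact_bforms mult.assoc)

lemma sweedler_rtwist:
  assumes "cbilin \<gamma>"
  shows "tensor_lift \<gamma> (coact C (rtwist x e)) =
    tensor_lift (\<lambda>a v. tensor_lift (\<lambda>b w. \<gamma> (a * b) (rtwist v w)) (coact C e)) (coact C x)"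
proof -
  have g1: "clin (\<lambda>a. \<gamma> (f a) w)" if "clin f" for f :: "'a \<Rightarrow> 'a" and w
    by (rule clin_compose[OF _ that]) (use assms in \<open>simp add: cbilin_iff\<close>)
  have g2: "clin (\<lambda>w. \<gamma> a (g w))" if "clin g" for g :: "'w \<Rightarrow> 'w" and a
    by (rule clin_compose[OF _ that]) (use assms in \<open>simp add: cbilin_iff\<close>)
  have "cbilin (\<lambda>b w. \<gamma> (a * b) (v * w))" for a v by (intro cbilinI g1 g2 clin_intros)
  from sweedler_sign_twist[OF this] show ?thesis
    unfolding rtwist_def by (simp add: sweedler_mult[OF assms])
qed

lemma canonical_dg_bimodule: "comodule_dg_bimodule H C X"
proof -
  have m: "rtwist x e \<in> bforms C n (j + i)" if "e \<in> bforms C 0 i" "x \<in> bforms C n j" for i j e x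
    using mult_bforms[OF that(2) sign_twist_mem[OF that(1)]] by (simp add: rtwist_def)
  have d: "delbar C (rtwist x e) = rtwist (delbar C x) e + (-1) ^ j *\<^sub>C rtwist x (delbar C e)"
    if "x \<in> bforms C n j" for j x e
    by (simp add: rtwist_def delbar_mult[OF that] sign_twist_delbar mult_scaleC_right scaleC_scaleC power_add mult.commute)
  have c: "coact C (rtwist x e) = tensor_prod (row n) (dolb C) rtwist (coact C x) (coact C e)"
    if "x \<in> row n" "e \<in> dolb C" for x e
  proof -
    have "coact C (rtwist x e) = tensor_prod UNIV UNIV rtwist (coact C x) (coact C e)"
      using sweedler_rtwist[OF tens_cbilin, of x e] by (simp add: tensor_lift_id tensor_prod_def)
    then show ?thesis
      using tensor_prod_on_eq[OF row_sub dolb_sub row_coact _ rtwist_cbilin refl] row_coact[of e 0] that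
      by (simp add: dolb_row)
  qed
  show ?thesis
    unfolding comodule_dg_bimodule_def X_simps
    using canonical_left_dg_module can.r_bilin m d c by (auto simp: can.r_one can.r_mult can.l_r)
qed

end

section \<open>Functionals on the canonical bundle\<close>

context canonical begin

text \<open>Elements of the dual are linear on row \<open>n\<close> only, and other functions not at all. The projections make
  evaluation bilinear on the ambient spaces.\<close>

definition ev :: "('w \<Rightarrow> 'w) \<Rightarrow> 'w \<Rightarrow> 'w"
  where "ev \<phi> \<alpha> = subspace_proj can.dual \<phi> (subspace_proj (row n) \<alpha>)"

lemma ev_eq: "\<phi> \<in> can.dual \<Longrightarrow> \<alpha> \<in> row n \<Longrightarrow> ev \<phi> \<alpha> = \<phi> \<alpha>"
  by (simp add: ev_def subspace_proj_id[OF can.dual_sub] subspace_proj_id[OF row_sub])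

lemma ev_cbilin: "cbilin ev"
proof -
  have "cbilinear_on can.dual (row n) (\<lambda>\<phi> \<alpha>. \<phi> \<alpha>)"
    by (intro cbilinear_onI can.dual_clinear) (auto simp: clinear_on_def scaleC_fun_def)
  from bilinear_extend[OF can.dual_sub row_sub this] show ?thesis by (simp add: ev_def[abs_def])
qed

lemma ev_lin: "clin (\<lambda>\<phi>. ev \<phi> \<alpha>)" "clin (\<lambda>\<alpha>. ev \<phi> \<alpha>)"
  using ev_cbilin by (simp_all add: cbilin_iff)

lemma ev_clin1 [clin_intros]: "clin f \<Longrightarrow> clin (\<lambda>x. ev (f x) \<alpha>)"
  by (rule clin_compose[OF ev_lin(1)])

lemma ev_clin2 [clin_intros]: "clin f \<Longrightarrow> clin (\<lambda>x. ev \<phi> (f x))"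
  by (rule clin_compose[OF ev_lin(2)])

lemma act_cbilin: "cbilin (act ev)"
  unfolding act_def by (intro clin_intros)

lemma act_lin: "clin (\<lambda>t. act ev t \<alpha>)" "clin (\<lambda>\<alpha>. act ev t \<alpha>)"
  using act_cbilin by (simp_all add: cbilin_iff)

lemma act_clin1 [clin_intros]: "clin f \<Longrightarrow> clin (\<lambda>x. act ev (f x) \<alpha>)"
  by (rule clin_compose[OF act_lin(1)])

lemma act_clin2 [clin_intros]: "clin f \<Longrightarrow> clin (\<lambda>x. act ev t (f x))"
  by (rule clin_compose[OF act_lin(2)])

lemma slice_eval:
  "cfunctional f \<Longrightarrow> slice f (tensor_lift (\<lambda>b z. b \<otimes> ev z \<alpha>) t) = ev (slice f t) \<alpha>"
  by (rule slice_map[OF _ ev_lin(1)])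

text \<open>An element of the tensor product with the dual is a family of functionals, namely its slices, and
  functionals are determined by their values.\<close>

lemma eval_unique:
  fixes t t' :: "('a, 'w \<Rightarrow> 'w) tensor"
  assumes "t \<in> tspan UNIV can.dual" "t' \<in> tspan UNIV can.dual"
    and "\<And>\<alpha>. \<alpha> \<in> row n \<Longrightarrow>
      tensor_lift (\<lambda>b z. b \<otimes> ev z \<alpha>) t = tensor_lift (\<lambda>b z. b \<otimes> ev z \<alpha>) t'"
  shows "t = t'"
proof (rule slice_separates)
  fix f :: "'a \<Rightarrow> complex" assume f: "cfunctional f"
  note m = slice_mem[OF f can.dual_sub assms(1)] slice_mem[OF f can.dual_sub assms(2)]
  show "slice f t = slice f t'"
  proof (rule can.dual_eqI[OF m])
    fix \<alpha> assume \<alpha>: "\<alpha> \<in> row n"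
    have "ev (slice f t) \<alpha> = ev (slice f t') \<alpha>"
      unfolding slice_eval[OF f, symmetric] assms(3)[OF \<alpha>] ..
    then show "slice f t \<alpha> = slice f t' \<alpha>" using ev_eq m \<alpha> by simp
  qed
qed

lemma eval_of_act:
  assumes "\<alpha> \<in> row n" "clin (\<lambda>\<alpha>. T \<alpha>)" "\<And>\<alpha>. \<alpha> \<in> row n \<Longrightarrow> act ev' t \<alpha> = T \<alpha>" and ev': "cbilin ev'"
  shows "tensor_lift (\<lambda>b z. b \<otimes> ev' z \<alpha>) t =
    tensor_lift (\<lambda>a x. tensor_lift (\<lambda>b y. (antipode H a * b) \<otimes> y) (T x)) (coact C \<alpha>)"
proof -
  have e: "clin (\<lambda>z. ev' z y)" "clin (\<lambda>y. ev' z y)" for y z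
    using ev' by (simp_all add: cbilin_iff)
  have 1: "clin (act ev' t)" unfolding act_def by (intro clin_intros e)
  have i1: "cbilin (\<lambda>a x. tensor_lift (\<lambda>b y. (antipode H a * b) \<otimes> y) (act ev' t x))"
    by (intro clin_intros 1)
  have i2: "cbilin (\<lambda>a x. tensor_lift (\<lambda>b y. (antipode H a * b) \<otimes> y) (T x))"
    by (intro clin_intros assms(2))
  show ?thesis
    unfolding act_cancel[OF ev', symmetric]
    by (rule tensor_lift_cong[OF row_coact[OF assms(1)] cvec.subspace_UNIV i1 i2]) (simp add: assms(3))
qed

lemma eval_cancel:
  assumes ev': "cbilin ev'" and "\<And>\<alpha>. \<alpha> \<in> row n \<Longrightarrow> act ev' t \<alpha> = act ev' t' \<alpha>" "\<alpha> \<in> row n"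
  shows "tensor_lift (\<lambda>b z. b \<otimes> ev' z \<alpha>) t = tensor_lift (\<lambda>b z. b \<otimes> ev' z \<alpha>) t'"
proof -
  have e: "clin (\<lambda>z. ev' z y)" "clin (\<lambda>y. ev' z y)" for y z
    using ev' by (simp_all add: cbilin_iff)
  have 1: "clin (act ev' t')" unfolding act_def by (intro clin_intros e)
  show ?thesis
    using eval_of_act[OF assms(3) 1 assms(2) ev'] eval_of_act[OF assms(3) 1 refl ev'] by simp
qed

text \<open>The compatibility of the coaction of the dual with the other operations can thus be checked after
  evaluation at homogeneous forms.\<close>

lemma act_unique:
  assumes "t \<in> tspan UNIV can.dual" "t' \<in> tspan UNIV can.dual"
    and "\<And>j \<alpha>. \<alpha> \<in> bforms C n j \<Longrightarrow> act ev t \<alpha> = act ev t' \<alpha>"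
  shows "t = t'"
proof (rule eval_unique[OF assms(1,2)])
  have "act ev t \<alpha> = act ev t' \<alpha>" if "\<alpha> \<in> row n" for \<alpha>
    using that
    by (induction rule: row_induct)
       (simp_all add: clin_zero[OF act_lin(2)] clin_add[OF act_lin(2)] assms(3))
  then show "tensor_lift (\<lambda>b z. b \<otimes> ev z \<alpha>) t = tensor_lift (\<lambda>b z. b \<otimes> ev z \<alpha>) t'" if "\<alpha> \<in> row n" for \<alpha>
    using eval_cancel[OF ev_cbilin _ that] by blast
qed

definition hdual :: "nat \<Rightarrow> ('w \<Rightarrow> 'w) set"
  where "hdual k = {\<phi> \<in> can.dual. \<forall>j. \<forall>\<alpha>\<in>bforms C n j. \<phi> \<alpha> \<in> bforms C 0 (j + k)}"

text \<open>Multiplication by \<open>(-1)\<^sup>j\<close> in bidegree \<open>(n,j)\<close>: the first factor compensates the total degree \<open>n + j\<close> seen by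
  \<open>sign_twist\<close>.\<close>

definition parity :: "'w \<Rightarrow> 'w"
  where "parity \<alpha> = (-1) ^ n *\<^sub>C sign_twist 1 C \<alpha>"

text \<open>The equation \<open>\<partial>(\<alpha>\<phi>) = (\<partial>\<alpha>)\<phi> + (-1)\<^bsup>|\<alpha>|\<^esup> \<alpha>(\<partial>\<phi>)\<close> for \<open>delbar\<close>, solved for its last term without
  reference to the degree of \<open>\<alpha>\<close>.\<close>

definition dual_dif :: "('w \<Rightarrow> 'w) \<Rightarrow> 'w \<Rightarrow> 'w"
  where "dual_dif \<phi> \<alpha> = (if \<alpha> \<in> row n then delbar C (\<phi> (parity \<alpha>)) - \<phi> (delbar C (parity \<alpha>)) else 0)"

lemma parity_clin: "clin parity"
  unfolding parity_def by (intro clin_intros)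

lemma parity_bforms: "\<alpha> \<in> bforms C n j \<Longrightarrow> parity \<alpha> = (-1) ^ j *\<^sub>C \<alpha>"
  by (simp add: parity_def sign_twist_bforms scaleC_scaleC power_add)

lemma parity_row: "\<alpha> \<in> row n \<Longrightarrow> parity \<alpha> \<in> row n"
  unfolding parity_def by (intro cvec.subspace_scale[OF row_sub] sign_twist_row)

lemma hdual_dual: "\<phi> \<in> hdual k \<Longrightarrow> \<phi> \<in> can.dual"
  and hdual_mem: "\<phi> \<in> hdual k \<Longrightarrow> \<alpha> \<in> bforms C n j \<Longrightarrow> \<phi> \<alpha> \<in> bforms C 0 (j + k)"
  by (auto simp: hdual_def)

lemma hdual_sub: "csubspace (hdual k)"
proof (rule cvec.subspaceI)
  show "0 \<in> hdual k" by (simp add: hdual_def cvec.subspace_0[OF can.dual_sub] cvec.subspace_0[OF bforms_sub])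
  show "\<phi> + \<psi> \<in> hdual k" if "\<phi> \<in> hdual k" "\<psi> \<in> hdual k" for \<phi> \<psi>
    using that by (simp add: hdual_def cvec.subspace_add[OF can.dual_sub] cvec.subspace_add[OF bforms_sub])
  show "c *\<^sub>C \<phi> \<in> hdual k" if "\<phi> \<in> hdual k" for \<phi> c
    using that cvec.subspace_scale[OF can.dual_sub, of \<phi> c]
    by (simp add: hdual_def scaleC_fun_def cvec.subspace_scale[OF bforms_sub])
qed

lemma row_clinear_eqI:
  assumes "\<alpha> \<in> row a" "clinear_on (row a) f" "clinear_on (row a) g"
    "\<And>b x. x \<in> bforms C a b \<Longrightarrow> f x = g x"
  shows "f \<alpha> = g \<alpha>"
  using assms(1)
  by (induction rule: row_induct)
     (simp_all add: clinear_on_zero[OF assms(2) row_sub] clinear_on_zero[OF assms(3) row_sub]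
       clinear_on_add[OF assms(2)] clinear_on_add[OF assms(3)] assms(4))

lemma dual_bforms_eqI:
  assumes "\<phi> \<in> can.dual" "\<psi> \<in> can.dual" "\<And>j \<alpha>. \<alpha> \<in> bforms C n j \<Longrightarrow> \<phi> \<alpha> = \<psi> \<alpha>"
  shows "\<phi> = \<psi>"
proof (rule can.dual_eqI[OF assms(1,2)])
  show "\<phi> \<alpha> = \<psi> \<alpha>" if "\<alpha> \<in> row n" for \<alpha>
    by (rule row_clinear_eqI[OF that can.dual_clinear[OF assms(1)] can.dual_clinear[OF assms(2)]])
      (rule assms(3))
qed

lemma dual_dif_bforms:
  assumes "\<phi> \<in> can.dual" "\<alpha> \<in> bforms C n j"
  shows "dual_dif \<phi> \<alpha> = (-1) ^ j *\<^sub>C (delbar C (\<phi> \<alpha>) - \<phi> (delbar C \<alpha>))"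
  using bforms_row[OF assms(2)] bforms_row[OF delbar_mem[OF assms(2)]]
  by (simp add: dual_dif_def parity_bforms[OF assms(2)] can.dual_scale[OF assms(1)]
      clin_scale[OF delbar_clin] cvec.scale_right_diff_distrib)

lemma dual_dif_clinear: "\<phi> \<in> can.dual \<Longrightarrow> clinear_on (row n) (dual_dif \<phi>)"
  by (rule clinear_onI)
     (simp_all add: dual_dif_def cvec.subspace_add[OF row_sub] cvec.subspace_scale[OF row_sub]
       clin_add[OF parity_clin] clin_scale[OF parity_clin] can.dual_add can.dual_scale parity_row row_delbar
       clin_add[OF delbar_clin] clin_scale[OF delbar_clin] cvec.scale_right_diff_distrib)

lemma dual_dif_mem:
  assumes \<phi>: "\<phi> \<in> can.dual"
  shows "dual_dif \<phi> \<in> can.dual"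
proof (rule can.dualI)
  note lin = dual_dif_clinear[OF \<phi>]
  show "dual_dif \<phi> (\<alpha> + \<beta>) = dual_dif \<phi> \<alpha> + dual_dif \<phi> \<beta>" if "\<alpha> \<in> row n" "\<beta> \<in> row n" for \<alpha> \<beta>
    by (rule clinear_on_add[OF lin that])
  show "dual_dif \<phi> \<alpha> = 0" if "\<alpha> \<notin> row n" for \<alpha> using that by (simp add: dual_dif_def)
  show "dual_dif \<phi> \<alpha> \<in> dolb C" if "\<alpha> \<in> row n" for \<alpha>
    using that row_delbar[of "\<phi> (parity \<alpha>)" 0] can.dual_mem[OF \<phi>] cvec.subspace_diff[OF dolb_sub]
    by (simp add: dual_dif_def dolb_row parity_row row_delbar)
  fix e \<alpha> assume e: "e \<in> dolb C" and \<alpha>: "\<alpha> \<in> row n"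
  have mul: "clinear_on (row n) (\<lambda>\<alpha>. dual_dif \<phi> (e * \<alpha>))" "clinear_on (row n) (\<lambda>\<alpha>. e * dual_dif \<phi> \<alpha>)"
    if "e \<in> dolb C" for e
    using that can.l_mem
    by (auto intro!: clinear_onI simp: distrib_left clinear_on_add[OF lin] clinear_on_scale[OF lin] mult_scaleC_right)
  have hom: "dual_dif \<phi> (e * \<alpha>) = e * dual_dif \<phi> \<alpha>" if "e \<in> bforms C 0 i" "\<alpha> \<in> bforms C n j" for i j e \<alpha>
  proof -
    have m: "e \<in> dolb C" "\<alpha> \<in> row n" "delbar C e \<in> dolb C" "delbar C \<alpha> \<in> row n" "e * \<alpha> \<in> bforms C n (i + j)"
      using that mult_bforms[OF that] by (auto simp: dolb_row intro: bforms_row row_delbar)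
    have "delbar C (\<phi> (e * \<alpha>)) - \<phi> (delbar C (e * \<alpha>)) = (-1) ^ i *\<^sub>C (e * (delbar C (\<phi> \<alpha>) - \<phi> (delbar C \<alpha>)))"
      using m by (simp add: can.dual_l[OF \<phi>] delbar_mult[OF that(1)] can.dual_add[OF \<phi>] can.dual_scale[OF \<phi>]
          can.l_mem cvec.subspace_scale[OF row_sub] right_diff_distrib cvec.scale_right_diff_distrib)
    then show ?thesis
      unfolding dual_dif_bforms[OF \<phi> m(5)] dual_dif_bforms[OF \<phi> that(2)]
      by (simp add: scaleC_scaleC mult_scaleC_right power_add[symmetric] ) (simp add: power_add mult.commute mult.left_commute)
  qed
  have hom2: "dual_dif \<phi> (e * \<alpha>) = e * dual_dif \<phi> \<alpha>" if "e \<in> bforms C 0 i" for i e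
    by (rule row_clinear_eqI[OF \<alpha> mul hom]) (use that in \<open>auto simp: dolb_row intro: bforms_row\<close>)
  have "clinear_on (row 0) (\<lambda>e. dual_dif \<phi> (e * \<alpha>))" "clinear_on (row 0) (\<lambda>e. e * dual_dif \<phi> \<alpha>)"
    using \<alpha> can.l_mem
    by (auto intro!: clinear_onI simp: dolb_row distrib_right clinear_on_add[OF lin] clinear_on_scale[OF lin] mult_scaleC_left)
  from row_clinear_eqI[OF _ this hom2] e show "dual_dif \<phi> (e * \<alpha>) = e * dual_dif \<phi> \<alpha>"
    by (simp add: dolb_row)
qed

lemma dual_dif_hdual:
  assumes "\<phi> \<in> hdual k"
  shows "dual_dif \<phi> \<in> hdual (Suc k)"
proof -
  have "dual_dif \<phi> \<alpha> \<in> bforms C 0 (j + Suc k)" if \<alpha>: "\<alpha> \<in> bforms C n j" for j \<alpha>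
    using delbar_mem[OF hdual_mem[OF assms \<alpha>]] hdual_mem[OF assms delbar_mem[OF \<alpha>]]
    by (simp add: dual_dif_bforms[OF hdual_dual[OF assms] \<alpha>] cvec.subspace_scale[OF bforms_sub] cvec.subspace_diff[OF bforms_sub])
  then show ?thesis using dual_dif_mem[OF hdual_dual[OF assms]] by (simp add: hdual_def)
qed

lemma dual_dif_lin: "clinear_on can.dual dual_dif"
proof (rule clinear_onI)
  fix \<phi> \<psi> c assume \<phi>: "\<phi> \<in> can.dual" 
  show "dual_dif (\<phi> + \<psi>) = dual_dif \<phi> + dual_dif \<psi>"
    by (auto simp: dual_dif_def clin_add[OF delbar_clin])
  show "dual_dif (c *\<^sub>C \<phi>) = c *\<^sub>C dual_dif \<phi>"
    by (auto simp: dual_dif_def scaleC_fun_def clin_scale[OF delbar_clin] cvec.scale_right_diff_distrib)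
qed

lemma dual_dif_dif:
  assumes \<phi>: "\<phi> \<in> can.dual"
  shows "dual_dif (dual_dif \<phi>) = 0"
proof (rule dual_bforms_eqI)
  note m = dual_dif_mem[OF \<phi>]
  show "dual_dif (dual_dif \<phi>) \<in> can.dual" by (rule dual_dif_mem[OF m])
  show "0 \<in> can.dual" by (rule cvec.subspace_0[OF can.dual_sub])
  fix j \<alpha> assume \<alpha>: "\<alpha> \<in> bforms C n j"
  show "dual_dif (dual_dif \<phi>) \<alpha> = 0 \<alpha>"
    unfolding dual_dif_bforms[OF m \<alpha>] dual_dif_bforms[OF \<phi> \<alpha>] dual_dif_bforms[OF \<phi> delbar_mem[OF \<alpha>]]
    by (simp add: clin_scale[OF delbar_clin] clin_diff[OF delbar_clin] delbar_delbar can.dual_zero[OF \<phi>]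
        clin_uminus[OF delbar_clin] cvec.scale_right_diff_distrib)
qed

lemma dual_dif_lact:
  assumes e: "e \<in> bforms C 0 i" and \<phi>: "\<phi> \<in> can.dual"
  shows "dual_dif (can.dual_lact e \<phi>) = can.dual_lact (delbar C e) \<phi> + (-1) ^ i *\<^sub>C can.dual_lact e (dual_dif \<phi>)"
proof (rule dual_bforms_eqI)
  have m: "e \<in> dolb C" "delbar C e \<in> dolb C" using e by (auto simp: dolb_row intro: bforms_row row_delbar)
  note le = can.dual_lact_mem[OF m(1) \<phi>]
  show "dual_dif (can.dual_lact e \<phi>) \<in> can.dual" by (rule dual_dif_mem[OF le])
  show "can.dual_lact (delbar C e) \<phi> + (-1) ^ i *\<^sub>C can.dual_lact e (dual_dif \<phi>) \<in> can.dual"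
    using m \<phi> by (intro cvec.subspace_add[OF can.dual_sub] cvec.subspace_scale[OF can.dual_sub] can.dual_lact_mem dual_dif_mem)
  fix j \<alpha> assume \<alpha>: "\<alpha> \<in> bforms C n j"
  have r: "rtwist \<alpha> e \<in> bforms C n (j + i)"
    using mult_bforms[OF \<alpha> sign_twist_mem[OF e]] by (simp add: rtwist_def)
  have d: "delbar C (rtwist \<alpha> e) = rtwist (delbar C \<alpha>) e + (-1) ^ j *\<^sub>C rtwist \<alpha> (delbar C e)"
    using canonical_dg_bimodule \<alpha> m(1) unfolding comodule_dg_bimodule_def X_simps by blast
  have rows: "\<alpha> \<in> row n" "delbar C \<alpha> \<in> row n" "rtwist (delbar C \<alpha>) e \<in> row n" "rtwist \<alpha> (delbar C e) \<in> row n"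
    using \<alpha> m by (auto intro: bforms_row row_delbar can.r_mem)
  have 1: "dual_dif (can.dual_lact e \<phi>) \<alpha> = (-1) ^ j *\<^sub>C (delbar C (\<phi> (rtwist \<alpha> e)) - \<phi> (rtwist (delbar C \<alpha>) e))"
    unfolding dual_dif_bforms[OF le \<alpha>] using rows by (simp add: can.dual_lact_def)
  have sg: "(-1) ^ i * ((-1) ^ j * ((-1) ^ i * (-1) ^ j)) = (1 :: complex)"
    by (cases "even i"; cases "even j") simp_all
  show "dual_dif (can.dual_lact e \<phi>) \<alpha> = (can.dual_lact (delbar C e) \<phi> + (-1) ^ i *\<^sub>C can.dual_lact e (dual_dif \<phi>)) \<alpha>"
    unfolding 1 using rows
    by (simp add: scaleC_fun_def can.dual_lact_def dual_dif_bforms[OF \<phi> r] d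
        can.dual_add[OF \<phi>] can.dual_scale[OF \<phi>] cvec.subspace_scale[OF row_sub] scaleC_scaleC power_add
        cvec.scale_right_diff_distrib scaleC_add_right scaleC_one power_mult_distrib[symmetric] mult.commute sg)
qed

lemma dual_dif_ract:
  assumes \<phi>: "\<phi> \<in> hdual k" and e: "e \<in> dolb C"
  shows "dual_dif (can.dual_ract \<phi> e) = can.dual_ract (dual_dif \<phi>) e + (-1) ^ k *\<^sub>C can.dual_ract \<phi> (delbar C e)"
proof (rule dual_bforms_eqI)
  have m: "delbar C e \<in> dolb C" using e row_delbar by (simp add: dolb_row)
  note \<phi>' = hdual_dual[OF \<phi>]
  note re = can.dual_ract_mem[OF \<phi>' e]
  show "dual_dif (can.dual_ract \<phi> e) \<in> can.dual" by (rule dual_dif_mem[OF re])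
  show "can.dual_ract (dual_dif \<phi>) e + (-1) ^ k *\<^sub>C can.dual_ract \<phi> (delbar C e) \<in> can.dual"
    using m e \<phi>' by (intro cvec.subspace_add[OF can.dual_sub] cvec.subspace_scale[OF can.dual_sub] can.dual_ract_mem dual_dif_mem)
  fix j \<alpha> assume \<alpha>: "\<alpha> \<in> bforms C n j"
  have 1: "dual_dif (can.dual_ract \<phi> e) \<alpha> = (-1) ^ j *\<^sub>C (delbar C (\<phi> \<alpha> * e) - \<phi> (delbar C \<alpha>) * e)"
    unfolding dual_dif_bforms[OF re \<alpha>] by (simp add: can.dual_ract_def)
  have sg: "(-1) ^ j * ((-1) ^ j * c) = (c :: complex)" for c
    by (cases "even j") simp_all
  show "dual_dif (can.dual_ract \<phi> e) \<alpha> = (can.dual_ract (dual_dif \<phi>) e + (-1) ^ k *\<^sub>C can.dual_ract \<phi> (delbar C e)) \<alpha>"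
    unfolding 1
    by (simp add: dual_dif_bforms[OF \<phi>' \<alpha>] scaleC_fun_def can.dual_ract_def
        delbar_mult[OF hdual_mem[OF \<phi> \<alpha>]] scaleC_add_right scaleC_scaleC power_add mult_scaleC_left
        left_diff_distrib cvec.scale_right_diff_distrib sg)
qed

end

section \<open>The coaction on the dual\<close>

context canonical begin

lemma act_lift:
  assumes "cbilin \<gamma>"
  shows "tensor_lift \<gamma> (act ev t \<alpha>) = tensor_lift (\<lambda>a x. tensor_lift (\<lambda>b z. \<gamma> (a * b) (ev z x)) t) (coact C \<alpha>)"
proof -
  have 1: "cbilin (\<lambda>a x. tensor_lift (\<lambda>b z. (a * b) \<otimes> ev z x) t)" by (intro clin_intros)
  have 2: "cbilin (\<lambda>b z. (a * b) \<otimes> ev z x)" for a :: 'a and x by (intro clin_intros)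
  note lin = tensor_lift_clin[OF assms]
  show ?thesis
    unfolding act_def tensor_lift_compose[OF 1 lin] tensor_lift_compose[OF 2 lin] tensor_lift_tens[OF assms] ..
qed

end

locale canonical_dual_basis = canonical H C n
  for H :: "('a::complex_algebra_1) hopf" and C :: "('a, 'w::complex_algebra_1, 'm) cplx_calculus_scheme" and n +
  fixes J :: "'i set" and p :: "'i \<Rightarrow> 'w" and \<psi> :: "'i \<Rightarrow> 'w \<Rightarrow> 'w"
  assumes fin_J: "finite J" and p_mem: "i \<in> J \<Longrightarrow> p i \<in> bforms C n 0" and psi_mem: "i \<in> J \<Longrightarrow> \<psi> i \<in> hdual 0"
    and expansion: "v \<in> row n \<Longrightarrow> (\<Sum>i\<in>J. \<psi> i v * p i) = v"
begin

lemma dual_ract_hdual: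
  assumes "\<phi> \<in> hdual k" "e \<in> bforms C 0 i"
  shows "can.dual_ract \<phi> e \<in> hdual (k + i)"
  using can.dual_ract_mem[OF hdual_dual[OF assms(1)], of e] mult_bforms[OF hdual_mem[OF assms(1)] assms(2)] assms(2)
  by (auto simp: hdual_def dolb_row intro: bforms_row) (auto simp: can.dual_ract_def add.assoc)

lemma dual_expansion:
  assumes "\<phi> \<in> can.dual"
  shows "\<phi> = (\<Sum>i\<in>J. can.dual_ract (\<psi> i) (\<phi> (p i)))"
proof (rule can.dual_eqI[OF assms])
  have p: "p i \<in> row n" if "i \<in> J" for i using bforms_row[OF p_mem[OF that]] .
  have ps: "\<psi> i \<in> can.dual" if "i \<in> J" for i using hdual_dual[OF psi_mem[OF that]] .
  show "(\<Sum>i\<in>J. can.dual_ract (\<psi> i) (\<phi> (p i))) \<in> can.dual"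
    by (rule cvec.subspace_sum[OF can.dual_sub]) (use assms p ps can.dual_ract_mem can.dual_mem in auto)
  fix \<alpha> assume \<alpha>: "\<alpha> \<in> row n"
  have "\<phi> \<alpha> = \<phi> (\<Sum>i\<in>J. \<psi> i \<alpha> * p i)" using expansion[OF \<alpha>] by simp
  also have "\<dots> = (\<Sum>i\<in>J. \<phi> (\<psi> i \<alpha> * p i))"
    by (rule can.dual_sum[OF assms]) (use p ps \<alpha> can.dual_mem can.l_mem in auto)
  also have "\<dots> = (\<Sum>i\<in>J. \<psi> i \<alpha> * \<phi> (p i))"
    by (rule sum.cong) (use p ps \<alpha> can.dual_mem can.dual_l[OF assms] in auto)
  finally show "\<phi> \<alpha> = (\<Sum>i\<in>J. can.dual_ract (\<psi> i) (\<phi> (p i))) \<alpha>"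
    by (simp add: sum_fun_apply can.dual_ract_def)
qed

text \<open>A functional is determined by its values on the generators \<open>p i\<close> of degree zero, which are elements of the
  Dolbeault algebra and split into homogeneous parts. So it is a finite sum of homogeneous functionals, and
  their degrees are not negative.\<close>

lemma dual_span: "cspan (\<Union>k. hdual k) = can.dual"
proof
  show "cspan (\<Union>k. hdual k) \<subseteq> can.dual"
    by (rule csubspace_cspan_least[OF _ can.dual_sub]) (auto intro: hdual_dual)
  have *: "can.dual_ract \<phi> e \<in> cspan (\<Union>k. hdual k)" if \<phi>: "\<phi> \<in> hdual 0" and e: "e \<in> row 0" for \<phi> e
    using e
  proof (induction rule: row_induct)
    case zero
    have "can.dual_ract \<phi> 0 = 0" by (auto simp: can.dual_ract_def)
    then show ?case using cvec.span_zero[of "\<Union>k. hdual k"] by (simp only:)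
  next
    case (add x y)
    have "can.dual_ract \<phi> (x + y) = can.dual_ract \<phi> x + can.dual_ract \<phi> y" by (auto simp: can.dual_ract_def distrib_left)
    with cvec.span_add[OF add(3,4)] show ?case by (simp only:)
  next
    case (bform b x)
    then show ?case using dual_ract_hdual[OF \<phi> bform] by (intro cvec.span_base) auto
  qed
  show "can.dual \<subseteq> cspan (\<Union>k. hdual k)"
  proof
    fix \<phi> assume \<phi>: "\<phi> \<in> can.dual"
    have "\<phi> (p i) \<in> row 0" if "i \<in> J" for i
      using can.dual_mem[OF \<phi> bforms_row[OF p_mem[OF that]]] by (simp add: dolb_row)
    then have "(\<Sum>i\<in>J. can.dual_ract (\<psi> i) (\<phi> (p i))) \<in> cspan (\<Union>k. hdual k)"
      by (intro cvec.span_sum *) (auto intro: psi_mem)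
    then show "\<phi> \<in> cspan (\<Union>k. hdual k)" using dual_expansion[OF \<phi>] by simp
  qed
qed

lemma dual_dsum: "is_direct_sum UNIV hdual can.dual"
  unfolding dual_span[symmetric]
proof (rule direct_sumI[OF hdual_sub])
  fix f assume f: "\<And>k. f k \<in> hdual k" "finite {k. f k \<noteq> 0}" "(\<Sum>k | f k \<noteq> 0. f k) = 0"
  show "f = (\<lambda>_. 0)"
  proof
    fix k
    show "f k = 0"
    proof (rule dual_bforms_eqI[OF hdual_dual[OF f(1)] cvec.subspace_0[OF can.dual_sub]])
      fix j \<alpha> assume \<alpha>: "\<alpha> \<in> bforms C n j"
      have "0 = bcomp 0 (j + k) ((\<Sum>k | f k \<noteq> 0. f k) \<alpha>)" by (simp add: f(3) clin_zero[OF bcomp_clin])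
      also have "\<dots> = (\<Sum>l | f l \<noteq> 0. bcomp 0 (j + k) (f l \<alpha>))"
        by (simp add: sum_fun_apply clin_sum[OF bcomp_clin])
      also have "\<dots> = (\<Sum>l | f l \<noteq> 0. if l = k then f k \<alpha> else 0)"
        by (rule sum.cong) (auto simp: bcomp_in[OF hdual_mem[OF f(1) \<alpha>]])
      also have "\<dots> = f k \<alpha>" using f(2) by (auto simp: sum.delta)
      finally show "f k \<alpha> = 0 \<alpha>" by simp
    qed
  qed
qed

end

text \<open>The additional hypothesis asks for an element that makes evaluation at \<open>\<phi>\<close> equivariant. It is then
  unique, and is the coaction of \<open>\<phi>\<close>.\<close>

locale canonical_dual = canonical_dual_basis H C n J p \<psi>
  for H :: "('a::complex_algebra_1) hopf" and C :: "('a, 'w::complex_algebra_1, 'm) cplx_calculus_scheme"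
    and n and J :: "'i set" and p \<psi> +
  assumes coaction_exists: "\<phi> \<in> can.dual \<Longrightarrow>
      \<exists>t\<in>tspan UNIV can.dual. \<forall>\<alpha>\<in>row n. act ev t \<alpha> = coact C (\<phi> \<alpha>)"
begin

definition dual_coact :: "('w \<Rightarrow> 'w) \<Rightarrow> ('a, 'w \<Rightarrow> 'w) tensor"
  where "dual_coact \<phi> = (SOME t. t \<in> tspan UNIV can.dual \<and> (\<forall>\<alpha>\<in>row n. act ev t \<alpha> = coact C (\<phi> \<alpha>)))"

lemma
  assumes "\<phi> \<in> can.dual"
  shows dual_coact_mem: "dual_coact \<phi> \<in> tspan UNIV can.dual"
    and act_dual_coact: "\<alpha> \<in> row n \<Longrightarrow> act ev (dual_coact \<phi>) \<alpha> = coact C (\<phi> \<alpha>)"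
proof -
  have "\<exists>t. t \<in> tspan UNIV can.dual \<and> (\<forall>\<alpha>\<in>row n. act ev t \<alpha> = coact C (\<phi> \<alpha>))"
    using coaction_exists[OF assms] by blast
  then have "dual_coact \<phi> \<in> tspan UNIV can.dual \<and> (\<forall>\<alpha>\<in>row n. act ev (dual_coact \<phi>) \<alpha> = coact C (\<phi> \<alpha>))"
    unfolding dual_coact_def by (rule someI_ex)
  then show "dual_coact \<phi> \<in> tspan UNIV can.dual" "\<alpha> \<in> row n \<Longrightarrow> act ev (dual_coact \<phi>) \<alpha> = coact C (\<phi> \<alpha>)"
    by auto
qed

lemma dual_coact_eqI:
  assumes "\<phi> \<in> can.dual" "t \<in> tspan UNIV can.dual" "\<And>j \<alpha>. \<alpha> \<in> bforms C n j \<Longrightarrow> act ev t \<alpha> = coact C (\<phi> \<alpha>)"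
  shows "dual_coact \<phi> = t"
  by (rule act_unique[OF dual_coact_mem[OF assms(1)] assms(2)])
     (simp add: assms(3) act_dual_coact[OF assms(1)] bforms_row)

lemma dual_coact_clinear: "clinear_on can.dual dual_coact"
proof (rule clinear_onI)
  fix \<phi> \<psi> c assume \<phi>: "\<phi> \<in> can.dual"
  show "dual_coact (\<phi> + \<psi>) = dual_coact \<phi> + dual_coact \<psi>" if \<psi>: "\<psi> \<in> can.dual"
    by (rule dual_coact_eqI)
       (use \<phi> \<psi> in \<open>auto simp: clin_add[OF act_lin(1)] act_dual_coact bforms_row clin_add[OF coact_clin]
         intro: cvec.subspace_add[OF can.dual_sub] cvec.subspace_add[OF tspan_subspace] dual_coact_mem\<close>)
  show "dual_coact (c *\<^sub>C \<phi>) = c *\<^sub>C dual_coact \<phi>"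
    by (rule dual_coact_eqI[OF cvec.subspace_scale[OF can.dual_sub \<phi>] cvec.subspace_scale[OF tspan_subspace dual_coact_mem[OF \<phi>]]])
       (simp add: \<phi> clin_scale[OF act_lin(1)] act_dual_coact bforms_row clin_scale[OF coact_clin] scaleC_fun_def)
qed

text \<open>In the formula with the antipode all terms are homogeneous, hence so are the values of the slices.\<close>

lemma dual_coact_hdual:
  assumes "\<phi> \<in> hdual k"
  shows "dual_coact \<phi> \<in> tspan UNIV (hdual k)"
proof (rule tspan_slice[OF hdual_sub])
  note \<phi> = hdual_dual[OF assms]
  fix f :: "'a \<Rightarrow> complex" assume f: "cfunctional f"
  have m: "slice f (dual_coact \<phi>) \<in> can.dual" by (rule slice_mem[OF f can.dual_sub dual_coact_mem[OF \<phi>]])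
  have "slice f (dual_coact \<phi>) \<alpha> \<in> bforms C 0 (j + k)" if \<alpha>: "\<alpha> \<in> bforms C n j" for \<alpha> j
  proof -
    have i: "cbilin (\<lambda>a x. tensor_lift (\<lambda>b y. (antipode H a * b) \<otimes> y) (act ev (dual_coact \<phi>) x))"
      and i': "cbilin (\<lambda>b y. (antipode H a * b) \<otimes> (y :: 'w))" for a
      by (intro clin_intros)+
    have "tensor_lift (\<lambda>b z. b \<otimes> ev z \<alpha>) (dual_coact \<phi>) \<in> tspan UNIV (bforms C 0 (j + k))"
      unfolding act_cancel[OF ev_cbilin, symmetric]
    proof (rule tensor_lift_mem[OF coact_bforms[OF \<alpha>] cvec.subspace_UNIV i tspan_subspace])
      fix a x assume x: "x \<in> bforms C n j"
      show "tensor_lift (\<lambda>b y. (antipode H a * b) \<otimes> y) (act ev (dual_coact \<phi>) x) \<in> tspan UNIV (bforms C 0 (j + k))"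
        unfolding act_dual_coact[OF \<phi> bforms_row[OF x]]
        by (rule tensor_lift_mem[OF coact_bforms[OF hdual_mem[OF assms x]] cvec.subspace_UNIV i' tspan_subspace])
           (auto intro: tspan_tens)
    qed
    from slice_mem[OF f bforms_sub this] show ?thesis
      unfolding slice_eval[OF f] ev_eq[OF m bforms_row[OF \<alpha>]] .
  qed
  with m show "slice f (dual_coact \<phi>) \<in> hdual k" by (simp add: hdual_def)
qed

text \<open>After evaluation at a form of bidegree \<open>(n,j)\<close>, whose coaction involves forms of the same bidegree only, the sign
  in the differential of the dual is constant and the claim is equivariance of \<open>delbar\<close>.\<close>

lemma dual_coact_dif:
  assumes \<phi>: "\<phi> \<in> can.dual"
  shows "dual_coact (dual_dif \<phi>) = tensor_lift_on UNIV can.dual (\<lambda>a \<psi>. a \<otimes> dual_dif \<psi>) (dual_coact \<phi>)"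
proof -
  define d where "d \<psi> = dual_dif (subspace_proj can.dual \<psi>)" for \<psi>
  have d_clin: "clin d"
    unfolding d_def
    by (rule clinear_onI)
       (simp_all add: clin_add[OF subspace_proj_clin[OF can.dual_sub]] clin_scale[OF subspace_proj_clin[OF can.dual_sub]]
         clinear_on_add[OF dual_dif_lin] clinear_on_scale[OF dual_dif_lin] subspace_proj_mem[OF can.dual_sub])
  have d_eq: "d \<psi> = dual_dif \<psi>" if "\<psi> \<in> can.dual" for \<psi> by (simp add: d_def subspace_proj_id[OF can.dual_sub that])
  have dl: "clin (\<lambda>x. ev (d x) \<alpha>)" for \<alpha> by (intro clin_intros d_clin)
  have bil: "cbilin (\<lambda>a \<psi>. a \<otimes> d \<psi>)" by (intro clin_intros d_clin)
  have eq: "tensor_lift_on UNIV can.dual (\<lambda>a \<psi>. a \<otimes> dual_dif \<psi>) (dual_coact \<phi>) = tensor_lift (\<lambda>a \<psi>. a \<otimes> d \<psi>) (dual_coact \<phi>)"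
    by (rule tensor_lift_on_eq[OF cvec.subspace_UNIV can.dual_sub dual_coact_mem[OF \<phi>] bil]) (simp add: d_eq)
  show ?thesis
    unfolding eq
  proof (rule dual_coact_eqI[OF dual_dif_mem[OF \<phi>]])
    show "tensor_lift (\<lambda>a \<psi>. a \<otimes> d \<psi>) (dual_coact \<phi>) \<in> tspan UNIV can.dual"
      by (rule tensor_lift_mem[OF dual_coact_mem[OF \<phi>] cvec.subspace_UNIV bil tspan_subspace])
         (simp add: tspan_tens d_eq dual_dif_mem)
    fix j \<alpha> assume \<alpha>: "\<alpha> \<in> bforms C n j"
    have b2: "cbilin (\<lambda>b z. (a * b) \<otimes> ev z x)" for a :: 'a and x by (intro clin_intros)
    have "act ev (tensor_lift (\<lambda>a \<psi>. a \<otimes> d \<psi>) (dual_coact \<phi>)) \<alpha> =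
        tensor_lift (\<lambda>a x. tensor_lift (\<lambda>b z. (a * b) \<otimes> ev (d z) x) (dual_coact \<phi>)) (coact C \<alpha>)"
      unfolding act_def tensor_lift_compose[OF bil tensor_lift_clin[OF b2]] tensor_lift_tens[OF b2] ..
    also have "\<dots> = tensor_lift (\<lambda>a x. tensor_lift (\<lambda>b z. (a * b) \<otimes> ((-1) ^ j *\<^sub>C (delbar C (ev z x) - ev z (delbar C x)))) (dual_coact \<phi>)) (coact C \<alpha>)"
      by (rule tensor_lift_cong_right[OF coact_bforms[OF \<alpha>]], (intro clin_intros dl)+,
          rule tensor_lift_cong_right[OF dual_coact_mem[OF \<phi>]], (intro clin_intros dl)+)
         (simp add: d_eq ev_eq dual_dif_mem dual_dif_bforms bforms_row row_delbar)
    also have "\<dots> = (-1) ^ j *\<^sub>C (tensor_lift (\<lambda>a y. a \<otimes> delbar C y) (act ev (dual_coact \<phi>) \<alpha>) - act ev (dual_coact \<phi>) (delbar C \<alpha>))"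
    proof -
      have 1: "cbilin (\<lambda>a y. a \<otimes> delbar C y)" by (intro clin_intros)
      have 2: "cbilin (\<lambda>a x. tensor_lift (\<lambda>b z. (a * b) \<otimes> ev z x) (dual_coact \<phi>))" by (intro clin_intros)
      have 3: "cbilin (\<lambda>b z. (a * b) \<otimes> delbar C (ev z x))" "cbilin (\<lambda>b z. (a * b) \<otimes> ev z (delbar C x))" for a :: 'a and x
        by (intro clin_intros)+
      have 4: "cbilin (\<lambda>b z. (a * b) \<otimes> delbar C (ev z x) - (a * b) \<otimes> ev z (delbar C x))" for a :: 'a and x
        by (intro clin_intros)
      have 5: "cbilin (\<lambda>a x. tensor_lift (\<lambda>b z. (a * b) \<otimes> delbar C (ev z x)) (dual_coact \<phi>))"
        "cbilin (\<lambda>a x. tensor_lift (\<lambda>b z. (a * b) \<otimes> ev z (delbar C x)) (dual_coact \<phi>))"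
        by (intro clin_intros)+
      have 6: "cbilin (\<lambda>a x. tensor_lift (\<lambda>b z. (a * b) \<otimes> delbar C (ev z x)) (dual_coact \<phi>) -
          tensor_lift (\<lambda>b z. (a * b) \<otimes> ev z (delbar C x)) (dual_coact \<phi>))"
        by (intro clin_intros)
      have sc: "clin (\<lambda>t :: ('a, 'w) tensor. (-1) ^ j *\<^sub>C t)" by (intro clin_intros)
      have dist: "(a * b) \<otimes> ((-1) ^ j *\<^sub>C (u - v)) = (-1) ^ j *\<^sub>C ((a * b) \<otimes> u - (a * b) \<otimes> v)"
        for a b :: 'a and u v :: 'w
        by (simp add: tens_scale_right clin_diff[OF cbilinear_on_right[OF tens_cbilin UNIV_I]])
      show ?thesis
        unfolding dist tensor_lift_compose[OF 4 sc, symmetric] tensor_lift_diff_fun[OF 3]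
          tensor_lift_compose[OF 6 sc, symmetric] tensor_lift_diff_fun[OF 5] act_lift[OF 1]
        by (simp add: act_def sweedler_delbar[OF 2])
    qed
    also have "\<dots> = coact C (dual_dif \<phi> \<alpha>)"
      using bforms_row[OF \<alpha>] row_delbar[OF bforms_row[OF \<alpha>]]
      by (simp add: act_dual_coact[OF \<phi>] dual_dif_bforms[OF \<phi> \<alpha>] clin_scale[OF coact_clin] clin_diff[OF coact_clin] coact_delbar)
    finally show "act ev (tensor_lift (\<lambda>a \<psi>. a \<otimes> d \<psi>) (dual_coact \<phi>)) \<alpha> = coact C (dual_dif \<phi> \<alpha>)" .
  qed
qed

end

lemma tensor_assoc_lift: "tensor_assoc (s \<otimes> u) = tensor_lift (\<lambda>a b. a \<otimes> b \<otimes> u) s"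
proof -
  have 1: "cbilin (\<lambda>a b. a \<otimes> b \<otimes> u)" by (intro clin_intros)
  have 2: "clin (\<lambda>s. tensor_assoc (s \<otimes> u))" by (rule clin_compose[OF tensor_assoc_clin]) (intro clin_intros)
  show ?thesis
    by (induction s rule: tensor_induct)
       (simp_all add: clin_zero[OF 2] clin_add[OF 2] clin_zero[OF tensor_lift_clin[OF 1]] tensor_lift_add[OF 1]
         tensor_lift_tens[OF 1] tensor_assoc_tens)
qed

lemma clin_tensor_assoc [clin_intros]: "clin f \<Longrightarrow> clin (\<lambda>x. tensor_assoc (f x))"
  by (rule clin_compose[OF tensor_assoc_clin])

context dolbeault begin

lemma tensor_prod_mem:
  fixes s :: "('a, 'v::complex_vector) tensor" and \<beta> :: "'v \<Rightarrow> 'u::complex_vector \<Rightarrow> 'z::complex_vector"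
  assumes "csubspace V" "csubspace W" "csubspace Z" "s \<in> tspan UNIV V" "t \<in> tspan UNIV W" "cbilin \<beta>"
    "\<And>v w. v \<in> V \<Longrightarrow> w \<in> W \<Longrightarrow> \<beta> v w \<in> Z"
  shows "tensor_prod UNIV UNIV \<beta> s t \<in> tspan UNIV Z"
proof -
  have g: "clin (\<lambda>v. \<beta> v w)" "clin (\<lambda>w. \<beta> v w)" for v w
    using assms(6) by (simp_all add: cbilin_iff)
  have 1: "cbilin (\<lambda>a v. tensor_lift (\<lambda>b w. (a * b) \<otimes> \<beta> v w) t)" by (intro clin_intros g)
  have 2: "cbilin (\<lambda>b w. (a * b) \<otimes> \<beta> v w)" for a :: 'a and v by (intro clin_intros g)
  show ?thesis
    unfolding tensor_prod_def
    by (rule tensor_lift_mem[OF assms(4) cvec.subspace_UNIV 1 tspan_subspace],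
        rule tensor_lift_mem[OF assms(5) cvec.subspace_UNIV 2 tspan_subspace])
       (simp add: tspan_tens assms(7))
qed

end

context canonical begin

lemma clin_rtwist1 [clin_intros]: "clin f \<Longrightarrow> clin (\<lambda>x. rtwist (f x) e)"
  unfolding rtwist_def by (intro clin_intros)

lemma clin_rtwist2 [clin_intros]: "clin f \<Longrightarrow> clin (\<lambda>x. rtwist v (f x))"
  unfolding rtwist_def by (intro clin_intros)

lemma dual_ract_cbilin: "cbilin can.dual_ract"
  by (intro cbilinear_onI clinear_onI ext)
     (simp_all add: can.dual_ract_def scaleC_fun_def distrib_left distrib_right mult_scaleC_left mult_scaleC_right)

end

context canonical_dual begin

text \<open>A linear extension of the coaction to the ambient space, for use inside integrals.\<close>

definition dual_coact_ext :: "('w \<Rightarrow> 'w) \<Rightarrow> ('a, 'w \<Rightarrow> 'w) tensor"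
  where "dual_coact_ext w = dual_coact (subspace_proj can.dual w)"

lemma dual_coact_ext_clin: "clin dual_coact_ext"
  unfolding dual_coact_ext_def
  by (rule clinear_onI)
     (simp_all add: clin_add[OF subspace_proj_clin[OF can.dual_sub]] clin_scale[OF subspace_proj_clin[OF can.dual_sub]]
       clinear_on_add[OF dual_coact_clinear] clinear_on_scale[OF dual_coact_clinear] subspace_proj_mem[OF can.dual_sub])

lemma clin_dual_coact_ext [clin_intros]: "clin f \<Longrightarrow> clin (\<lambda>x. dual_coact_ext (f x))"
  by (rule clin_compose[OF dual_coact_ext_clin])

lemma dual_coact_ext_eq: "w \<in> can.dual \<Longrightarrow> dual_coact_ext w = dual_coact w"
  by (simp add: dual_coact_ext_def subspace_proj_id[OF can.dual_sub])

lemma dual_coact_ext_mem: "dual_coact_ext w \<in> tspan UNIV can.dual"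
  unfolding dual_coact_ext_def by (rule dual_coact_mem[OF subspace_proj_mem[OF can.dual_sub]])

lemma act_dual_coact_ext: "x \<in> row n \<Longrightarrow> act ev (dual_coact_ext w) x = coact C (ev w x)"
  unfolding dual_coact_ext_def act_dual_coact[OF subspace_proj_mem[OF can.dual_sub]] by (simp add: ev_def subspace_proj_id[OF row_sub])

text \<open>The two sides of coassociativity for the dual are paired with a form twice over, by \<open>act\<close> for the pairing
  \<open>act ev\<close>. The first side becomes \<open>(\<Delta> \<otimes> id)\<close> of the coaction of the value, by coassociativity of the
  coaction of \<open>\<alpha>\<close> and multiplicativity of \<open>\<Delta>\<close>.\<close>

lemma act_comult:
  "act (act ev) (tensor_lift (\<lambda>a w. tensor_assoc (comult H a \<otimes> w)) t) \<alpha> =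
   tensor_lift (\<lambda>a y. tensor_assoc (comult H a \<otimes> y)) (act ev t \<alpha>)" (is "?L = ?R")
proof -
  define K where "K a c1 a' c2 w x = (a * c1) \<otimes> (a' * c2) \<otimes> ev w x" for a c1 a' c2 :: 'a and w x
  have K: "clin (\<lambda>a. K a c1 a' c2 w x)" "clin (\<lambda>c1. K a c1 a' c2 w x)" "clin (\<lambda>a'. K a c1 a' c2 w x)"
    "clin (\<lambda>c2. K a c1 a' c2 w x)" "clin (\<lambda>w. K a c1 a' c2 w x)" "clin (\<lambda>x. K a c1 a' c2 w x)" for a c1 a' c2 w x
    unfolding K_def by (intro clin_intros)+
  have b1: "cbilin (\<lambda>a w. tensor_assoc (comult H a \<otimes> (w :: 'w \<Rightarrow> 'w)))" by (intro clin_intros)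
  have b1': "cbilin (\<lambda>a w. tensor_assoc (comult H a \<otimes> (w :: 'w)))" by (intro clin_intros)
  have b2: "cbilin (\<lambda>b s. (a * b) \<otimes> act ev s x)" for a :: 'a and x by (intro clin_intros)
  have b3: "cbilin (\<lambda>a b. a \<otimes> b \<otimes> w)" for w :: "'w \<Rightarrow> 'w" by (intro clin_intros)
  have b4: "cbilin (\<lambda>a x. tensor_lift (\<lambda>b z. (a * b) \<otimes> ev z x) (c2 \<otimes> w))" for c2 :: 'a and w by (intro clin_intros)
  have b5: "cbilin (\<lambda>b z. (a * b) \<otimes> ev z x)" for a :: 'a and x by (intro clin_intros)
  have b6: "cbilin (\<lambda>a x. (a * c2) \<otimes> ev w x)" for c2 :: 'a and w by (intro clin_intros)
  have c: "clin (\<lambda>s. b \<otimes> s)" for b :: 'a and s :: "('a, 'w) tensor" by (intro clin_intros)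
  have t1: "(a * c1) \<otimes> act ev (c2 \<otimes> w) x = tensor_lift (\<lambda>a' x'. K a c1 a' c2 w x') (coact C x)" for a c1 c2 w x
    unfolding act_def tensor_lift_tens[OF b5] K_def
    by (rule tensor_lift_compose[OF b6]) (intro clin_intros)
  have "?L = tensor_lift (\<lambda>a x. tensor_lift (\<lambda>c w. tensor_lift (\<lambda>c1 c2.
      tensor_lift (\<lambda>a' x'. K a c1 a' c2 w x') (coact C x)) (comult H c)) t) (coact C \<alpha>)"
    unfolding act_def[of "act ev"] tensor_lift_compose[OF b1 tensor_lift_clin[OF b2]]
    unfolding tensor_assoc_lift tensor_lift_compose[OF b3 tensor_lift_clin[OF b2]] tensor_lift_tens[OF b2] t1 ..
  also have "\<dots> = tensor_lift (\<lambda>a x. tensor_lift (\<lambda>a' x'. tensor_lift (\<lambda>c w. tensor_lift (\<lambda>c1 c2.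
      K a c1 a' c2 w x') (comult H c)) t) (coact C x)) (coact C \<alpha>)"
    by (subst (1 2) tensor_lift_fubini) (intro clin_intros K | rule refl)+
  also have "\<dots> = tensor_lift (\<lambda>a x. tensor_lift (\<lambda>a1 a2. tensor_lift (\<lambda>c w. tensor_lift (\<lambda>c1 c2.
      K a1 c1 a2 c2 w x) (comult H c)) t) (comult H a)) (coact C \<alpha>)"
    by (rule sweedler_coassoc) (intro clin_intros K)
  also have "\<dots> = tensor_lift (\<lambda>a x. tensor_lift (\<lambda>c w. tensor_lift (\<lambda>a1 a2. tensor_lift (\<lambda>c1 c2.
      K a1 c1 a2 c2 w x) (comult H c)) (comult H a)) t) (coact C \<alpha>)"
    by (subst tensor_lift_fubini) (intro clin_intros K | rule refl)+
  also have "\<dots> = ?R"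
  proof -
    have b7: "cbilin (\<lambda>a b. a \<otimes> b \<otimes> y)" for y :: 'w by (intro clin_intros)
    show ?thesis
      unfolding act_lift[OF b1']
      unfolding tensor_assoc_lift sweedler_comult[OF b7] K_def ..
  qed
  finally show ?thesis .
qed

text \<open>The second side becomes \<open>(id \<otimes> \<delta>)\<close> of the coaction of the value, where \<open>\<delta>\<close> is the coaction on forms.\<close>

lemma act_dual_coact_ext_lift:
  assumes \<alpha>: "\<alpha> \<in> row n"
  shows "act (act ev) (tensor_lift (\<lambda>a w. a \<otimes> dual_coact_ext w) t) \<alpha> = tensor_lift (\<lambda>a y. a \<otimes> coact C y) (act ev t \<alpha>)"
proof -
  have b1: "cbilin (\<lambda>a w. a \<otimes> dual_coact_ext w)" by (intro clin_intros)
  have b2: "cbilin (\<lambda>b s. (a * b) \<otimes> act ev s x)" for a :: 'a and x by (intro clin_intros)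
  have b3: "cbilin (\<lambda>a y. a \<otimes> coact C y)" by (intro clin_intros)
  show ?thesis
    unfolding act_def[of "act ev"] tensor_lift_compose[OF b1 tensor_lift_clin[OF b2]] tensor_lift_tens[OF b2]
      act_lift[OF b3]
    by (rule tensor_lift_cong_right[OF row_coact[OF \<alpha>]]) (intro clin_intros | simp add: act_dual_coact_ext)+
qed

text \<open>For coassociativity the form is cancelled twice: against the pairing \<open>act ev\<close>, and then, slice by
  slice, against \<open>ev\<close>.\<close>

lemma dual_comodule: "is_comodule H can.dual dual_coact"
  unfolding is_comodule_def
proof (intro conjI ballI dual_coact_clinear dual_coact_mem)
  fix \<phi> assume \<phi>: "\<phi> \<in> can.dual"
  note mem = dual_coact_mem[OF \<phi>]
  note on = tensor_lift_on_eq[OF cvec.subspace_UNIV can.dual_sub mem]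
  have b1: "cbilin (\<lambda>a w. tensor_assoc (comult H a \<otimes> (w :: 'w \<Rightarrow> 'w)))" by (intro clin_intros)
  have b2: "cbilin (\<lambda>a w. a \<otimes> dual_coact_ext w)" by (intro clin_intros)
  have b3: "cbilin (\<lambda>a w. counit H a *\<^sub>C (w :: 'w \<Rightarrow> 'w))" by (intro clin_intros)
  define T1 where "T1 = tensor_lift (\<lambda>a w. tensor_assoc (comult H a \<otimes> w)) (dual_coact \<phi>)"
  define T2 where "T2 = tensor_lift (\<lambda>a w. a \<otimes> dual_coact_ext w) (dual_coact \<phi>)"
  have m2: "T2 \<in> tspan UNIV (tspan UNIV can.dual)"
    unfolding T2_def
    by (rule tensor_lift_mem[OF mem cvec.subspace_UNIV b2 tspan_subspace]) (simp add: tspan_tens dual_coact_ext_mem)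
  have m1: "T1 \<in> tspan UNIV (tspan UNIV can.dual)"
    unfolding T1_def
  proof (rule tensor_lift_mem[OF mem cvec.subspace_UNIV b1 tspan_subspace])
    fix a and w :: "'w \<Rightarrow> 'w" assume w: "w \<in> can.dual"
    have b4: "cbilin (\<lambda>a b. a \<otimes> b \<otimes> w)" by (intro clin_intros)
    have "comult H a \<in> tspan UNIV UNIV" by (simp add: tspan_UNIV)
    then show "tensor_assoc (comult H a \<otimes> w) \<in> tspan UNIV (tspan UNIV can.dual)"
      unfolding tensor_assoc_lift
      by (rule tensor_lift_mem[OF _ cvec.subspace_UNIV b4 tspan_subspace]) (simp add: tspan_tens w)
  qed
  have act_eq: "act (act ev) T1 \<alpha> = act (act ev) T2 \<alpha>" if "\<alpha> \<in> row n" for \<alpha>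
    unfolding T1_def T2_def act_comult act_dual_coact_ext_lift[OF that] act_dual_coact[OF \<phi> that] by (rule coact_coassoc)
  have "T1 = T2"
  proof (rule slice_separates)
    fix f :: "'a \<Rightarrow> complex" assume f: "cfunctional f"
    show "slice f T1 = slice f T2"
    proof (rule act_unique[OF slice_mem[OF f tspan_subspace m1] slice_mem[OF f tspan_subspace m2]])
      fix j \<alpha> assume "\<alpha> \<in> bforms C n j"
      then have \<alpha>: "\<alpha> \<in> row n" by (rule bforms_row)
      have "tensor_lift (\<lambda>b s. b \<otimes> act ev s \<alpha>) T1 = tensor_lift (\<lambda>b s. b \<otimes> act ev s \<alpha>) T2"
        by (rule eval_cancel[OF act_cbilin act_eq \<alpha>])
      then show "act ev (slice f T1) \<alpha> = act ev (slice f T2) \<alpha>"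
        unfolding slice_map[OF f act_lin(1), symmetric] by simp
    qed
  qed
  moreover have "tensor_lift_on UNIV can.dual (\<lambda>a w. tensor_assoc (comult H a \<otimes> w)) (dual_coact \<phi>) = T1"
    unfolding T1_def by (rule on[OF b1 refl])
  moreover have "tensor_lift_on UNIV can.dual (\<lambda>a w. a \<otimes> dual_coact w) (dual_coact \<phi>) = T2"
    unfolding T2_def by (rule on[OF b2]) (simp add: dual_coact_ext_eq)
  ultimately show "tensor_lift_on UNIV can.dual (\<lambda>a w. tensor_assoc (comult H a \<otimes> w)) (dual_coact \<phi>) =
      tensor_lift_on UNIV can.dual (\<lambda>a w. a \<otimes> dual_coact w) (dual_coact \<phi>)" by simp
  have "slice (counit H) (dual_coact \<phi>) = \<phi>"
  proof (rule can.dual_eqI[OF slice_mem[OF counit_functional can.dual_sub mem] \<phi>])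
    fix \<alpha> assume \<alpha>: "\<alpha> \<in> row n"
    have b5: "cbilin (\<lambda>a y. counit H a *\<^sub>C (y :: 'w))" by (intro clin_intros)
    have b6: "cbilin (\<lambda>b z. counit H b *\<^sub>C ev z x)" for x by (intro clin_intros)
    have b7: "cbilin (\<lambda>b z. counit H b *\<^sub>C (z :: 'w \<Rightarrow> 'w))" by (intro clin_intros)
    have "\<phi> \<alpha> = tensor_lift (\<lambda>a y. counit H a *\<^sub>C y) (act ev (dual_coact \<phi>) \<alpha>)"
      by (simp add: act_dual_coact[OF \<phi> \<alpha>] coact_counit)
    also have "\<dots> = tensor_lift (\<lambda>a x. counit H a *\<^sub>C tensor_lift (\<lambda>b z. counit H b *\<^sub>C ev z x) (dual_coact \<phi>)) (coact C \<alpha>)"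
    proof -
      have "clin (\<lambda>w. counit H a *\<^sub>C (w :: 'w))" for a by (intro clin_intros)
      from tensor_lift_compose[OF b6 this] show ?thesis
        unfolding act_lift[OF b5] counit_mult by (simp add: scaleC_scaleC)
    qed
    also have "\<dots> = tensor_lift (\<lambda>b z. counit H b *\<^sub>C ev z \<alpha>) (dual_coact \<phi>)"
      by (rule sweedler_counit) (intro clin_intros)
    also have "\<dots> = ev (slice (counit H) (dual_coact \<phi>)) \<alpha>"
      unfolding slice_def tensor_lift_compose[OF b7 ev_lin(1)] clin_scale[OF ev_lin(1)] ..
    also have "\<dots> = slice (counit H) (dual_coact \<phi>) \<alpha>"
      by (rule ev_eq[OF slice_mem[OF counit_functional can.dual_sub mem] \<alpha>])
    finally show "slice (counit H) (dual_coact \<phi>) \<alpha> = \<phi> \<alpha>" by simp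
  qed
  then show "tensor_lift_on UNIV can.dual (\<lambda>a w. counit H a *\<^sub>C w) (dual_coact \<phi>) = \<phi>"
    unfolding on[OF b3 refl] slice_def .
qed

lemma dual_coact_lact:
  assumes e: "e \<in> dolb C" and \<phi>: "\<phi> \<in> can.dual"
  shows "dual_coact (can.dual_lact e \<phi>) = tensor_prod (dolb C) can.dual can.dual_lact (coact C e) (dual_coact \<phi>)"
proof -
  interpret D: sub_bimodule "dolb C" can.dual_lact can.dual_ract can.dual by (rule can.dual_sub_bimodule)
  define l where "l v w = can.dual_lact (subspace_proj (dolb C) v) (subspace_proj can.dual w)" for v w
  have l: "cbilin l"
    using bilinear_extend[OF dolb_sub can.dual_sub D.l_bilin] by (simp add: l_def[abs_def])
  have l_eq: "l v w = can.dual_lact v w" if "v \<in> dolb C" "w \<in> can.dual" for v w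
    using that by (simp add: l_def subspace_proj_id[OF dolb_sub] subspace_proj_id[OF can.dual_sub])
  have ll: "clin (\<lambda>v. l v w)" "clin (\<lambda>w. l v w)" for v w using l by (simp_all add: cbilin_iff)
  have ce: "coact C e \<in> tspan UNIV (dolb C)" using row_coact[of e 0] e by (simp add: dolb_row)
  note mem = dual_coact_mem[OF \<phi>]
  have eq: "tensor_prod (dolb C) can.dual can.dual_lact (coact C e) (dual_coact \<phi>) = tensor_prod UNIV UNIV l (coact C e) (dual_coact \<phi>)"
    by (rule tensor_prod_on_eq[OF dolb_sub can.dual_sub ce mem l]) (simp add: l_eq)
  show ?thesis unfolding eq
  proof (rule dual_coact_eqI[OF can.dual_lact_mem[OF e \<phi>]])
    show "tensor_prod UNIV UNIV l (coact C e) (dual_coact \<phi>) \<in> tspan UNIV can.dual"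
      by (rule tensor_prod_mem[OF dolb_sub can.dual_sub can.dual_sub ce mem l]) (simp add: l_eq can.dual_lact_mem)
    fix j \<alpha> assume "\<alpha> \<in> bforms C n j"
    then have \<alpha>: "\<alpha> \<in> row n" by (rule bforms_row)
    have b1: "cbilin (\<lambda>b z. (a * b) \<otimes> ev z x)" for a :: 'a and x by (intro clin_intros)
    have b2: "cbilin (\<lambda>a x. tensor_lift (\<lambda>b z. (a * b) \<otimes> ev z x) (dual_coact \<phi>))" by (intro clin_intros)
    have "act ev (tensor_prod UNIV UNIV l (coact C e) (dual_coact \<phi>)) \<alpha> =
      tensor_lift (\<lambda>a x. tensor_lift (\<lambda>c v. tensor_lift (\<lambda>b w. (a * (c * b)) \<otimes> ev (l v w) x) (dual_coact \<phi>)) (coact C e)) (coact C \<alpha>)"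
      unfolding act_def tensor_prod_lift[OF l b1] ..
    also have "\<dots> = tensor_lift (\<lambda>a x. tensor_lift (\<lambda>c v. tensor_lift (\<lambda>b w. (a * c * b) \<otimes> ev w (rtwist x v)) (dual_coact \<phi>)) (coact C e)) (coact C \<alpha>)"
      by (rule tensor_lift_cong_right[OF row_coact[OF \<alpha>]], (intro clin_intros ll)+,
          rule tensor_lift_cong_right[OF ce], (intro clin_intros ll)+,
          rule tensor_lift_cong_right[OF mem], (intro clin_intros ll)+)
         (simp add: l_eq ev_eq can.dual_lact_mem can.r_mem mult.assoc, simp add: can.dual_lact_def)
    also have "\<dots> = act ev (dual_coact \<phi>) (rtwist \<alpha> e)"
      unfolding act_def by (rule sweedler_rtwist[OF b2, symmetric])
    also have "\<dots> = coact C (can.dual_lact e \<phi> \<alpha>)"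
      using act_dual_coact[OF \<phi> can.r_mem[OF \<alpha> e]] \<alpha> by (simp add: can.dual_lact_def)
    finally show "act ev (tensor_prod UNIV UNIV l (coact C e) (dual_coact \<phi>)) \<alpha> = coact C (can.dual_lact e \<phi> \<alpha>)" .
  qed
qed

lemma dual_coact_ract:
  assumes e: "e \<in> dolb C" and \<phi>: "\<phi> \<in> can.dual"
  shows "dual_coact (can.dual_ract \<phi> e) = tensor_prod can.dual (dolb C) can.dual_ract (dual_coact \<phi>) (coact C e)"
proof -
  note r = dual_ract_cbilin
  have rl: "clin (\<lambda>v. can.dual_ract v w)" "clin (\<lambda>w. can.dual_ract v w)" for v w using r by (simp_all add: cbilin_iff)
  have ce: "coact C e \<in> tspan UNIV (dolb C)" using row_coact[of e 0] e by (simp add: dolb_row)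
  note mem = dual_coact_mem[OF \<phi>]
  show ?thesis unfolding tensor_prod_on_eq[OF can.dual_sub dolb_sub mem ce r refl]
  proof (rule dual_coact_eqI[OF can.dual_ract_mem[OF \<phi> e]])
    show "tensor_prod UNIV UNIV can.dual_ract (dual_coact \<phi>) (coact C e) \<in> tspan UNIV can.dual"
      by (rule tensor_prod_mem[OF can.dual_sub dolb_sub can.dual_sub mem ce r]) (simp add: can.dual_ract_mem)
    fix j \<alpha> assume "\<alpha> \<in> bforms C n j"
    then have \<alpha>: "\<alpha> \<in> row n" by (rule bforms_row)
    have b1: "cbilin (\<lambda>b z. (a * b) \<otimes> ev z x)" for a :: 'a and x by (intro clin_intros)
    have b2: "cbilin (\<lambda>a y. tensor_lift (\<lambda>c v. (a * c) \<otimes> (y * v)) (coact C e))" by (intro clin_intros)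
    have "act ev (tensor_prod UNIV UNIV can.dual_ract (dual_coact \<phi>) (coact C e)) \<alpha> =
      tensor_lift (\<lambda>a x. tensor_lift (\<lambda>b w. tensor_lift (\<lambda>c v. (a * (b * c)) \<otimes> ev (can.dual_ract w v) x) (coact C e)) (dual_coact \<phi>)) (coact C \<alpha>)"
      unfolding act_def tensor_prod_lift[OF r b1] ..
    also have "\<dots> = tensor_lift (\<lambda>a x. tensor_lift (\<lambda>b w. tensor_lift (\<lambda>c v. (a * b * c) \<otimes> (ev w x * v)) (coact C e)) (dual_coact \<phi>)) (coact C \<alpha>)"
      by (rule tensor_lift_cong_right[OF row_coact[OF \<alpha>]], (intro clin_intros rl)+,
          rule tensor_lift_cong_right[OF mem], (intro clin_intros rl)+,
          rule tensor_lift_cong_right[OF ce], (intro clin_intros rl)+)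
         (simp add: ev_eq can.dual_ract_mem mult.assoc, simp add: can.dual_ract_def)
    also have "\<dots> = tensor_lift (\<lambda>a y. tensor_lift (\<lambda>c v. (a * c) \<otimes> (y * v)) (coact C e)) (act ev (dual_coact \<phi>) \<alpha>)"
      by (rule act_lift[OF b2, symmetric])
    also have "\<dots> = coact C (can.dual_ract \<phi> e \<alpha>)"
      unfolding act_dual_coact[OF \<phi> \<alpha>] can.dual_ract_def coact_mult by (simp add: tensor_prod_def)
    finally show "act ev (tensor_prod UNIV UNIV can.dual_ract (dual_coact \<phi>) (coact C e)) \<alpha> = coact C (can.dual_ract \<phi> e \<alpha>)" .
  qed
qed

definition Y :: "('a, 'w, 'w \<Rightarrow> 'w) dgmod"
  where "Y = \<lparr>mcomp = hdual, lact = can.dual_lact, ract = can.dual_ract, mdif = dual_dif, mcoact = dual_coact\<rparr>"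

lemma Y_simps: "mcomp Y = hdual" "lact Y = can.dual_lact" "ract Y = can.dual_ract" "mdif Y = dual_dif"
    "mcoact Y = dual_coact" "mcarrier Y = can.dual"
  by (simp_all add: Y_def mcarrier_def dual_span)

lemma dual_lact_hdual:
  assumes e: "e \<in> bforms C 0 i" and \<phi>: "\<phi> \<in> hdual j"
  shows "can.dual_lact e \<phi> \<in> hdual (i + j)"
proof -
  have "e \<in> dolb C" using bforms_row[OF e] by (simp add: dolb_row)
  from can.dual_lact_mem[OF this hdual_dual[OF \<phi>]]
  have m: "can.dual_lact e \<phi> \<in> can.dual" .
  have "can.dual_lact e \<phi> \<alpha> \<in> bforms C 0 (k + (i + j))" if \<alpha>: "\<alpha> \<in> bforms C n k" for k \<alpha>
  proof -
    have "rtwist \<alpha> e \<in> bforms C n (k + i)"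
      using mult_bforms[OF \<alpha> sign_twist_mem[OF e]] by (simp add: rtwist_def)
    from hdual_mem[OF \<phi> this] show ?thesis
      using bforms_row[OF \<alpha>] by (simp add: can.dual_lact_def add.assoc)
  qed
  with m show ?thesis by (simp add: hdual_def)
qed

lemma dual_left_dg_module: "comodule_left_dg_module H C Y"
proof -
  interpret D: sub_bimodule "dolb C" can.dual_lact can.dual_ract can.dual by (rule can.dual_sub_bimodule)
  show ?thesis
    unfolding comodule_left_dg_module_def Y_simps
  proof (intro conjI allI ballI)
    show "dual_dif (can.dual_lact e \<phi>) = can.dual_lact (delbar C e) \<phi> + (-1) ^ i *\<^sub>C can.dual_lact e (dual_dif \<phi>)"
      if "e \<in> bforms C 0 i" "\<phi> \<in> can.dual" for i e \<phi> by (rule dual_dif_lact[OF that])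
    show "dual_dif (dual_dif \<phi>) = 0" if "\<phi> \<in> can.dual" for \<phi> by (rule dual_dif_dif[OF that])
    show "dual_coact (can.dual_lact e \<phi>) = tensor_prod (dolb C) can.dual can.dual_lact (coact C e) (dual_coact \<phi>)"
      if "e \<in> dolb C" "\<phi> \<in> can.dual" for e \<phi> by (rule dual_coact_lact[OF that])
    show "dual_coact (dual_dif \<phi>) = tensor_lift_on UNIV can.dual (\<lambda>a y. a \<otimes> dual_dif y) (dual_coact \<phi>)"
      if "\<phi> \<in> can.dual" for \<phi> by (rule dual_coact_dif[OF that])
  qed (simp_all add: dual_dsum D.l_bilin dual_lact_hdual D.l_one D.l_mult dual_dif_lin dual_dif_hdual
        dual_comodule dual_coact_hdual)
qed

lemma dual_dg_bimodule: "comodule_dg_bimodule H C Y"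
proof -
  interpret D: sub_bimodule "dolb C" can.dual_lact can.dual_ract can.dual by (rule can.dual_sub_bimodule)
  show ?thesis
    unfolding comodule_dg_bimodule_def Y_simps
  proof (intro conjI allI ballI)
    show "dual_coact (can.dual_ract \<phi> e) = tensor_prod can.dual (dolb C) can.dual_ract (dual_coact \<phi>) (coact C e)"
      if "e \<in> dolb C" "\<phi> \<in> can.dual" for e \<phi> by (rule dual_coact_ract[OF that])
  qed (simp_all add: dual_left_dg_module D.r_bilin dual_ract_hdual D.r_one D.r_mult D.l_r dual_dif_ract)
qed

lemma Y_is_dual: "is_dual H C X Y"
proof -
  have dif: "delbar C (\<phi> \<alpha>) = \<phi> (delbar C \<alpha>) + (-1) ^ j *\<^sub>C dual_dif \<phi> \<alpha>"
    if "\<phi> \<in> can.dual" "\<alpha> \<in> bforms C n j" for \<phi> j \<alpha>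
    by (simp add: dual_dif_bforms[OF that] scaleC_scaleC power_add[symmetric] scaleC_one)
  have co: "tensor_lift_on UNIV can.dual (\<lambda>a \<psi>. a \<otimes> \<psi> \<alpha>) (dual_coact \<phi>) =
      tensor_lift_on UNIV (row n) (\<lambda>a \<alpha>'. tensor_lift (\<lambda>b e. (antipode H a * b) \<otimes> e) (coact C (\<phi> \<alpha>'))) (coact C \<alpha>)"
    if \<phi>: "\<phi> \<in> can.dual" and \<alpha>: "\<alpha> \<in> row n" for \<phi> \<alpha>
  proof -
    have b1: "cbilin (\<lambda>b z. b \<otimes> ev z \<alpha>)" by (intro clin_intros)
    have b2: "cbilin (\<lambda>a x. tensor_lift (\<lambda>b y. (antipode H a * b) \<otimes> y) (act ev (dual_coact \<phi>) x))"
      by (intro clin_intros)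
    have "tensor_lift_on UNIV can.dual (\<lambda>a \<psi>. a \<otimes> \<psi> \<alpha>) (dual_coact \<phi>) = tensor_lift (\<lambda>b z. b \<otimes> ev z \<alpha>) (dual_coact \<phi>)"
      by (rule tensor_lift_on_eq[OF cvec.subspace_UNIV can.dual_sub dual_coact_mem[OF \<phi>] b1]) (simp add: ev_eq \<alpha>)
    also have "\<dots> = tensor_lift (\<lambda>a x. tensor_lift (\<lambda>b y. (antipode H a * b) \<otimes> y) (act ev (dual_coact \<phi>) x)) (coact C \<alpha>)"
      by (rule act_cancel[OF ev_cbilin, symmetric])
    also have "\<dots> = tensor_lift_on UNIV (row n) (\<lambda>a \<alpha>'. tensor_lift (\<lambda>b e. (antipode H a * b) \<otimes> e) (coact C (\<phi> \<alpha>'))) (coact C \<alpha>)"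
      by (rule tensor_lift_on_eq[OF cvec.subspace_UNIV row_sub row_coact[OF \<alpha>] b2, symmetric])
         (simp add: act_dual_coact[OF \<phi>])
    finally show ?thesis .
  qed
  show ?thesis
    unfolding is_dual_def X_simps Y_simps
    using dif co dual_coact_mem dual_dif_mem
    by (auto simp: hdual_def can.dual_lact_def can.dual_ract_def)
qed

end

section \<open>Holomorphic top forms as an invertible bimodule\<close>

locale kaehler_factorisable = canonical H K n
  for H :: "('a::complex_algebra_1) hopf" and K :: "('a, 'w::complex_algebra_1) kaehler" and n :: nat +
  assumes kaehler: "kaehler_structure H n K" and fact: "factorisable K"
begin

abbreviation M where "M \<equiv> forms K 0"
abbreviation P where "P \<equiv> bforms K n 0"
abbreviation Q where "Q \<equiv> bforms K 0 n"

definition \<kappa> where "\<kappa> = kform K ^ n"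

lemma kform_mem: "kform K \<in> bforms K 1 1" and kform_central: "kform K * \<omega> = \<omega> * kform K"
  and kform_coact: "coact K (kform K) = 1 \<otimes> kform K"
  using kaehler unfolding kaehler_structure_def by blast+

lemma \<kappa>_power_mem: "kform K ^ j \<in> bforms K j j"
proof (induction j)
  case 0
  then show ?case using one_form by (simp add: forms_zero)
next
  case (Suc j)
  then show ?case using mult_bforms[OF kform_mem Suc] by simp
qed

lemma \<kappa>_mem: "\<kappa> \<in> bforms K n n"
  unfolding \<kappa>_def by (rule \<kappa>_power_mem)

lemma \<kappa>_central: "\<kappa> * \<omega> = \<omega> * \<kappa>"
proof -
  have "kform K ^ j * \<omega> = \<omega> * kform K ^ j" for j
  proof (induction j)
    case (Suc j)
    have "kform K ^ Suc j * \<omega> = kform K * (\<omega> * kform K ^ j)" by (simp add: mult.assoc Suc)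
    also have "\<dots> = \<omega> * kform K * kform K ^ j" by (simp only: kform_central[of \<omega>] mult.assoc[symmetric])
    finally show ?case by (simp add: mult.assoc)
  qed simp
  then show ?thesis by (simp add: \<kappa>_def)
qed

lemma coact_\<kappa>: "coact K \<kappa> = 1 \<otimes> \<kappa>"
proof -
  have p: "tensor_prod UNIV UNIV (*) (a \<otimes> v) (b \<otimes> w) = (a * b) \<otimes> (v * w)" for a b :: 'a and v w :: 'w
  proof -
    have 1: "cbilin (\<lambda>a v. (a * b) \<otimes> (v * w))" by (intro clin_intros)
    have 2: "cbilin (\<lambda>b w. (a * b) \<otimes> (v * w))" for a :: 'a and v :: 'w by (intro clin_intros)
    show ?thesis unfolding tensor_prod_def tensor_lift_tens[OF 2] tensor_lift_tens[OF 1] ..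
  qed
  have "coact K (kform K ^ j) = 1 \<otimes> kform K ^ j" for j
    by (induction j) (simp_all add: coact_one coact_mult kform_coact p)
  then show ?thesis by (simp add: \<kappa>_def)
qed

lemma M_bforms: "M = bforms K 0 0"
  by (rule forms_zero)

text \<open>The image of the Lefschetz isomorphism in degree zero is \<open>\<kappa> M\<close> and lies in bidegree \<open>(n,n)\<close>, so there are no
  other top forms.\<close>

lemma \<kappa>_bij: "bij_betw ((*) \<kappa>) M (bforms K n n)"
proof -
  have "(lefschetz K ^^ j) \<omega> = kform K ^ j * \<omega>" for j \<omega>
    by (induction j) (simp_all add: lefschetz_def mult.assoc)
  then have L: "(lefschetz K ^^ n) = (*) \<kappa>" by (simp add: \<kappa>_def fun_eq_iff)
  have b: "bij_betw ((*) \<kappa>) M (forms K (2 * n))"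
  proof (cases "n = 0")
    \<comment> \<open>The Lefschetz isomorphisms are required in degrees below \<open>n\<close> only.\<close>
    case True
    have one: "\<kappa> = 1" unfolding \<kappa>_def using True by simp
    show ?thesis unfolding one using True by (simp add: bij_betw_def inj_on_def)
  next
    case False
    then have "bij_betw (lefschetz K ^^ (n - 0)) (forms K 0) (forms K (2 * n - 0))"
      using kaehler unfolding kaehler_structure_def by blast
    then show ?thesis using L by simp
  qed
  have "(*) \<kappa> ` M \<subseteq> bforms K n n"
    using mult_bforms[OF \<kappa>_mem, of _ 0 0] by (auto simp: M_bforms)
  moreover have "bforms K n n \<subseteq> forms K (2 * n)"
    using bforms_forms[of _ n n] by (auto simp: mult_2)
  ultimately show ?thesis using b by (auto simp: bij_betw_def)
qed

text \<open>Division by \<open>\<kappa>\<close>; up to a scalar it is the trivialisation \<open>vol\<close> of the top forms. The projection to bidegree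
  \<open>(n,n)\<close> makes it linear on all forms.\<close>

definition \<tau> :: "'w \<Rightarrow> 'w" where "\<tau> \<omega> = inv_into M ((*) \<kappa>) (bcomp n n \<omega>)"

lemma \<tau>_mem: "\<tau> \<omega> \<in> M" and \<kappa>_\<tau>: "\<kappa> * \<tau> \<omega> = bcomp n n \<omega>"
  using bij_betw_inv_into[OF \<kappa>_bij] bij_betw_inv_into_right[OF \<kappa>_bij bcomp_mem] bcomp_mem
  by (auto simp: \<tau>_def bij_betw_def)

lemma \<kappa>_\<tau>_in: "\<omega> \<in> bforms K n n \<Longrightarrow> \<kappa> * \<tau> \<omega> = \<omega>"
  by (simp add: \<kappa>_\<tau> bcomp_in)

lemma \<kappa>_inj: "x \<in> M \<Longrightarrow> y \<in> M \<Longrightarrow> \<kappa> * x = \<kappa> * y \<Longrightarrow> x = y"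
  using \<kappa>_bij by (auto simp: bij_betw_def inj_on_def)

lemma M_add: "x \<in> M \<Longrightarrow> y \<in> M \<Longrightarrow> x + y \<in> M"
  by (rule cvec.subspace_add[OF forms_sub])

lemma M_mult: "x \<in> M \<Longrightarrow> y \<in> M \<Longrightarrow> x * y \<in> M"
  using mult_forms[of x 0 y 0] by simp

lemma \<tau>_eqI: "x \<in> M \<Longrightarrow> \<kappa> * x = bcomp n n \<omega> \<Longrightarrow> \<tau> \<omega> = x"
  by (rule \<kappa>_inj[OF \<tau>_mem]) (simp_all add: \<kappa>_\<tau>)

lemma \<tau>_clin: "clin \<tau>"
  by (rule clinear_onI; rule \<tau>_eqI)
     (simp_all add: M_add \<tau>_mem cvec.subspace_scale[OF forms_sub] distrib_left \<kappa>_\<tau> clin_add[OF bcomp_clin]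
       clin_scale[OF bcomp_clin] mult_scaleC_right)

lemma clin_\<tau> [clin_intros]: "clin f \<Longrightarrow> clin (\<lambda>x. \<tau> (f x))"
  by (rule clin_compose[OF \<tau>_clin])

lemma M_bforms_left: "m \<in> M \<Longrightarrow> x \<in> bforms K a b \<Longrightarrow> m * x \<in> bforms K a b"
  using mult_bforms[of m 0 0 x a b] by (simp add: M_bforms)

lemma M_bforms_right: "x \<in> bforms K a b \<Longrightarrow> m \<in> M \<Longrightarrow> x * m \<in> bforms K a b"
  using mult_bforms[of x a b m 0 0] by (simp add: M_bforms)

lemma \<tau>_left:
  assumes "m \<in> M" "\<omega> \<in> bforms K n n"
  shows "\<tau> (m * \<omega>) = m * \<tau> \<omega>"
proof (rule \<tau>_eqI)
  show "m * \<tau> \<omega> \<in> M" by (simp add: M_mult \<tau>_mem assms)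
  have "\<kappa> * (m * \<tau> \<omega>) = m * \<kappa> * \<tau> \<omega>" by (simp only: mult.assoc[symmetric] \<kappa>_central[of m])
  then show "\<kappa> * (m * \<tau> \<omega>) = bcomp n n (m * \<omega>)"
    by (simp add: mult.assoc \<kappa>_\<tau>_in assms bcomp_in[OF M_bforms_left[OF assms]])
qed

lemma \<tau>_right:
  assumes "m \<in> M" "\<omega> \<in> bforms K n n"
  shows "\<tau> (\<omega> * m) = \<tau> \<omega> * m"
  by (rule \<tau>_eqI)
     (simp_all add: M_mult \<tau>_mem assms bcomp_in[OF M_bforms_right[OF assms(2,1)]] mult.assoc[symmetric] \<kappa>_\<tau>_in)

lemma \<tau>_\<kappa>: "m \<in> M \<Longrightarrow> \<tau> (\<kappa> * m) = m"
  by (rule \<tau>_eqI) (simp_all add: bcomp_in[OF M_bforms_right[OF \<kappa>_mem]])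

lemma \<tau>_\<kappa>_one: "\<tau> \<kappa> = 1"
  using \<tau>_\<kappa>[OF one_form] by simp

lemma PQ_mem: "p \<in> P \<Longrightarrow> q \<in> Q \<Longrightarrow> p * q \<in> bforms K n n" and QP_mem: "p \<in> P \<Longrightarrow> q \<in> Q \<Longrightarrow> q * p \<in> bforms K n n"
  using mult_bforms[of p n 0 q 0 n] mult_bforms[of q 0 n p n 0] by simp_all

lemma balanced_bforms: "balanced_data M (*) (bforms K a b) (*) (bforms K c d)"
  by unfold_locales (simp_all add: bforms_sub M_bforms_left M_bforms_right)

lemma iso_PQ: "tensor_iso M (*) P (*) Q (*) (bforms K n n)" and iso_QP: "tensor_iso M (*) Q (*) P (*) (bforms K n n)"
  using fact by (simp_all add: factorisable_def)

sublocale PQ: balanced_data M "(*)" P "(*)" Q by (rule balanced_bforms)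
sublocale QP: balanced_data M "(*)" Q "(*)" P by (rule balanced_bforms)

lemma P_sub: "csubspace P" and Q_sub: "csubspace Q" by (rule bforms_sub)+

end

text \<open>Expansions of \<open>\<kappa>\<close> according to the two factorisations of \<open>\<Omega>\<^bsup>(n,n)\<^esup>\<close>. Since \<open>\<tau> \<kappa> = 1\<close>, they show that both
  pairings of \<open>P\<close> and \<open>Q\<close> are onto.\<close>

locale kaehler_bases = kaehler_factorisable H K n
  for H :: "('a::complex_algebra_1) hopf" and K :: "('a, 'w::complex_algebra_1) kaehler" and n :: nat +
  fixes N1 :: nat and p1 q1 :: "nat \<Rightarrow> 'w" and N2 :: nat and q2 p2 :: "nat \<Rightarrow> 'w"
  assumes p1: "i < N1 \<Longrightarrow> p1 i \<in> P" and q1: "i < N1 \<Longrightarrow> q1 i \<in> Q" and sum1: "\<kappa> = (\<Sum>i<N1. p1 i * q1 i)"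
    and q2: "i < N2 \<Longrightarrow> q2 i \<in> Q" and p2: "i < N2 \<Longrightarrow> p2 i \<in> P" and sum2: "\<kappa> = (\<Sum>i<N2. q2 i * p2 i)"
begin

text \<open>There are two contractions of \<open>P \<otimes> Q \<otimes> P\<close> to \<open>P\<close>, namely \<open>\<tau>(p q) p'\<close> and \<open>p \<tau>(q p')\<close>. The map \<open>shift\<close> inserts the
  second expansion of \<open>\<kappa>\<close> and contracts on the left, that is, it expresses the first contraction in terms of
  the second; \<open>unshift\<close> does the opposite.\<close>

definition shift :: "'w \<Rightarrow> 'w" where "shift p = (\<Sum>i<N2. \<tau> (p * q2 i) * p2 i)"
definition unshift :: "'w \<Rightarrow> 'w" where "unshift p = (\<Sum>i<N1. p1 i * \<tau> (q1 i * p))"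

lemma trace1: "(\<Sum>i<N1. \<tau> (p1 i * q1 i)) = 1"
  using clin_sum[OF \<tau>_clin, of "\<lambda>i. p1 i * q1 i" "{..<N1}"] by (simp add: sum1[symmetric] \<tau>_\<kappa>_one)

lemma trace2: "(\<Sum>i<N2. \<tau> (q2 i * p2 i)) = 1"
  using clin_sum[OF \<tau>_clin, of "\<lambda>i. q2 i * p2 i" "{..<N2}"] by (simp add: sum2[symmetric] \<tau>_\<kappa>_one)

lemma shift_mem: "p \<in> P \<Longrightarrow> shift p \<in> P" and unshift_mem: "p \<in> P \<Longrightarrow> unshift p \<in> P"
  unfolding shift_def unshift_def
  by (rule cvec.subspace_sum[OF P_sub], simp add: M_bforms_left M_bforms_right \<tau>_mem p1 p2)+

lemma shift_clin: "clin shift"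
  unfolding shift_def by (intro clin_sum_fun clin_intros)

text \<open>For fixed \<open>p\<close> the assignment \<open>q p' \<mapsto> \<tau>(p q) p'\<close> is a well defined and right linear map \<open>g\<close> on
  \<open>\<Omega>\<^bsup>(n,n)\<^esup>\<close>, and \<open>q p' = \<kappa> \<tau>(q p')\<close>.\<close>

lemma shift_\<tau>:
  assumes p: "p \<in> P" and p': "p' \<in> P" and q: "q \<in> Q"
  shows "shift p * \<tau> (q * p') = \<tau> (p * q) * p'"
proof -
  have "QP.balanced_map (\<lambda>q p'. \<tau> (p * q) * p')"
    unfolding QP.balanced_map_def
  proof (intro conjI ballI)
    fix q m p' assume "q \<in> Q" "m \<in> M" "p' \<in> P"
    then show "\<tau> (p * (q * m)) * p' = \<tau> (p * q) * (m * p')"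
      using \<tau>_right[OF \<open>m \<in> M\<close> PQ_mem[OF p \<open>q \<in> Q\<close>]] by (simp add: mult.assoc)
  qed (rule cbilin_on, intro clin_intros)
  from QP.tensor_iso_factor[OF iso_QP this]
  obtain g where g: "clinear_on (bforms K n n) g" and gm: "\<And>q p'. q \<in> Q \<Longrightarrow> p' \<in> P \<Longrightarrow> g (q * p') = \<tau> (p * q) * p'"
    by blast
  have gr: "g (\<omega> * m) = g \<omega> * m" if "m \<in> M" "\<omega> \<in> bforms K n n" for m \<omega>
    using iso_QP that(2)
  proof (induction rule: QP.tensor_iso_induct)
    case zero
    then show ?case by (simp add: clinear_on_zero[OF g bforms_sub])
  next
    case (add x y)
    then show ?case using that(1) by (simp add: distrib_right clinear_on_add[OF g] M_bforms_right)
  next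
    case (mult q p')
    then show ?case using that(1) by (simp add: mult.assoc gm M_bforms_right)
  qed
  have "g \<kappa> = shift p"
    unfolding sum2 shift_def using q2 p2
    by (subst clinear_on_sum[OF g bforms_sub]) (simp_all add: QP_mem gm)
  then have "shift p * \<tau> (q * p') = g (\<kappa> * \<tau> (q * p'))" by (simp add: gr \<tau>_mem \<kappa>_mem)
  also have "\<dots> = \<tau> (p * q) * p'" by (simp add: \<kappa>_\<tau>_in QP_mem p' q gm)
  finally show ?thesis .
qed

lemma \<tau>_unshift:
  assumes p: "p \<in> P" and p': "p' \<in> P" and q: "q \<in> Q"
  shows "\<tau> (p * q) * unshift p' = p * \<tau> (q * p')"
proof -
  have "PQ.balanced_map (\<lambda>p q. p * \<tau> (q * p'))"
    unfolding PQ.balanced_map_def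
  proof (intro conjI ballI)
    fix p m q assume "p \<in> P" "m \<in> M" "q \<in> Q"
    then show "p * m * \<tau> (q * p') = p * \<tau> (m * q * p')"
      using \<tau>_left[OF \<open>m \<in> M\<close> QP_mem[OF p' \<open>q \<in> Q\<close>]] by (simp add: mult.assoc)
  qed (rule cbilin_on, intro clin_intros)
  from PQ.tensor_iso_factor[OF iso_PQ this]
  obtain g where g: "clinear_on (bforms K n n) g" and gm: "\<And>p q. p \<in> P \<Longrightarrow> q \<in> Q \<Longrightarrow> g (p * q) = p * \<tau> (q * p')"
    by blast
  have gl: "g (m * \<omega>) = m * g \<omega>" if "m \<in> M" "\<omega> \<in> bforms K n n" for m \<omega>
    using iso_PQ that(2)
  proof (induction rule: PQ.tensor_iso_induct)
    case zero
    then show ?case by (simp add: clinear_on_zero[OF g bforms_sub])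
  next
    case (add x y)
    then show ?case using that(1) by (simp add: distrib_left clinear_on_add[OF g] M_bforms_left)
  next
    case (mult p q)
    then show ?case using that(1) by (simp add: mult.assoc[symmetric] gm M_bforms_left)
  qed
  have "g \<kappa> = unshift p'"
    unfolding sum1 unshift_def using q1 p1
    by (subst clinear_on_sum[OF g bforms_sub]) (simp_all add: PQ_mem gm)
  then have "\<tau> (p * q) * unshift p' = g (\<tau> (p * q) * \<kappa>)" by (simp add: gl \<tau>_mem \<kappa>_mem)
  also have "\<dots> = p * \<tau> (q * p')" by (simp add: \<kappa>_central[symmetric] \<kappa>_\<tau>_in PQ_mem p q gm)
  finally show ?thesis .
qed

lemma eq_by_trace1: "(\<And>i. i < N1 \<Longrightarrow> \<tau> (p1 i * q1 i) * x = \<tau> (p1 i * q1 i) * y) \<Longrightarrow> x = y"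
proof -
  assume "\<And>i. i < N1 \<Longrightarrow> \<tau> (p1 i * q1 i) * x = \<tau> (p1 i * q1 i) * y"
  then have "(\<Sum>i<N1. \<tau> (p1 i * q1 i)) * x = (\<Sum>i<N1. \<tau> (p1 i * q1 i)) * y"
    by (simp add: sum_distrib_right)
  then show ?thesis by (simp add: trace1)
qed

lemma eq_by_trace2: "(\<And>i. i < N2 \<Longrightarrow> x * \<tau> (q2 i * p2 i) = y * \<tau> (q2 i * p2 i)) \<Longrightarrow> x = y"
proof -
  assume "\<And>i. i < N2 \<Longrightarrow> x * \<tau> (q2 i * p2 i) = y * \<tau> (q2 i * p2 i)"
  then have "x * (\<Sum>i<N2. \<tau> (q2 i * p2 i)) = y * (\<Sum>i<N2. \<tau> (q2 i * p2 i))"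
    by (simp add: sum_distrib_left)
  then show ?thesis by (simp add: trace2)
qed

lemma shift_left: "m \<in> M \<Longrightarrow> p \<in> P \<Longrightarrow> shift (m * p) = m * shift p"
  unfolding shift_def by (simp add: sum_distrib_left mult.assoc \<tau>_left PQ_mem q2)

lemma unshift_right: "p \<in> P \<Longrightarrow> m \<in> M \<Longrightarrow> unshift (p * m) = unshift p * m"
proof -
  assume p: "p \<in> P" and m: "m \<in> M"
  have "\<tau> (q1 i * (p * m)) = \<tau> (q1 i * p) * m" if "i < N1" for i
    using \<tau>_right[OF m QP_mem[OF p q1[OF that]]] by (simp add: mult.assoc)
  then show ?thesis unfolding unshift_def by (simp add: sum_distrib_right mult.assoc)
qed

lemma shift_right:
  assumes "p \<in> P" "m \<in> M"
  shows "shift (p * m) = shift p * m"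
proof (rule eq_by_trace2)
  fix i assume i: "i < N2"
  have "shift (p * m) * \<tau> (q2 i * p2 i) = \<tau> (p * (m * q2 i)) * p2 i"
    using shift_\<tau>[OF M_bforms_right[OF assms] p2[OF i] q2[OF i]] by (simp add: mult.assoc)
  also have "\<dots> = shift p * \<tau> (m * q2 i * p2 i)"
    using shift_\<tau>[OF assms(1) p2[OF i] M_bforms_left[OF assms(2) q2[OF i]]] by simp
  also have "\<dots> = shift p * m * \<tau> (q2 i * p2 i)"
    using \<tau>_left[OF assms(2) QP_mem[OF p2[OF i] q2[OF i]]] by (simp add: mult.assoc)
  finally show "shift (p * m) * \<tau> (q2 i * p2 i) = shift p * m * \<tau> (q2 i * p2 i)" .
qed

text \<open>With \<open>[p, q] = \<tau>(p q)\<close>, linearity gives \<open>[p, q] shift(unshift p') = shift(p \<tau>(q p')) = shift(p) \<tau>(q p') = [p, q] p'\<close>,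
  and the elements \<open>[p, q]\<close> sum to \<open>1\<close>.\<close>

lemma shift_unshift:
  assumes "p \<in> P"
  shows "shift (unshift p) = p"
proof (rule eq_by_trace1)
  fix i assume i: "i < N1"
  have "\<tau> (p1 i * q1 i) * shift (unshift p) = shift (\<tau> (p1 i * q1 i) * unshift p)"
    by (simp add: shift_left \<tau>_mem unshift_mem assms)
  also have "\<dots> = shift (p1 i * \<tau> (q1 i * p))" by (simp add: \<tau>_unshift p1 q1 i assms)
  also have "\<dots> = shift (p1 i) * \<tau> (q1 i * p)" by (simp add: shift_right p1 i \<tau>_mem)
  also have "\<dots> = \<tau> (p1 i * q1 i) * p" by (simp add: shift_\<tau> p1 q1 i assms)
  finally show "\<tau> (p1 i * q1 i) * shift (unshift p) = \<tau> (p1 i * q1 i) * p" .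
qed

lemma unshift_left:
  assumes "m \<in> M" "p \<in> P"
  shows "unshift (m * p) = m * unshift p"
proof (rule eq_by_trace1)
  fix i assume i: "i < N1"
  have "\<tau> (p1 i * q1 i) * unshift (m * p) = p1 i * \<tau> (q1 i * m * p)"
    using \<tau>_unshift[OF p1[OF i] M_bforms_left[OF assms] q1[OF i]] by (simp add: mult.assoc)
  also have "\<dots> = \<tau> (p1 i * (q1 i * m)) * unshift p"
    using \<tau>_unshift[OF p1[OF i] assms(2) M_bforms_right[OF q1[OF i] assms(1)]] by simp
  also have "\<dots> = \<tau> (p1 i * q1 i) * (m * unshift p)"
    using \<tau>_right[OF assms(1) PQ_mem[OF p1[OF i] q1[OF i]]] by (simp add: mult.assoc)
  finally show "\<tau> (p1 i * q1 i) * unshift (m * p) = \<tau> (p1 i * q1 i) * (m * unshift p)" .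
qed

lemma unshift_shift:
  assumes "p \<in> P"
  shows "unshift (shift p) = p"
proof (rule eq_by_trace2)
  fix i assume i: "i < N2"
  have "unshift (shift p) * \<tau> (q2 i * p2 i) = unshift (shift p * \<tau> (q2 i * p2 i))" by (simp add: unshift_right shift_mem assms \<tau>_mem)
  also have "\<dots> = unshift (\<tau> (p * q2 i) * p2 i)" by (simp add: shift_\<tau> assms p2 q2 i)
  also have "\<dots> = \<tau> (p * q2 i) * unshift (p2 i)" by (simp add: unshift_left \<tau>_mem p2 i)
  also have "\<dots> = p * \<tau> (q2 i * p2 i)" by (simp add: \<tau>_unshift assms p2 q2 i)
  finally show "unshift (shift p) * \<tau> (q2 i * p2 i) = p * \<tau> (q2 i * p2 i)" .
qed

text \<open>The pairing of \<open>Q\<close> and \<open>P\<close> that is associative with \<open>\<tau>(p q)\<close>.\<close>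

definition copair :: "'w \<Rightarrow> 'w \<Rightarrow> 'w" where "copair q p = \<tau> (q * shift p)"

lemma copair_mem: "copair q p \<in> M"
  by (simp add: copair_def \<tau>_mem)

lemma clin_shift [clin_intros]: "clin form \<Longrightarrow> clin (\<lambda>x. shift (form x))"
  by (rule clin_compose[OF shift_clin])

lemma copair_assoc: "p \<in> P \<Longrightarrow> q \<in> Q \<Longrightarrow> p' \<in> P \<Longrightarrow> p * copair q p' = \<tau> (p * q) * p'"
  using \<tau>_unshift[of p "shift p'" q] by (simp add: copair_def shift_mem unshift_shift)

lemma copair_right: "q \<in> Q \<Longrightarrow> p \<in> P \<Longrightarrow> m \<in> M \<Longrightarrow> copair q (p * m) = copair q p * m"
  using \<tau>_right[of m "q * shift p"] by (simp add: copair_def shift_right QP_mem shift_mem mult.assoc)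

text \<open>With the functionals \<open>\<tau>(- q2 i)\<close> these are a dual basis of the left module \<open>P\<close>.\<close>

definition gen :: "nat \<Rightarrow> 'w" where "gen i = unshift (p2 i)"

lemma gen_mem: "i < N2 \<Longrightarrow> gen i \<in> P"
  by (simp add: gen_def unshift_mem p2)

lemma cotrace: "(\<Sum>i<N2. copair (q2 i) (gen i)) = 1"
  using trace2 by (simp add: copair_def gen_def shift_unshift p2)

lemma P_expansion: "p \<in> P \<Longrightarrow> (\<Sum>i<N2. \<tau> (p * q2 i) * gen i) = p"
proof -
  assume p: "p \<in> P"
  have "(\<Sum>i<N2. \<tau> (p * q2 i) * gen i) = (\<Sum>i<N2. p * copair (q2 i) (gen i))"
    by (simp add: copair_assoc p q2 gen_mem)
  then show ?thesis by (simp add: sum_distrib_left[symmetric] cotrace)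
qed

lemma rtwist_M: "m \<in> M \<Longrightarrow> rtwist x m = x * m"
  by (simp add: rtwist_def sign_twist_zero_form)

lemma P_bimodule: "sub_bimodule M (*) rtwist P"
proof
  show "cbilinear_on M P (*)" by (rule cbilin_on[OF mult_cbilin])
  show "cbilinear_on P M rtwist" by (rule cbilin_on[OF rtwist_cbilin])
qed (simp_all add: forms_sub P_sub one_form M_mult M_bforms_left M_bforms_right rtwist_M mult.assoc)

sublocale MP: sub_bimodule M "(*)" rtwist P by (rule P_bimodule)

definition form :: "'w \<Rightarrow> 'w \<Rightarrow> 'w" where "form q p = (if p \<in> P then \<tau> (p * q) else 0)"

lemma form_mem: "q \<in> Q \<Longrightarrow> form q \<in> MP.dual"
  by (rule MP.dualI)
     (simp_all add: form_def \<tau>_mem cvec.subspace_add[OF P_sub] distrib_right clin_add[OF \<tau>_clin] M_bforms_left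
       mult.assoc \<tau>_left PQ_mem)

text \<open>A left linear endomorphism \<open>g\<close> of \<open>P\<close> is right multiplication by \<open>\<Sum> \<langle>q\<^sub>i, g(gen\<^sub>i)\<rangle>\<close>, because
  \<open>p \<langle>q\<^sub>i, g(gen\<^sub>i)\<rangle> = \<tau>(p q\<^sub>i) g(gen\<^sub>i)\<close>.\<close>

lemma MP_invertible: "invertible_bimodule M (*) rtwist P {..<N1} p1 (\<lambda>i. form (q1 i))"
proof unfold_locales
  show "(\<Sum>i<N1. form (q1 i) (p1 i)) = 1" using trace1 by (simp add: form_def p1)
next
  fix g assume g: "clinear_on P g" "\<And>v. v \<in> P \<Longrightarrow> g v \<in> P" "\<And>a v. a \<in> M \<Longrightarrow> v \<in> P \<Longrightarrow> g (a * v) = a * g v"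
  define d where "d = (\<Sum>i<N2. copair (q2 i) (g (gen i)))"
  have d: "d \<in> M" unfolding d_def by (rule cvec.subspace_sum[OF forms_sub]) (rule copair_mem)
  have "g p = rtwist p d" if p: "p \<in> P" for p
  proof -
    have "p * d = (\<Sum>i<N2. \<tau> (p * q2 i) * g (gen i))"
      unfolding d_def by (simp add: sum_distrib_left copair_assoc p q2 gen_mem g(2))
    also have "\<dots> = g (\<Sum>i<N2. \<tau> (p * q2 i) * gen i)"
      by (subst clinear_on_sum[OF g(1) P_sub]) (simp_all add: g(3) \<tau>_mem gen_mem M_bforms_left)
    finally show ?thesis by (simp add: P_expansion p rtwist_M d)
  qed
  with d show "\<exists>d\<in>M. \<forall>v\<in>P. g v = rtwist v d" by blast
next
  fix d assume d: "d \<in> M" "\<And>v. v \<in> P \<Longrightarrow> rtwist v d = 0"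
  have "d = (\<Sum>i<N2. copair (q2 i) (gen i)) * d" by (simp add: cotrace)
  also have "\<dots> = (\<Sum>i<N2. copair (q2 i) (gen i * d))" by (simp add: sum_distrib_right copair_right q2 gen_mem d(1))
  also have "\<dots> = 0"
    using d(2)[OF gen_mem] by (intro sum.neutral) (simp add: rtwist_M[OF d(1)] copair_def clin_zero[OF shift_clin] clin_zero[OF \<tau>_clin])
  finally show "d = 0" .
qed (simp_all add: p1 form_mem q1)

lemma P_projective: "left_projective M (*) P"
  and P_finitely_generated: "finitely_generated_by M (*) (gen ` {..<N2}) P"
  using MP.dual_basis_projective[of "{..<N2}" "\<lambda>i. form (q2 i)" gen] P_expansion
  by (simp_all add: form_mem q2 gen_mem form_def)

end

section \<open>The canonical bundle is invertible\<close>

context kaehler_bases begin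

lemma dolb_M: "m \<in> M \<Longrightarrow> m \<in> dolb K"
  using bforms_row[of m 0 0] by (simp add: dolb_row M_bforms)

lemma P_row: "p \<in> P \<Longrightarrow> p \<in> row n"
  by (rule bforms_row)

sublocale DP: balanced_data M "(*)" "dolb K" "(*)" P
  by unfold_locales (simp_all add: dolb_sub P_sub dolb_mult dolb_M M_bforms_left)

sublocale PD: balanced_data M "(*)" P "(*)" "dolb K"
  by unfold_locales (simp_all add: dolb_sub P_sub dolb_mult dolb_M M_bforms_right)

lemma iso_DP: "tensor_iso M (*) (dolb K) (*) P (*) (row n)"
  unfolding row_def
proof (rule tensor_iso_direct_sum[where V' = "bforms K 0" and W' = "\<lambda>_. P" and pr = "bcomp n"])
  show "tensor_iso M (*) (bforms K 0 b) (*) P (*) (bforms K n b)" for b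
    using fact by (simp add: factorisable_def)
  show "bforms K 0 b \<subseteq> dolb K" for b using bforms_row by (auto simp: dolb_row)
  show "v * w \<in> cspan (\<Union>b. bforms K n b)" if "v \<in> dolb K" "w \<in> P" for v w
    using can.l_mem[OF that(1) P_row[OF that(2)]] by (simp add: row_def)
  show "\<exists>B s. finite B \<and> (\<forall>b\<in>B. s b \<in> tspan (bforms K 0 b) P) \<and> t = (\<Sum>b\<in>B. s b)"
    if "t \<in> tspan (dolb K) P" for t
    by (rule tspan_cspan_left[OF bforms_sub P_sub]) (use that in \<open>simp add: dolb_def\<close>)
  show "balanced_data M (*) (dolb K) (*) P" by (rule DP.balanced_data_axioms)
qed (auto simp: balanced_bforms cbilin_on[OF mult_cbilin] mult.assoc bcomp_clin bcomp_in)

lemma iso_PD: "tensor_iso M (*) P (*) (dolb K) (*) (row n)"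
  unfolding row_def
proof (rule tensor_iso_direct_sum[where W' = "bforms K 0" and V' = "\<lambda>_. P" and pr = "bcomp n"])
  show "tensor_iso M (*) P (*) (bforms K 0 b) (*) (bforms K n b)" for b
    using fact by (simp add: factorisable_def)
  show "bforms K 0 b \<subseteq> dolb K" for b using bforms_row by (auto simp: dolb_row)
  show "v * w \<in> cspan (\<Union>b. bforms K n b)" if "v \<in> P" "w \<in> dolb K" for v w
    using row_mult[OF P_row[OF that(1)], of w 0] that(2) by (simp add: row_def dolb_row)
  show "\<exists>B s. finite B \<and> (\<forall>b\<in>B. s b \<in> tspan P (bforms K 0 b)) \<and> t = (\<Sum>b\<in>B. s b)"
    if "t \<in> tspan P (dolb K)" for t
    by (rule tspan_cspan_right[OF bforms_sub P_sub]) (use that in \<open>simp add: dolb_def\<close>)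
  show "balanced_data M (*) P (*) (dolb K)" by (rule PD.balanced_data_axioms)
qed (auto simp: balanced_bforms cbilin_on[OF mult_cbilin] mult.assoc bcomp_clin bcomp_in)

lemma row_eqI:
  assumes "clinear_on (row n) g" "clinear_on (row n) g'" "\<And>e p. e \<in> dolb K \<Longrightarrow> p \<in> P \<Longrightarrow> g (e * p) = g' (e * p)"
    "x \<in> row n"
  shows "g x = g' x"
  using iso_DP assms(4)
  by (induction rule: DP.tensor_iso_induct)
     (simp_all add: clinear_on_zero[OF assms(1) row_sub] clinear_on_zero[OF assms(2) row_sub]
       clinear_on_add[OF assms(1)] clinear_on_add[OF assms(2)] assms(3))

text \<open>The left \<open>D\<close>-linear extension of \<open>form q\<close> from \<open>P\<close> to \<open>D \<otimes>\<^sub>M P\<close>, which is row \<open>n\<close>.\<close>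

definition contract :: "'w \<Rightarrow> 'w \<Rightarrow> 'w"
  where "contract q = (SOME g. clinear_on (row n) g \<and> (\<forall>e\<in>dolb K. \<forall>p\<in>P. g (e * p) = e * \<tau> (p * q)))"

definition ext_form :: "'w \<Rightarrow> 'w \<Rightarrow> 'w" where "ext_form q x = (if x \<in> row n then contract q x else 0)"

lemma
  assumes q: "q \<in> Q"
  shows contract_lin: "clinear_on (row n) (contract q)"
    and contract_mult: "e \<in> dolb K \<Longrightarrow> p \<in> P \<Longrightarrow> contract q (e * p) = e * \<tau> (p * q)"
proof -
  have "DP.balanced_map (\<lambda>e p. e * \<tau> (p * q))"
    unfolding DP.balanced_map_def
  proof (intro conjI ballI)
    fix e m p assume "e \<in> dolb K" "m \<in> M" "p \<in> P"
    then show "e * m * \<tau> (p * q) = e * \<tau> (m * p * q)"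
      using \<tau>_left[OF \<open>m \<in> M\<close> PQ_mem[OF \<open>p \<in> P\<close> q]] by (simp add: mult.assoc)
  qed (rule cbilin_on, intro clin_intros)
  from DP.tensor_iso_factor[OF iso_DP this]
  have "clinear_on (row n) (contract q) \<and> (\<forall>e\<in>dolb K. \<forall>p\<in>P. contract q (e * p) = e * \<tau> (p * q))"
    unfolding contract_def by (rule someI_ex)
  then show "clinear_on (row n) (contract q)" "e \<in> dolb K \<Longrightarrow> p \<in> P \<Longrightarrow> contract q (e * p) = e * \<tau> (p * q)"
    by auto
qed

lemma ext_form_mult: "q \<in> Q \<Longrightarrow> e \<in> dolb K \<Longrightarrow> p \<in> P \<Longrightarrow> ext_form q (e * p) = e * \<tau> (p * q)"
  by (simp add: ext_form_def contract_mult can.l_mem P_row)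

lemma ext_form_P: "q \<in> Q \<Longrightarrow> p \<in> P \<Longrightarrow> ext_form q p = \<tau> (p * q)"
  using ext_form_mult[of q 1 p] one_dolb by simp

lemma ext_form_lin: "q \<in> Q \<Longrightarrow> clinear_on (row n) (ext_form q)"
  by (rule clinear_onI)
     (simp_all add: ext_form_def cvec.subspace_add[OF row_sub] cvec.subspace_scale[OF row_sub]
       clinear_on_add[OF contract_lin] clinear_on_scale[OF contract_lin])

lemma ext_form_dual:
  assumes q: "q \<in> Q"
  shows "ext_form q \<in> can.dual"
proof (rule can.dualI)
  note lin = ext_form_lin[OF q]
  show "ext_form q x \<in> dolb K" if "x \<in> row n" for x
    using iso_DP that
    by (induction rule: DP.tensor_iso_induct)
       (simp_all add: clinear_on_zero[OF lin row_sub] cvec.subspace_0[OF dolb_sub] clinear_on_add[OF lin]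
         cvec.subspace_add[OF dolb_sub] ext_form_mult q dolb_mult dolb_M \<tau>_mem)
  show "ext_form q (x + y) = ext_form q x + ext_form q y" if "x \<in> row n" "y \<in> row n" for x y by (rule clinear_on_add[OF lin that])
  show "ext_form q (a * x) = a * ext_form q x" if a: "a \<in> dolb K" and x: "x \<in> row n" for a x
    using iso_DP x
  proof (induction rule: DP.tensor_iso_induct)
    case (mult e p)
    then show ?case using a by (simp add: ext_form_mult q mult.assoc[symmetric] dolb_mult)
  qed (use a in \<open>simp_all add: clinear_on_zero[OF lin row_sub] clinear_on_add[OF lin] distrib_left can.l_mem\<close>)
qed (simp add: ext_form_def)

lemma ext_form_hdual:
  assumes q: "q \<in> Q"
  shows "ext_form q \<in> hdual 0"
proof -
  have "ext_form q \<alpha> \<in> bforms K 0 j" if "\<alpha> \<in> bforms K n j" for j \<alpha>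
  proof -
    interpret B: balanced_data M "(*)" "bforms K 0 j" "(*)" P by (rule balanced_bforms)
    have "tensor_iso M (*) (bforms K 0 j) (*) P (*) (bforms K n j)" using fact by (simp add: factorisable_def)
    then show ?thesis using that
    proof (induction rule: B.tensor_iso_induct)
      case zero
      then show ?case by (simp add: clinear_on_zero[OF ext_form_lin[OF q] row_sub] cvec.subspace_0[OF bforms_sub])
    next
      case (add x y)
      then show ?case by (simp add: clinear_on_add[OF ext_form_lin[OF q]] bforms_row cvec.subspace_add[OF bforms_sub])
    next
      case (mult e p)
      then have "e \<in> dolb K" using bforms_row[of e 0 j] by (simp add: dolb_row)
      then show ?case using mult by (simp add: ext_form_mult q M_bforms_right \<tau>_mem)
    qed
  qed
  then show ?thesis using ext_form_dual[OF q] by (simp add: hdual_def)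
qed

lemma ext_form_clin: "clinear_on Q ext_form"
proof (rule clinear_onI)
  fix q q' c assume q: "q \<in> Q"
  show "ext_form (q + q') = ext_form q + ext_form q'" if q': "q' \<in> Q"
  proof (rule can.dual_eqI[OF ext_form_dual[OF cvec.subspace_add[OF Q_sub q q']] cvec.subspace_add[OF can.dual_sub ext_form_dual[OF q] ext_form_dual[OF q']]])
    have l: "clinear_on (row n) (ext_form q + ext_form q')"
      by (rule can.dual_clinear[OF cvec.subspace_add[OF can.dual_sub ext_form_dual[OF q] ext_form_dual[OF q']]])
    show "ext_form (q + q') x = (ext_form q + ext_form q') x" if "x \<in> row n" for x
      by (rule row_eqI[OF ext_form_lin[OF cvec.subspace_add[OF Q_sub q q']] l _ that])
         (simp add: ext_form_mult q q' cvec.subspace_add[OF Q_sub] distrib_left clin_add[OF \<tau>_clin])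
  qed
  show "ext_form (c *\<^sub>C q) = c *\<^sub>C ext_form q"
  proof (rule can.dual_eqI[OF ext_form_dual[OF cvec.subspace_scale[OF Q_sub q]] cvec.subspace_scale[OF can.dual_sub ext_form_dual[OF q]]])
    have l: "clinear_on (row n) (c *\<^sub>C ext_form q)"
      by (rule can.dual_clinear[OF cvec.subspace_scale[OF can.dual_sub ext_form_dual[OF q]]])
    show "ext_form (c *\<^sub>C q) x = (c *\<^sub>C ext_form q) x" if "x \<in> row n" for x
      by (rule row_eqI[OF ext_form_lin[OF cvec.subspace_scale[OF Q_sub q]] l _ that])
         (simp add: ext_form_mult q cvec.subspace_scale[OF Q_sub] mult_scaleC_right clin_scale[OF \<tau>_clin] scaleC_fun_def)
  qed
qed

lemma row_expansion:
  assumes "x \<in> row n"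
  shows "(\<Sum>i<N2. ext_form (q2 i) x * gen i) = x"
proof (rule row_eqI[OF _ _ _ assms])
  show "clinear_on (row n) (\<lambda>x. \<Sum>i<N2. ext_form (q2 i) x * gen i)"
    by (rule clinear_onI)
       (simp_all add: clinear_on_add[OF ext_form_lin] clinear_on_scale[OF ext_form_lin] q2 distrib_right sum.distrib
         mult_scaleC_left cvec.scale_sum_right)
  show "clinear_on (row n) (\<lambda>x. x)" by (simp add: clinear_on_def)
  fix e p assume "e \<in> dolb K" "p \<in> P"
  then have "(\<Sum>i<N2. ext_form (q2 i) (e * p) * gen i) = e * (\<Sum>i<N2. \<tau> (p * q2 i) * gen i)"
    by (simp add: ext_form_mult q2 sum_distrib_left mult.assoc)
  then show "(\<Sum>i<N2. ext_form (q2 i) (e * p) * gen i) = e * p" by (simp add: P_expansion \<open>p \<in> P\<close>)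
qed

sublocale basis: canonical_dual_basis H K n "{..<N2}" gen "\<lambda>i. ext_form (q2 i)"
  by unfold_locales (simp_all add: gen_mem ext_form_hdual q2 row_expansion)

text \<open>The right \<open>D\<close>-linear extension of \<open>copair q\<close> from \<open>P\<close> to \<open>P \<otimes>\<^sub>M D\<close>, which is row \<open>n\<close> as well. It inherits
  associativity with \<open>\<tau>(p q)\<close>.\<close>

lemma cocontract:
  assumes q: "q \<in> Q"
  shows "\<exists>g. clinear_on (row n) g \<and> (\<forall>p\<in>P. \<forall>e\<in>dolb K. g (p * e) = copair q p * e) \<and>
    (\<forall>x\<in>row n. g x \<in> dolb K \<and> (\<forall>p\<in>P. p * g x = \<tau> (p * q) * x))"
proof -
  have "PD.balanced_map (\<lambda>p e. copair q p * e)"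
    unfolding PD.balanced_map_def
  proof (intro conjI ballI)
    fix e m p assume "e \<in> dolb K" "m \<in> M" "p \<in> P"
    then show "copair q (p * m) * e = copair q p * (m * e)" by (simp add: copair_right q mult.assoc)
  qed (rule cbilin_on, unfold copair_def, intro clin_intros)
  from PD.tensor_iso_factor[OF iso_PD this]
  obtain g where g: "clinear_on (row n) g" and gm: "\<And>p e. p \<in> P \<Longrightarrow> e \<in> dolb K \<Longrightarrow> g (p * e) = copair q p * e"
    by blast
  have "g x \<in> dolb K \<and> (\<forall>p\<in>P. p * g x = \<tau> (p * q) * x)" if "x \<in> row n" for x
    using iso_PD that
  proof (induction rule: PD.tensor_iso_induct)
    case zero
    then show ?case by (simp add: clinear_on_zero[OF g row_sub] cvec.subspace_0[OF dolb_sub])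
  next
    case (add x y)
    then show ?case by (simp add: clinear_on_add[OF g] cvec.subspace_add[OF dolb_sub] distrib_left)
  next
    case (mult p e)
    then show ?case
      by (simp add: gm dolb_mult dolb_M copair_mem mult.assoc[symmetric] copair_assoc q)
  qed
  with g gm show ?thesis by blast
qed

text \<open>As for \<open>P\<close>, with \<open>copair\<close> replaced by its extension to row \<open>n\<close>. The right action contains \<open>sign_twist\<close>, which has
  to be undone to obtain the element that represents an endomorphism.\<close>

lemma D_invertible: "invertible_bimodule (dolb K) (*) rtwist (row n) {..<N1} p1 (\<lambda>i. ext_form (q1 i))"
proof unfold_locales
  show "(\<Sum>i<N1. ext_form (q1 i) (p1 i)) = 1" using trace1 by (simp add: ext_form_P p1 q1)
next
  fix g assume g: "clinear_on (row n) g" "\<And>v. v \<in> row n \<Longrightarrow> g v \<in> row n"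
    "\<And>a v. a \<in> dolb K \<Longrightarrow> v \<in> row n \<Longrightarrow> g (a * v) = a * g v"
  have "\<exists>\<theta>. \<forall>i<N2. \<forall>x\<in>row n. \<theta> i x \<in> dolb K \<and> (\<forall>p\<in>P. p * \<theta> i x = \<tau> (p * q2 i) * x)"
    using cocontract[OF q2] by metis
  then obtain \<theta> where \<theta>: "\<And>i x. i < N2 \<Longrightarrow> x \<in> row n \<Longrightarrow> \<theta> i x \<in> dolb K"
    "\<And>i x p. i < N2 \<Longrightarrow> x \<in> row n \<Longrightarrow> p \<in> P \<Longrightarrow> p * \<theta> i x = \<tau> (p * q2 i) * x" by blast
  \<comment> \<open>the analogue of \<open>\<Sum> \<langle>q\<^sub>i, g(gen\<^sub>i)\<rangle>\<close>, up to the sign in the right action\<close>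
  define d where "d = (\<Sum>i<N2. \<theta> i (g (gen i)))"
  have d: "d \<in> dolb K" unfolding d_def
    by (rule cvec.subspace_sum[OF dolb_sub]) (simp add: \<theta>(1) g(2) P_row gen_mem)
  have p: "p * d = g p" if p: "p \<in> P" for p
  proof -
    have "p * d = (\<Sum>i<N2. \<tau> (p * q2 i) * g (gen i))"
      unfolding d_def by (simp add: sum_distrib_left \<theta>(2) p g(2) P_row gen_mem)
    also have "\<dots> = g (\<Sum>i<N2. \<tau> (p * q2 i) * gen i)"
      by (subst clinear_on_sum[OF g(1) row_sub]) (simp_all add: g(3) dolb_M \<tau>_mem P_row gen_mem can.l_mem)
    finally show ?thesis by (simp add: P_expansion p)
  qed
  have "g x = rtwist x (sign_twist n K d)" if "x \<in> row n" for x
  proof (rule row_eqI[OF g(1) _ _ that])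
    show "clinear_on (row n) (\<lambda>x. rtwist x (sign_twist n K d))"
      by (rule clin_on) (intro clin_intros)
    show "g (e * p) = rtwist (e * p) (sign_twist n K d)" if "e \<in> dolb K" "p \<in> P" for e p
      using that by (simp add: g(3) P_row rtwist_def sign_twist_twist mult.assoc \<open>\<And>p. p \<in> P \<Longrightarrow> p * d = g p\<close>)
  qed
  moreover have "sign_twist n K d \<in> dolb K" using sign_twist_row[of d 0] d by (simp add: dolb_row)
  ultimately show "\<exists>d\<in>dolb K. \<forall>v\<in>row n. g v = rtwist v d" by blast
next
  fix d assume d: "d \<in> dolb K" "\<And>v. v \<in> row n \<Longrightarrow> rtwist v d = 0"
  have s: "sign_twist n K d \<in> dolb K" using sign_twist_row[of d 0] d(1) by (simp add: dolb_row)
  have "copair (q2 i) (gen i) * sign_twist n K d = 0" if i: "i < N2" for i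
  proof -
    obtain g where g: "clinear_on (row n) g" "\<And>p e. p \<in> P \<Longrightarrow> e \<in> dolb K \<Longrightarrow> g (p * e) = copair (q2 i) p * e"
      using cocontract[OF q2[OF i]] by blast
    have "copair (q2 i) (gen i) * sign_twist n K d = g (rtwist (gen i) d)"
      by (simp add: g(2) gen_mem i s rtwist_def)
    also have "\<dots> = 0" by (simp add: d(2) P_row gen_mem i clinear_on_zero[OF g(1) row_sub])
    finally show ?thesis .
  qed
  then have "(\<Sum>i<N2. copair (q2 i) (gen i)) * sign_twist n K d = 0" by (simp add: sum_distrib_right)
  then have "sign_twist n K d = 0" by (simp add: cotrace)
  then show "d = 0" using sign_twist_twist[of n d] by (simp add: clin_zero[OF sign_twist_clin])
qed (simp_all add: p1 P_row ext_form_dual q1)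

text \<open>The form \<open>\<kappa>\<close> is coinvariant, so multiplication by it is equivariant.\<close>

lemma coact_\<tau>:
  assumes \<omega>: "\<omega> \<in> bforms K n n"
  shows "coact K (\<tau> \<omega>) = tensor_lift (\<lambda>a w. a \<otimes> \<tau> w) (coact K \<omega>)"
proof -
  have b: "cbilin (\<lambda>a w. a \<otimes> \<tau> w)" by (intro clin_intros)
  have b2: "cbilin (\<lambda>a v. tensor_lift (\<lambda>b w. (a * b) \<otimes> \<tau> (v * w)) (coact K (\<tau> \<omega>)))" by (intro clin_intros)
  have mem: "coact K (\<tau> \<omega>) \<in> tspan UNIV M" by (rule coact_forms[OF \<tau>_mem])
  have "tensor_lift (\<lambda>a w. a \<otimes> \<tau> w) (coact K \<omega>) = tensor_lift (\<lambda>a w. a \<otimes> \<tau> w) (coact K (\<kappa> * \<tau> \<omega>))"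
    by (simp add: \<kappa>_\<tau>_in \<omega>)
  also have "\<dots> = tensor_lift (\<lambda>b w. b \<otimes> \<tau> (\<kappa> * w)) (coact K (\<tau> \<omega>))"
    unfolding sweedler_mult[OF b] coact_\<kappa> tensor_lift_tens[OF b2] by simp
  also have "\<dots> = tensor_lift (\<otimes>) (coact K (\<tau> \<omega>))"
    by (rule tensor_lift_cong_right[OF mem]) (intro clin_intros | simp add: \<tau>_\<kappa>)+
  finally show ?thesis by (simp add: tensor_lift_id)
qed

lemma sweedler_\<tau>:
  assumes "\<omega> \<in> bforms K n n" "cbilin \<gamma>"
  shows "tensor_lift \<gamma> (coact K (\<tau> \<omega>)) = tensor_lift (\<lambda>a w. \<gamma> a (\<tau> w)) (coact K \<omega>)"
proof -
  have b: "cbilin (\<lambda>a w. a \<otimes> \<tau> w)" by (intro clin_intros)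
  show ?thesis
    unfolding coact_\<tau>[OF assms(1)] tensor_lift_compose[OF b tensor_lift_clin[OF assms(2)]] tensor_lift_tens[OF assms(2)] ..
qed

text \<open>The value at \<open>e\<^sub>0 p\<close> is the product \<open>e\<^sub>0 \<tau>(p q) e\<close>, and its coaction is the product of the coactions of
  the factors. Collecting the contributions of \<open>q\<close> and \<open>e\<close> shows that the product of their coactions, with
  values in the functionals \<open>ext_form q' \<cdot> e'\<close>, makes evaluation equivariant.\<close>

lemma ext_form_coaction:
  assumes q: "q \<in> Q" and e: "e \<in> dolb K"
  shows "\<exists>t\<in>tspan UNIV can.dual. \<forall>\<alpha>\<in>row n. act ev t \<alpha> = coact K (ext_form q \<alpha> * e)"
proof -
  define \<beta> where "\<beta> q e = can.dual_ract (ext_form (subspace_proj Q q)) e" for q e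
  have F': "clin (\<lambda>q. ext_form (subspace_proj Q q))"
    by (rule clinear_onI)
       (simp_all add: clin_add[OF subspace_proj_clin[OF Q_sub]] clin_scale[OF subspace_proj_clin[OF Q_sub]]
         clinear_on_add[OF ext_form_clin] clinear_on_scale[OF ext_form_clin] subspace_proj_mem[OF Q_sub])
  have rl: "clin (\<lambda>v. can.dual_ract v w)" "clin (\<lambda>w. can.dual_ract v w)" for v w
    using dual_ract_cbilin by (simp_all add: cbilin_iff)
  have \<beta>l: "clin (\<lambda>q. \<beta> q e)" "clin (\<lambda>e. \<beta> q e)" for q e
    unfolding \<beta>_def by (rule clin_compose[OF rl(1) F'], rule rl(2))
  have \<beta>: "cbilin \<beta>" using \<beta>l by (simp add: cbilin_iff)
  have \<beta>_eq: "\<beta> q e = can.dual_ract (ext_form q) e" if "q \<in> Q" for q e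
    by (simp add: \<beta>_def subspace_proj_id[OF Q_sub that])
  have cq: "coact K q \<in> tspan UNIV Q" by (rule coact_bforms[OF q])
  have ce: "coact K e \<in> tspan UNIV (dolb K)" using row_coact[of e 0] e by (simp add: dolb_row)
  define t where "t = tensor_prod UNIV UNIV \<beta> (coact K q) (coact K e)"
  have t: "t \<in> tspan UNIV can.dual"
    unfolding t_def
    by (rule tensor_prod_mem[OF Q_sub dolb_sub can.dual_sub cq ce \<beta>]) (simp add: \<beta>_eq can.dual_ract_mem ext_form_dual)
  have "act ev t \<alpha> = coact K (ext_form q \<alpha> * e)" if \<alpha>: "\<alpha> \<in> row n" for \<alpha>
  proof (rule row_eqI[OF clin_on[OF act_lin(2)] _ _ \<alpha>])
    show "clinear_on (row n) (\<lambda>\<alpha>. coact K (ext_form q \<alpha> * e))"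
      by (rule clinear_onI)
         (simp_all add: clinear_on_add[OF ext_form_lin[OF q]] clinear_on_scale[OF ext_form_lin[OF q]] distrib_right
           clin_add[OF coact_clin] mult_scaleC_left clin_scale[OF coact_clin])
    fix e0 p assume e0: "e0 \<in> dolb K" and p: "p \<in> P"
    have ce0: "coact K e0 \<in> tspan UNIV (dolb K)" using row_coact[of e0 0] e0 by (simp add: dolb_row)
    have cp: "coact K p \<in> tspan UNIV P" by (rule coact_bforms[OF p])
    have val: "ev (\<beta> q' e') (v * p') = v * \<tau> (p' * q') * e'"
      if "v \<in> dolb K" "p' \<in> P" "q' \<in> Q" "e' \<in> dolb K" for v p' q' e'
      using ev_eq[OF can.dual_ract_mem[OF ext_form_dual] can.l_mem[OF _ P_row]] that
      by (simp add: \<beta>_eq can.dual_ract_def ext_form_mult)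
    have b1: "cbilin (\<lambda>b z. (a * b) \<otimes> ev z x)" for a :: 'a and x by (intro clin_intros)
    have b2: "cbilin (\<lambda>c x. tensor_lift (\<lambda>a q'. tensor_lift (\<lambda>b e'. (c * (a * b)) \<otimes> ev (\<beta> q' e') x) (coact K e)) (coact K q))"
      by (intro clin_intros \<beta>l)
    have b3: "cbilin (\<lambda>a y. tensor_lift (\<lambda>b e'. (a * b) \<otimes> (y * e')) (coact K e))" by (intro clin_intros)
    have b4: "cbilin (\<lambda>c y. tensor_lift (\<lambda>b e'. (c1 * c * b) \<otimes> (v * y * e')) (coact K e))" for c1 :: 'a and v by (intro clin_intros)
    have b5: "cbilin (\<lambda>c y. tensor_lift (\<lambda>b e'. (c1 * c * b) \<otimes> (v * \<tau> y * e')) (coact K e))" for c1 :: 'a and v by (intro clin_intros)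
    have "act ev t (e0 * p) = tensor_lift (\<lambda>c1 v. tensor_lift (\<lambda>c2 p'. tensor_lift (\<lambda>a q'. tensor_lift (\<lambda>b e'.
        (c1 * c2 * (a * b)) \<otimes> ev (\<beta> q' e') (v * p')) (coact K e)) (coact K q)) (coact K p)) (coact K e0)"
      unfolding act_def t_def tensor_prod_lift[OF \<beta> b1] sweedler_mult[OF b2] ..
    also have "\<dots> = tensor_lift (\<lambda>c1 v. tensor_lift (\<lambda>c2 p'. tensor_lift (\<lambda>a q'. tensor_lift (\<lambda>b e'.
        (c1 * (c2 * a) * b) \<otimes> (v * \<tau> (p' * q') * e')) (coact K e)) (coact K q)) (coact K p)) (coact K e0)"
      by (rule tensor_lift_cong_right[OF ce0], (intro clin_intros \<beta>l)+,
          rule tensor_lift_cong_right[OF cp], (intro clin_intros \<beta>l)+,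
          rule tensor_lift_cong_right[OF cq], (intro clin_intros \<beta>l)+,
          rule tensor_lift_cong_right[OF ce], (intro clin_intros \<beta>l)+)
         (simp add: val mult.assoc)
    also have "\<dots> = coact K (e0 * \<tau> (p * q) * e)"
    proof -
      have "coact K (e0 * \<tau> (p * q) * e) = tensor_lift (\<lambda>a y. tensor_lift (\<lambda>b e'. (a * b) \<otimes> (y * e')) (coact K e)) (coact K (e0 * \<tau> (p * q)))"
        unfolding coact_mult by (simp add: tensor_prod_def)
      then show ?thesis
        unfolding sweedler_mult[OF b3] sweedler_\<tau>[OF PQ_mem[OF p q] b4] sweedler_mult[OF b5] by simp
    qed
    finally show "act ev t (e0 * p) = coact K (ext_form q (e0 * p) * e)" by (simp add: ext_form_mult q e0 p)
  qed
  with t show ?thesis by blast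
qed

sublocale dual: canonical_dual H K n "{..<N2}" gen "\<lambda>i. ext_form (q2 i)"
proof unfold_locales
  fix \<phi> assume \<phi>: "\<phi> \<in> can.dual"
  have "\<forall>i<N2. \<exists>t. t \<in> tspan UNIV can.dual \<and> (\<forall>\<alpha>\<in>row n. act ev t \<alpha> = coact K (ext_form (q2 i) \<alpha> * \<phi> (gen i)))"
    using ext_form_coaction[OF q2] can.dual_mem[OF \<phi> P_row[OF gen_mem]] by blast
  then obtain t where t: "\<And>i. i < N2 \<Longrightarrow> t i \<in> tspan UNIV can.dual"
    "\<And>i \<alpha>. i < N2 \<Longrightarrow> \<alpha> \<in> row n \<Longrightarrow> act ev (t i) \<alpha> = coact K (ext_form (q2 i) \<alpha> * \<phi> (gen i))"
    by metis
  have "act ev (\<Sum>i<N2. t i) \<alpha> = coact K (\<phi> \<alpha>)" if \<alpha>: "\<alpha> \<in> row n" for \<alpha>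
  proof -
    have "\<phi> \<alpha> = (\<Sum>i<N2. can.dual_ract (ext_form (q2 i)) (\<phi> (gen i))) \<alpha>"
      by (subst basis.dual_expansion[OF \<phi>]) (rule refl)
    also have "\<dots> = (\<Sum>i<N2. ext_form (q2 i) \<alpha> * \<phi> (gen i))" by (simp add: sum_fun_apply can.dual_ract_def)
    finally show ?thesis by (simp add: clin_sum[OF act_lin(1)] t(2) \<alpha> clin_sum[OF coact_clin])
  qed
  moreover have "(\<Sum>i<N2. t i) \<in> tspan UNIV can.dual"
    by (rule cvec.subspace_sum[OF tspan_subspace]) (simp add: t(1))
  ultimately show "\<exists>t\<in>tspan UNIV can.dual. \<forall>\<alpha>\<in>row n. act ev t \<alpha> = coact K (\<phi> \<alpha>)" by blast
qed

lemma canonical_dg0: "dg0_lproj H K X"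
  unfolding dg0_lproj_def
proof (intro conjI canonical_dg_bimodule)
  have b: "left_projective (dolb K) (*) (row n)" "finitely_generated_by (dolb K) (*) (gen ` {..<N2}) (row n)"
    using can.dual_basis_projective[of "{..<N2}" "\<lambda>i. ext_form (q2 i)" gen] row_expansion
    by (simp_all add: ext_form_dual q2 gen_mem P_row)
  show "left_projective (dolb K) (lact X) (mcarrier X)" using b(1) by (simp add: X_simps)
  show "\<exists>G\<subseteq>mcomp X 0. finitely_generated_by (dolb K) (lact X) G (mcarrier X)"
    using b(2) gen_mem by (intro exI[of _ "gen ` {..<N2}"]) (auto simp: X_simps)
qed

lemma dual_dg0: "dg0_lproj H K dual.Y"
proof -
  interpret inv: invertible_bimodule "dolb K" "(*)" rtwist "row n" "{..<N1}" p1 "\<lambda>i. ext_form (q1 i)" by (rule D_invertible)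
  show ?thesis
    unfolding dg0_lproj_def
  proof (intro conjI dual.dual_dg_bimodule)
    show "left_projective (dolb K) (lact dual.Y) (mcarrier dual.Y)"
      using inv.dual_projective by (simp add: dual.Y_simps)
    show "\<exists>G\<subseteq>mcomp dual.Y 0. finitely_generated_by (dolb K) (lact dual.Y) G (mcarrier dual.Y)"
      using inv.dual_finitely_generated ext_form_hdual q1
      by (intro exI[of _ "(\<lambda>i. ext_form (q1 i)) ` {..<N1}"]) (auto simp: dual.Y_simps)
  qed
qed

lemma canonical_invertible: "invertible H K X"
proof -
  interpret D: invertible_bimodule "dolb K" "(*)" rtwist "row n" "{..<N1}" p1 "\<lambda>i. ext_form (q1 i)" by (rule D_invertible)
  interpret P: invertible_bimodule M "(*)" rtwist P "{..<N1}" p1 "\<lambda>i. form (q1 i)" by (rule MP_invertible)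
  have 1: "evaluation_bimodule_iso M (*) rtwist P (\<lambda>m \<phi> x. if x \<in> P then \<phi> (rtwist x m) else 0) (\<lambda>\<phi> m x. \<phi> x * m) MP.dual"
    using P.evaluation_iso by (simp add: MP.dual_lact_def[abs_def] MP.dual_ract_def[abs_def])
  have 2: "evaluation_bimodule_iso (dolb K) (*) rtwist (row n) (lact dual.Y) (ract dual.Y) (mcarrier dual.Y)"
    using D.evaluation_iso by (simp add: dual.Y_simps)
  show ?thesis
    unfolding invertible_def X_simps
    using canonical_dg0 dual_dg0 dual.Y_is_dual 1 2 by blast
qed

lemma canonical_holomorphic: "holomorphic_vector_bundle H K X"
  unfolding holomorphic_vector_bundle_def X_simps
  using canonical_left_dg_module iso_DP P_projective P_finitely_generated by blast

end

theorem proposition8p6: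
  fixes H :: "('a::complex_algebra_1) hopf"
    and K :: "('a, 'w::complex_algebra_1) kaehler"
    and n :: nat
    and f :: "'w \<Rightarrow> complex"
  assumes "hopf_star_algebra H"
    and "kaehler_structure H n K"
    and "positive_definite n K"
    and "is_state K f"
    and "closed_integral n K f"
    and "factorisable K"
  shows "holomorphic_vector_bundle H K (canonical_bundle n K) \<and>
         invertible H K (canonical_bundle n K)"
proof -
  interpret kaehler_factorisable H K n
    using assms by unfold_locales (simp_all add: kaehler_structure_def)
  obtain N1 p1 q1 where 1: "\<And>i. i < (N1::nat) \<Longrightarrow> p1 i \<in> P" "\<And>i. i < N1 \<Longrightarrow> q1 i \<in> Q"
    "\<kappa> = (\<Sum>i<N1. p1 i * q1 i)"
    by (rule PQ.tensor_iso_sum[OF iso_PQ \<kappa>_mem]) (rule that)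
  obtain N2 q2 p2 where 2: "\<And>i. i < (N2::nat) \<Longrightarrow> q2 i \<in> Q" "\<And>i. i < N2 \<Longrightarrow> p2 i \<in> P"
    "\<kappa> = (\<Sum>i<N2. q2 i * p2 i)"
    by (rule QP.tensor_iso_sum[OF iso_QP \<kappa>_mem]) (rule that)
  interpret kaehler_bases H K n N1 p1 q1 N2 q2 p2
    using 1 2 by unfold_locales
  show ?thesis
    using canonical_holomorphic canonical_invertible by blast
qed

end
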